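(* Let $F$ be a non-commutative random variable in the second Wigner chaos such that $\varphi(F^2)=\varphi(F_\infty^2)=1$ and $\varphi(F^4)\ge\varphi(F_\infty^4)=5/2$, where $F_\infty=(S_1^2-S_2^2)/\sqrt2$ has the tetilla law ($S_1,S_2$ freely independent centered semicircular of unit variance). Then $\varphi(F^{2n})\ge\varphi(F_\infty^{2n})$ for every positive integer $n$, and if this inequality is an equality for some $n\ge3$, then $F$ and $F_\infty$ have the same distribution.
   Context: Let $(\mathcal A,\varphi)$ be a free probability space (von Neumann algebra with faithful, positive, weakly continuous, unital trace) carrying a free Brownian motion $S$. The second Wigner chaos is the set of Wigner double integrals $I_2^S(f)$, $f\in L^2(\mathbb R_+^2)$ real and symmetric; equivalently, its elements are the $F=\sum_{z\in\mathbb Z}\lambda_z(S_z^2-1)$ with $(S_z)$ freely independent centered semicircular variables of unit variance, $\lambda_z$ real, $\sum_z\lambda_z^2=\varphi(F^2)<\infty$ (convergence in $L^2(\mathcal A,\varphi)$). The law of a self-adjoint $F$ is the probability measure $Q$ on $\mathbb R$ with $\varphi(F^n)=\int x^nQ(dx)$ for all $n$. *)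

theory Defs
  imports "HOL-Probability.Probability"
begin

class complex_vector = real_vector +
  fixes scaleC :: "complex \<Rightarrow> 'a \<Rightarrow> 'a" (infixr "*\<^sub>C" 75)
  assumes scaleC_add_right: "c *\<^sub>C (x + y) = c *\<^sub>C x + c *\<^sub>C y"
    and scaleC_add_left: "(c + d) *\<^sub>C x = c *\<^sub>C x + d *\<^sub>C x"
    and scaleC_scaleC: "c *\<^sub>C d *\<^sub>C x = (c * d) *\<^sub>C x"
    and scaleC_of_real: "complex_of_real r *\<^sub>C x = r *\<^sub>R x"

text \<open>The inner product is linear in its second argument.\<close>

class chilbert_space = complex_vector + banach +
  fixes cinner :: "'a \<Rightarrow> 'a \<Rightarrow> complex"
  assumes cinner_commute: "cinner x y = cnj (cinner y x)"
    and cinner_add_right: "cinner x (y + z) = cinner x y + cinner x z"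
    and cinner_scaleC_right: "cinner x (c *\<^sub>C y) = c * cinner x y"
    and cinner_norm: "cinner x x = complex_of_real ((norm x)\<^sup>2)"

definition bounded_clinear :: "('h::chilbert_space \<Rightarrow> 'h) \<Rightarrow> bool" where
  "bounded_clinear f \<longleftrightarrow> bounded_linear f \<and> (\<forall>c x. f (c *\<^sub>C x) = c *\<^sub>C f x)"

typedef (overloaded) 'h bop = "{f :: 'h::chilbert_space \<Rightarrow> 'h. bounded_clinear f}"
  morphisms apply_bop Bop
  by (rule exI[of _ "\<lambda>x. x"]) (simp add: bounded_clinear_def bounded_linear_ident)

setup_lifting type_definition_bop

lemma scaleC_zero_right: "c *\<^sub>C (0::'a::complex_vector) = 0"
  using scaleC_add_right[of c "0::'a" 0] by simp

lemma scaleC_minus_right: "c *\<^sub>C (- x) = - (c *\<^sub>C (x::'a::complex_vector))"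
  using scaleC_add_right[of c x "- x"] by (simp add: scaleC_zero_right eq_neg_iff_add_eq_0 add.commute)

lemma scaleC_diff_right: "c *\<^sub>C (x - y) = c *\<^sub>C x - c *\<^sub>C (y::'a::complex_vector)"
  using scaleC_add_right[of c x "- y"] by (simp add: scaleC_minus_right)

lemma scaleC_scaleR: "c *\<^sub>C (r *\<^sub>R x) = r *\<^sub>R (c *\<^sub>C (x::'a::complex_vector))"
  by (simp add: scaleC_scaleC mult.commute flip: scaleC_of_real)

lemma bounded_linear_scaleC: "bounded_linear (\<lambda>x::'h::chilbert_space. c *\<^sub>C x)"
proof (rule bounded_linear_intro[where K = "cmod c"])
  fix x y :: 'h and r :: real
  show "c *\<^sub>C (x + y) = c *\<^sub>C x + c *\<^sub>C y" by (rule scaleC_add_right)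
  show "c *\<^sub>C (r *\<^sub>R x) = r *\<^sub>R c *\<^sub>C x" by (rule scaleC_scaleR)
  have "complex_of_real ((norm (c *\<^sub>C x))\<^sup>2) = c * cnj (c * cinner x x)"
    by (metis cinner_norm cinner_scaleC_right cinner_commute)
  also have "\<dots> = complex_of_real ((cmod c * norm x)\<^sup>2)"
    by (simp add: cinner_norm power_mult_distrib flip: complex_norm_square mult.assoc)
  finally have "(norm (c *\<^sub>C x))\<^sup>2 = (cmod c * norm x)\<^sup>2"
    by (simp only: of_real_eq_iff)
  then have "norm (c *\<^sub>C x) = cmod c * norm x"
    by (simp add: power2_eq_iff_nonneg)
  then show "norm (c *\<^sub>C x) \<le> norm x * cmod c" by (simp add: mult.commute)
qed

text \<open>Multiplication of operators is composition; there is no \<open>ring_1\<close> instance because the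
  Hilbert space may be trivial.\<close>

instantiation bop :: (chilbert_space) "{ring, monoid_mult}"
begin

lift_definition zero_bop :: "'a bop" is "\<lambda>_. 0"
  by (simp add: bounded_clinear_def scaleC_zero_right)
lift_definition one_bop :: "'a bop" is "\<lambda>x. x"
  by (simp add: bounded_clinear_def bounded_linear_ident)
lift_definition plus_bop :: "'a bop \<Rightarrow> 'a bop \<Rightarrow> 'a bop" is "\<lambda>f g x. f x + g x"
  by (simp add: bounded_clinear_def bounded_linear_add scaleC_add_right)
lift_definition uminus_bop :: "'a bop \<Rightarrow> 'a bop" is "\<lambda>f x. - f x"
  by (simp add: bounded_clinear_def bounded_linear_minus scaleC_minus_right)
lift_definition minus_bop :: "'a bop \<Rightarrow> 'a bop \<Rightarrow> 'a bop" is "\<lambda>f g x. f x - g x"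
  by (simp add: bounded_clinear_def bounded_linear_sub scaleC_diff_right)
lift_definition times_bop :: "'a bop \<Rightarrow> 'a bop \<Rightarrow> 'a bop" is "\<lambda>f g x. f (g x)"
  by (simp add: bounded_clinear_def bounded_linear_compose)

instance
proof
  fix a b c :: "'a bop"
  show "a + b + c = a + (b + c)" by transfer (simp add: add.assoc)
  show "a + b = b + a" by transfer (simp add: add.commute)
  show "0 + a = a" by transfer simp
  show "- a + a = 0" by transfer simp
  show "a - b = a + - b" by transfer simp
  show "a * b * c = a * (b * c)" by transfer simp
  show "1 * a = a" by transfer simp
  show "a * 1 = a" by transfer simp
  show "(a + b) * c = a * c + b * c" by transfer simp
  show "a * (b + c) = a * b + a * c"
    by transfer (simp add: bounded_clinear_def linear_add bounded_linear.linear)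
qed

end

instantiation bop :: (chilbert_space) "{real_algebra, complex_vector}"
begin

lift_definition scaleR_bop :: "real \<Rightarrow> 'a bop \<Rightarrow> 'a bop" is "\<lambda>r f x. r *\<^sub>R f x"
  by (simp add: bounded_clinear_def bounded_linear_const_scaleR scaleC_scaleR)
lift_definition scaleC_bop :: "complex \<Rightarrow> 'a bop \<Rightarrow> 'a bop" is "\<lambda>c f x. c *\<^sub>C f x"
  by (simp add: bounded_clinear_def scaleC_scaleC mult.commute
      bounded_linear_compose[OF bounded_linear_scaleC])

instance
proof
  fix a b :: "'a bop" and r q :: real and c d :: complex
  show "r *\<^sub>R (a + b) = r *\<^sub>R a + r *\<^sub>R b" by transfer (simp add: scaleR_add_right)
  show "(r + q) *\<^sub>R a = r *\<^sub>R a + q *\<^sub>R a" by transfer (simp add: scaleR_add_left)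
  show "r *\<^sub>R q *\<^sub>R a = (r * q) *\<^sub>R a" by transfer simp
  show "1 *\<^sub>R a = a" by transfer simp
  show "r *\<^sub>R a * b = r *\<^sub>R (a * b)" by transfer simp
  show "a * r *\<^sub>R b = r *\<^sub>R (a * b)"
    by transfer (simp add: bounded_clinear_def linear_scale bounded_linear.linear)
  show "c *\<^sub>C (a + b) = c *\<^sub>C a + c *\<^sub>C b" by transfer (simp add: scaleC_add_right)
  show "(c + d) *\<^sub>C a = c *\<^sub>C a + d *\<^sub>C a" by transfer (simp add: scaleC_add_left)
  show "c *\<^sub>C d *\<^sub>C a = (c * d) *\<^sub>C a" by transfer (simp add: scaleC_scaleC)
  show "complex_of_real r *\<^sub>C a = r *\<^sub>R a" by transfer (simp add: scaleC_of_real)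
qed

end

definition is_adjoint :: "'h::chilbert_space bop \<Rightarrow> 'h bop \<Rightarrow> bool" where
  "is_adjoint A B \<longleftrightarrow> (\<forall>x y. cinner x (apply_bop A y) = cinner (apply_bop B x) y)"

definition adj :: "'h::chilbert_space bop \<Rightarrow> 'h bop" where
  "adj A = (THE B. is_adjoint A B)"

definition self_adjoint :: "'h::chilbert_space bop \<Rightarrow> bool" where
  "self_adjoint A \<longleftrightarrow> is_adjoint A A"

definition commutant :: "'h::chilbert_space bop set \<Rightarrow> 'h bop set" where
  "commutant M = {T. \<forall>A\<in>M. T * A = A * T}"

definition von_neumann_algebra :: "'h::chilbert_space bop set \<Rightarrow> bool" where
  "von_neumann_algebra M \<longleftrightarrow>
     (\<forall>A\<in>M. \<exists>B\<in>M. is_adjoint A B) \<and> commutant (commutant M) = M"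

text \<open>The ultraweak topology is finer than the weak operator topology, so a functional that is
  continuous for the latter is continuous for the former.\<close>

definition ultraweak_topology :: "'h::chilbert_space bop topology" where
  "ultraweak_topology = topology_generated_by
     {{A. (\<Sum>n. cinner (x n) (apply_bop A (y n))) \<in> U} | x y U.
        open U \<and> summable (\<lambda>n. (norm (x n))\<^sup>2) \<and> summable (\<lambda>n. (norm (y n))\<^sup>2)}"

definition free_probability_space ::
  "'h::chilbert_space bop set \<Rightarrow> ('h bop \<Rightarrow> complex) \<Rightarrow> bool" where
  "free_probability_space M \<phi> \<longleftrightarrow>
     von_neumann_algebra M \<and>
     (\<forall>A\<in>M. \<forall>B\<in>M. \<phi> (A + B) = \<phi> A + \<phi> B) \<and>
     (\<forall>c. \<forall>A\<in>M. \<phi> (c *\<^sub>C A) = c * \<phi> A) \<and>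
     \<phi> 1 = 1 \<and>
     (\<forall>A\<in>M. \<phi> (adj A * A) \<in> \<real>\<^sub>\<ge>\<^sub>0) \<and>
     (\<forall>A\<in>M. \<phi> (adj A * A) = 0 \<longrightarrow> A = 0) \<and>
     (\<forall>A\<in>M. \<forall>B\<in>M. \<phi> (A * B) = \<phi> (B * A)) \<and>
     continuous_map (subtopology ultraweak_topology M) euclidean \<phi>"

definition is_law :: "('h::chilbert_space bop \<Rightarrow> complex) \<Rightarrow> 'h bop \<Rightarrow> real measure \<Rightarrow> bool" where
  "is_law \<phi> F Q \<longleftrightarrow> prob_space Q \<and> sets Q = sets borel \<and>
     (\<forall>n::nat. integrable Q (\<lambda>x. x ^ n) \<and> \<phi> (F ^ n) = complex_of_real (LINT x|Q. x ^ n))"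

text \<open>For a self-adjoint \<open>F\<close> the law exists and is unique, because \<open>F\<close> is bounded.\<close>

definition law :: "('h::chilbert_space bop \<Rightarrow> complex) \<Rightarrow> 'h bop \<Rightarrow> real measure" where
  "law \<phi> F = (THE Q. is_law \<phi> F Q)"

definition semicircle_distribution :: "real \<Rightarrow> real measure" where
  "semicircle_distribution v = density lborel
     (\<lambda>x. ennreal (sqrt (4 * v - x\<^sup>2) / (2 * pi * v)) * indicator {- 2 * sqrt v .. 2 * sqrt v} x)"

definition semicircular :: "('h::chilbert_space bop \<Rightarrow> complex) \<Rightarrow> real \<Rightarrow> 'h bop \<Rightarrow> bool" where
  "semicircular \<phi> v X \<longleftrightarrow> self_adjoint X \<and> is_law \<phi> X (semicircle_distribution v)"

inductive_set generated_algebra :: "'h::chilbert_space bop \<Rightarrow> 'h bop set" for X where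
  gen: "X \<in> generated_algebra X"
| one: "1 \<in> generated_algebra X"
| add: "A \<in> generated_algebra X \<Longrightarrow> B \<in> generated_algebra X \<Longrightarrow> A + B \<in> generated_algebra X"
| scale: "A \<in> generated_algebra X \<Longrightarrow> c *\<^sub>C A \<in> generated_algebra X"
| mult: "A \<in> generated_algebra X \<Longrightarrow> B \<in> generated_algebra X \<Longrightarrow> A * B \<in> generated_algebra X"

text \<open>A list of pairs \<open>(i\<^sub>1, p\<^sub>1), \<dots>, (i\<^sub>k, p\<^sub>k)\<close> encodes an alternating product
  \<open>p\<^sub>1 \<cdots> p\<^sub>k\<close> of centered elements of the unital algebras generated by the \<open>X i\<^sub>j\<close>.\<close>

definition freely_independent ::
  "('h::chilbert_space bop \<Rightarrow> complex) \<Rightarrow> 'i set \<Rightarrow> ('i \<Rightarrow> 'h bop) \<Rightarrow> bool" where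
  "freely_independent \<phi> I X \<longleftrightarrow>
     (\<forall>ps :: ('i \<times> 'h bop) list.
        ps \<noteq> [] \<and>
        (\<forall>(i, p)\<in>set ps. i \<in> I \<and> p \<in> generated_algebra (X i) \<and> \<phi> p = 0) \<and>
        (\<forall>k. Suc k < length ps \<longrightarrow> fst (ps ! k) \<noteq> fst (ps ! Suc k))
        \<longrightarrow> \<phi> (prod_list (map snd ps)) = 0)"

definition subdivision :: "nat \<Rightarrow> (nat \<Rightarrow> real) \<Rightarrow> bool" where
  "subdivision m t \<longleftrightarrow> 0 \<le> t 0 \<and> (\<forall>i<m. t i < t (Suc i))"

definition free_brownian_motion ::
  "'h::chilbert_space bop set \<Rightarrow> ('h bop \<Rightarrow> complex) \<Rightarrow> (real \<Rightarrow> 'h bop) \<Rightarrow> bool" where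
  "free_brownian_motion M \<phi> S \<longleftrightarrow>
     (\<forall>t\<ge>0. S t \<in> M \<and> self_adjoint (S t)) \<and> S 0 = 0 \<and>
     (\<forall>s t. 0 \<le> s \<and> s < t \<longrightarrow> semicircular \<phi> (t - s) (S t - S s)) \<and>
     (\<forall>m t. subdivision m t \<longrightarrow> freely_independent \<phi> {..<m} (\<lambda>i. S (t (Suc i)) - S (t i)))"

text \<open>Elementary kernels are the step functions on a product grid that vanish on the diagonal
  cells; on these the Wigner double integral is given by a finite sum of products of increments,
  and it extends to all square-integrable kernels by the isometry property.\<close>

definition elementary_kernel ::
  "nat \<Rightarrow> (nat \<Rightarrow> real) \<Rightarrow> (nat \<Rightarrow> nat \<Rightarrow> real) \<Rightarrow> real \<times> real \<Rightarrow> real" where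
  "elementary_kernel m t a z = (\<Sum>i<m. \<Sum>j<m. a i j *
     indicator {t i <.. t (Suc i)} (fst z) * indicator {t j <.. t (Suc j)} (snd z))"

definition elementary_integral ::
  "(real \<Rightarrow> 'h::chilbert_space bop) \<Rightarrow> nat \<Rightarrow> (nat \<Rightarrow> real) \<Rightarrow> (nat \<Rightarrow> nat \<Rightarrow> real) \<Rightarrow> 'h bop" where
  "elementary_integral S m t a = (\<Sum>i<m. \<Sum>j<m. a i j *\<^sub>R
     ((S (t (Suc i)) - S (t i)) * (S (t (Suc j)) - S (t j))))"

abbreviation quadrant :: "(real \<times> real) set" where
  "quadrant \<equiv> {0..} \<times> {0..}"

definition L2_kernel :: "(real \<times> real \<Rightarrow> real) \<Rightarrow> bool" where
  "L2_kernel f \<longleftrightarrow> set_borel_measurable lborel quadrant f \<and>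
     set_integrable lborel quadrant (\<lambda>z. (f z)\<^sup>2)"

definition symmetric_kernel :: "(real \<times> real \<Rightarrow> real) \<Rightarrow> bool" where
  "symmetric_kernel f \<longleftrightarrow> (AE z in lborel. z \<in> quadrant \<longrightarrow> f z = f (prod.swap z))"

definition is_wigner_integral2 ::
  "('h::chilbert_space bop \<Rightarrow> complex) \<Rightarrow> (real \<Rightarrow> 'h bop) \<Rightarrow> (real \<times> real \<Rightarrow> real) \<Rightarrow> 'h bop \<Rightarrow> bool"
  where
  "is_wigner_integral2 \<phi> S f F \<longleftrightarrow>
     (\<exists>m t a. (\<forall>k::nat. subdivision (m k) (t k) \<and> (\<forall>i. a k i i = 0)) \<and>
        (\<lambda>k. LINT z:quadrant|lborel. (elementary_kernel (m k) (t k) (a k) z - f z)\<^sup>2)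
          \<longlonglongrightarrow> 0 \<and>
        (\<lambda>k. \<phi> (adj (elementary_integral S (m k) (t k) (a k) - F) *
                  (elementary_integral S (m k) (t k) (a k) - F))) \<longlonglongrightarrow> 0)"

definition second_wigner_chaos ::
  "'h::chilbert_space bop set \<Rightarrow> ('h bop \<Rightarrow> complex) \<Rightarrow> (real \<Rightarrow> 'h bop) \<Rightarrow> 'h bop set" where
  "second_wigner_chaos M \<phi> S =
     {F \<in> M. \<exists>f. L2_kernel f \<and> symmetric_kernel f \<and> is_wigner_integral2 \<phi> S f F}"

end

theory Submission
  imports Defs "Jordan_Normal_Form.Schur_Decomposition"
begin

text \<open>
  An element of the second chaos is an L2-limit of quadratic forms in free semicircular variables
  whose matrices B are symmetric with zero diagonal. For such a form the Schwinger-Dyson equation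
  yields the moment-cumulant relation with free cumulants tr B^j, so by Lagrange inversion the even
  moments are nonnegative combinations of even coefficients of powers of f(w) = sum of
  tr B^(j+2) w^j, the moment series of a probability measure (the eigenvalues, weighted by their
  squares). Even coefficients of powers of f are nonnegative by Hunter's positivity of complete
  homogeneous symmetric polynomials of even degree. Gauss quadrature replaces the measure by one
  on two points with the same first moments, decreasing these coefficients, and among two-point
  measures with second moment at least 1/2 they are smallest for the symmetric one, which is the
  tetilla law. In the case of equality the third cumulant vanishes and the fourth is 1/2, which
  again forces the measure to be the symmetric two-point one.
\<close>

text \<open>Two cones of power series carry the inequalities: \<open>fnn\<close> (all coefficients
  nonnegative) and \<open>fpos\<close>. Nonnegativity of the even coefficients alone is not stable
  under products, so \<open>fpos\<close> asks for more: the differential operator attached to the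
  series has to preserve a class of polynomials, and this property is multiplicative.

  The hard comparison is that of a two-point measure with the symmetric one when its mean is
  negative and the sum of its points is positive. The correction terms then have mixed signs, and
  the bound comes from a minimum principle in the parameters of the measure instead of a comparison
  of coefficients.

  The approximation is in L2 only, without control of operator norms, and the limit is not a finite
  quadratic form. Hence the inequalities are shown for finitely many eigenvalues and passed to the
  limit coefficient by coefficient; moment bounds for the approximants come from bounds on their
  cumulants.\<close>

hide_const (open) module.smult
alias smult = Polynomial.smult

section \<open>Traces of powers of a symmetric matrix\<close>

fun mpow :: "'i set \<Rightarrow> ('i \<Rightarrow> 'i \<Rightarrow> real) \<Rightarrow> nat \<Rightarrow> 'i \<Rightarrow> 'i \<Rightarrow> real" where
  "mpow I B 0 i j = (if i = j then 1 else 0)"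
| "mpow I B (Suc p) i j = (\<Sum>l\<in>I. B i l * mpow I B p l j)"

lemma mpow_Suc_right:
  assumes "finite I" "i \<in> I" "j \<in> I"
  shows "mpow I B (Suc p) i j = (\<Sum>l\<in>I. mpow I B p i l * B l j)"
  using assms(2)
proof (induction p arbitrary: i)
  case 0
  then show ?case using assms by (simp add: if_distrib[of "\<lambda>x. _ * x"] if_distrib[of "\<lambda>x. x * _"] sum.delta cong: if_cong)
next
  case (Suc p)
  have "mpow I B (Suc (Suc p)) i j = (\<Sum>l\<in>I. B i l * (\<Sum>k\<in>I. mpow I B p l k * B k j))"
    unfolding mpow.simps(2)[of I B "Suc p"] by (intro sum.cong refl) (simp only: Suc.IH)
  also have "\<dots> = (\<Sum>k\<in>I. (\<Sum>l\<in>I. B i l * mpow I B p l k) * B k j)"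
    unfolding sum_distrib_left sum_distrib_right by (subst sum.swap) (simp only: mult.assoc)
  finally show ?case by simp
qed

lemma mat_trace_mult_commute:
  assumes A: "A \<in> carrier_mat n n" and B: "(B :: complex mat) \<in> carrier_mat n n"
  shows "(\<Sum>i<n. (A * B) $$ (i, i)) = (\<Sum>i<n. (B * A) $$ (i, i))"
proof -
  have "(\<Sum>i<n. (A * B) $$ (i, i)) = (\<Sum>i<n. \<Sum>k<n. A $$ (i, k) * B $$ (k, i))"
    using A B by (intro sum.cong) (auto simp: scalar_prod_def lessThan_atLeast0)
  also have "\<dots> = (\<Sum>k<n. \<Sum>i<n. B $$ (k, i) * A $$ (i, k))"
    by (subst sum.swap) (simp only: mult.commute)
  also have "\<dots> = (\<Sum>i<n. (B * A) $$ (i, i))"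
    using A B by (intro sum.cong) (auto simp: scalar_prod_def lessThan_atLeast0)
  finally show ?thesis .
qed

lemma upper_triangular_pow:
  assumes B: "(B :: complex mat) \<in> carrier_mat n n" and up: "upper_triangular B"
  shows "(\<forall>i<n. \<forall>j<i. (B ^\<^sub>m k) $$ (i, j) = 0) \<and> (\<forall>i<n. (B ^\<^sub>m k) $$ (i, i) = (B $$ (i, i)) ^ k)"
proof (induction k)
  case 0
  then show ?case using B by auto
next
  case (Suc k)
  have Bk: "B ^\<^sub>m k \<in> carrier_mat n n" using B by simp
  have nth: "(B ^\<^sub>m Suc k) $$ (i, j) = (\<Sum>l<n. (B ^\<^sub>m k) $$ (i, l) * B $$ (l, j))" if "i < n" "j < n" for i j
    using that B Bk by (auto simp: scalar_prod_def lessThan_atLeast0)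
  have 1: "(B ^\<^sub>m Suc k) $$ (i, j) = 0" if "i < n" "j < i" for i j
  proof -
    have "(B ^\<^sub>m k) $$ (i, l) * B $$ (l, j) = 0" if l: "l < n" for l
    proof (cases "l < i")
      case True
      then show ?thesis using Suc \<open>i < n\<close> by simp
    next
      case False
      then have "B $$ (l, j) = 0" using up \<open>j < i\<close> l B by (auto intro!: upper_triangularD)
      then show ?thesis by simp
    qed
    then have "(\<Sum>l<n. (B ^\<^sub>m k) $$ (i, l) * B $$ (l, j)) = 0"
      by (intro sum.neutral) simp
    then show ?thesis using that by (subst nth) simp_all
  qed
  have 2: "(B ^\<^sub>m Suc k) $$ (i, i) = (B $$ (i, i)) ^ Suc k" if i: "i < n" for i
  proof -
    have "(B ^\<^sub>m k) $$ (i, l) * B $$ (l, i) = (if l = i then (B ^\<^sub>m k) $$ (i, i) * B $$ (i, i) else 0)" if l: "l < n" for l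
    proof (cases l i rule: linorder_cases)
      case less
      then show ?thesis using Suc i by simp
    next
      case greater
      then have "B $$ (l, i) = 0" using up l B by (auto intro!: upper_triangularD)
      then show ?thesis using greater by simp
    qed simp
    then have "(\<Sum>l<n. (B ^\<^sub>m k) $$ (i, l) * B $$ (l, i)) = (\<Sum>l<n. if l = i then (B ^\<^sub>m k) $$ (i, i) * B $$ (i, i) else 0)"
      by (intro sum.cong) auto
    also have "\<dots> = (B ^\<^sub>m k) $$ (i, i) * B $$ (i, i)" using i by (simp add: sum.delta)
    also have "\<dots> = (B $$ (i, i)) ^ k * B $$ (i, i)" using Suc i by metis
    finally show ?thesis using nth[OF i i] by (simp only: power_Suc2)
  qed
  show ?case using 1 2 by blast
qed

text \<open>Only traces of powers are wanted, so a Schur triangular form is enough: the diagonal of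
  a power of a triangular matrix consists of the powers of the diagonal entries. Symmetry makes the
  eigenvalues real.\<close>

lemma symmetric_trace_eigenvalues:
  fixes S :: "nat \<Rightarrow> nat \<Rightarrow> real"
  assumes sym: "\<And>i j. i < n \<Longrightarrow> j < n \<Longrightarrow> S i j = S j i"
  shows "\<exists>l. \<forall>p. (\<Sum>i<n. mpow {..<n} S p i i) = (\<Sum>a<n. l a ^ p)"
proof -
  define A where "A = mat n n (\<lambda>(i, j). complex_of_real (S i j))"
  have A: "A \<in> carrier_mat n n" by (simp add: A_def)
  have pow: "(A ^\<^sub>m p) $$ (i, j) = of_real (mpow {..<n} S p i j)" if "i < n" "j < n" for p i j
    using that
  proof (induction p arbitrary: i j)
    case 0
    then show ?case using A by auto
  next
    case (Suc p)
    have Ap: "A ^\<^sub>m p \<in> carrier_mat n n" using A by simp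
    have "(A ^\<^sub>m Suc p) $$ (i, j) = (\<Sum>l<n. (A ^\<^sub>m p) $$ (i, l) * A $$ (l, j))"
      using Suc.prems A Ap by (auto simp: scalar_prod_def lessThan_atLeast0)
    also have "\<dots> = (\<Sum>l<n. of_real (mpow {..<n} S p i l * S l j))"
      using Suc by (intro sum.cong) (auto simp: A_def)
    also have "\<dots> = of_real (mpow {..<n} S (Suc p) i j)"
      using Suc.prems by (subst mpow_Suc_right) auto
    finally show ?case .
  qed
  obtain es where es: "char_poly A = (\<Prod>a\<leftarrow>es. [:- a, 1:])" "length es = n"
    using char_poly_factorized[OF A] by blast
  obtain B P Q where dec: "schur_decomposition A es = (B, P, Q)"
    by (cases "schur_decomposition A es")
  have sim: "similar_mat_wit A B P Q" and up: "upper_triangular B" and diag: "diag_mat B = es"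
    using schur_decomposition[OF A es(1) dec] by auto
  have c: "B \<in> carrier_mat n n" "P \<in> carrier_mat n n" "Q \<in> carrier_mat n n" "Q * P = 1\<^sub>m n"
    using similar_mat_witD2[OF A sim] by auto
  have B_es: "B $$ (i, i) = es ! i" if "i < n" for i
    using that diag c(1) by (auto simp: diag_mat_def)
  have real: "e \<in> \<real>" if "e \<in> set es" for e
  proof -
    have "poly (char_poly A) e = 0"
      unfolding es(1) using that by (simp add: poly_prod_list prod_list_zero_iff)
    then have "eigenvalue A e" using eigenvalue_root_char_poly[OF A] by simp
    then obtain x where x: "x \<in> carrier_vec n" "x \<noteq> 0\<^sub>v n" "A *\<^sub>v x = e \<cdot>\<^sub>v x"
      using A by (auto simp: eigenvalue_def eigenvector_def)
    define y where "y i = vec_index x i" for i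
    have eq: "(\<Sum>j<n. of_real (S i j) * y j) = e * y i" if "i < n" for i
    proof -
      have "vec_index (A *\<^sub>v x) i = (\<Sum>j<n. of_real (S i j) * y j)"
        using that A x(1) by (auto simp: scalar_prod_def lessThan_atLeast0 A_def y_def)
      then show ?thesis using that x by (simp add: y_def)
    qed
    \<comment> \<open>The quadratic form at the eigenvector is real by symmetry, and it equals
      \<open>e\<close> times a positive number.\<close>
    define T where "T = (\<Sum>i<n. \<Sum>j<n. cnj (y i) * of_real (S i j) * y j)"
    have "T = (\<Sum>i<n. cnj (y i) * (\<Sum>j<n. of_real (S i j) * y j))"
      by (simp add: T_def sum_distrib_left mult.assoc)
    also have "\<dots> = (\<Sum>i<n. e * of_real ((cmod (y i))\<^sup>2))"
    proof (intro sum.cong refl)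
      fix i assume "i \<in> {..<n}"
      then have "cnj (y i) * (\<Sum>j<n. of_real (S i j) * y j) = e * (y i * cnj (y i))"
        by (simp add: eq)
      then show "cnj (y i) * (\<Sum>j<n. of_real (S i j) * y j) = e * of_real ((cmod (y i))\<^sup>2)"
        by (simp only: complex_norm_square)
    qed
    also have "\<dots> = e * of_real (\<Sum>i<n. (cmod (y i))\<^sup>2)"
      by (simp add: sum_distrib_left)
    finally have Te: "T = e * of_real (\<Sum>i<n. (cmod (y i))\<^sup>2)" .
    have "cnj T = (\<Sum>i<n. \<Sum>j<n. cnj (y j) * of_real (S j i) * y i)"
      unfolding T_def cnj_sum complex_cnj_mult complex_cnj_cnj complex_cnj_complex_of_real
      by (intro sum.cong refl) (simp add: sym mult_ac)
    also have "\<dots> = T" unfolding T_def by (rule sum.swap)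
    finally have "Im T = 0" by (metis Reals_cnj_iff complex_is_Real_iff)
    moreover have "(\<Sum>i<n. (cmod (y i))\<^sup>2) > 0"
    proof (rule ccontr)
      assume "\<not> ?thesis"
      then have "(\<Sum>i<n. (cmod (y i))\<^sup>2) = 0"
        by (smt (verit, ccfv_SIG) sum_nonneg zero_le_power2)
      then have "y i = 0" if "i < n" for i
        using that by (simp add: sum_nonneg_eq_0_iff)
      then have "x = 0\<^sub>v n" using x(1) by (intro eq_vecI) (auto simp: y_def)
      then show False using x(2) by simp
    qed
    ultimately have "Im e = 0" by (simp add: Te)
    then show ?thesis by (simp add: complex_is_Real_iff)
  qed
  show ?thesis
  proof (intro exI allI)
    fix p
    have Bp: "B ^\<^sub>m p \<in> carrier_mat n n" using c by simp
    have "complex_of_real (\<Sum>i<n. mpow {..<n} S p i i) = (\<Sum>i<n. (A ^\<^sub>m p) $$ (i, i))"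
      by (simp add: pow)
    also have "A ^\<^sub>m p = P * (B ^\<^sub>m p * Q)"
      using similar_mat_wit_pow_id[OF sim, of p] c Bp by (simp add: assoc_mult_mat[of _ n n _ n _ n])
    also have "(\<Sum>i<n. (P * (B ^\<^sub>m p * Q)) $$ (i, i)) = (\<Sum>i<n. (B ^\<^sub>m p * Q * P) $$ (i, i))"
      using c Bp by (intro mat_trace_mult_commute) auto
    also have "B ^\<^sub>m p * Q * P = B ^\<^sub>m p"
      using c Bp by (simp add: assoc_mult_mat[of _ n n _ n _ n])
    also have "(\<Sum>i<n. (B ^\<^sub>m p) $$ (i, i)) = (\<Sum>i<n. (es ! i) ^ p)"
      using upper_triangular_pow[OF c(1) up] by (simp add: B_es)
    also have "\<dots> = complex_of_real (\<Sum>i<n. Re (es ! i) ^ p)"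
    proof -
      have "es ! i = of_real (Re (es ! i))" if "i < n" for i
        using real[of "es ! i"] that es(2) by (simp add: of_real_Re)
      then have "(es ! i) ^ p = of_real (Re (es ! i) ^ p)" if "i < n" for i
        using that by (metis of_real_power)
      then show ?thesis by simp
    qed
    finally show "(\<Sum>i<n. mpow {..<n} S p i i) = (\<Sum>a<n. Re (es ! a) ^ p)"
      by (simp only: of_real_eq_iff)
  qed
qed

no_notation vec_index (infixl "$" 100)
unbundle no vec_syntax
unbundle fps_syntax

section \<open>Even coefficients of products of geometric series\<close>

lemma nat_cases_2:
  obtains "n = 0" | "n = 1" | p where "n = p + (2::nat)"
  by (metis One_nat_def Suc_1 add_2_eq_Suc' not0_implies_Suc)

text \<open>The operator y(D) with D = d/dt, a finite sum on each polynomial. Products of series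
  become compositions of operators, and y(D) t^N at t = 0 is N! times the N-th coefficient of
  y.\<close>

definition fps_op :: "real fps \<Rightarrow> real poly \<Rightarrow> real poly" where
  "fps_op y p = (\<Sum>j\<le>degree p. smult (y $ j) ((pderiv ^^ j) p))"

lemma degree_pderiv_funpow: "degree ((pderiv ^^ j) (p::real poly)) = degree p - j"
  by (induction j) (simp_all add: degree_pderiv)

lemma pderiv_funpow_eq_0: "j > degree p \<Longrightarrow> (pderiv ^^ j) (p::real poly) = 0"
proof (induction j)
  case (Suc j)
  show ?case
  proof (cases "j > degree p")
    case True
    then show ?thesis using Suc by simp
  next
    case False
    then have "degree ((pderiv ^^ j) p) = 0"
      using Suc.prems by (simp add: degree_pderiv_funpow)
    then show ?thesis by (simp add: pderiv_eq_0_iff)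
  qed
qed simp

lemma fps_op_bound: "degree p \<le> n \<Longrightarrow> fps_op y p = (\<Sum>j\<le>n. smult (y $ j) ((pderiv ^^ j) p))"
  unfolding fps_op_def by (rule sum.mono_neutral_left) (auto simp: pderiv_funpow_eq_0)

lemma le_degree_if_pderiv_funpow: "(pderiv ^^ j) (p::real poly) \<noteq> 0 \<Longrightarrow> j \<le> degree p"
  using pderiv_funpow_eq_0 not_le by blast

lemma pderiv_funpow_add: "(pderiv ^^ j) (p + q) = (pderiv ^^ j) p + (pderiv ^^ j) (q::real poly)"
  by (induction j) (simp_all add: pderiv_add)

lemma pderiv_funpow_smult: "(pderiv ^^ j) (smult c p) = smult c ((pderiv ^^ j) (p::real poly))"
  by (induction j) (simp_all add: pderiv_smult)

lemma pderiv_funpow_sum: "(pderiv ^^ j) (sum f A) = (\<Sum>a\<in>A. (pderiv ^^ j) (f a :: real poly))"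
proof (induction A rule: infinite_finite_induct)
  case empty
  then show ?case by (induction j) simp_all
next
  case (infinite A)
  then show ?case by (induction j) simp_all
qed (simp add: pderiv_funpow_add)

lemma smult_sum_right: "smult c (sum f A) = (\<Sum>a\<in>A. smult c (f a))"
  by (induction A rule: infinite_finite_induct) (simp_all add: smult_add_right)

lemma smult_sum_left: "smult (sum f A) p = (\<Sum>a\<in>A. smult (f a) p)"
  by (induction A rule: infinite_finite_induct) (simp_all add: smult_add_left)

lemma degree_fps_op: "degree (fps_op y p) \<le> degree p"
  unfolding fps_op_def
  by (intro degree_sum_le order_trans[OF degree_smult_le]) (auto simp: degree_pderiv_funpow)

lemma fps_op_mult: "fps_op (y * z) p = fps_op y (fps_op z p)"
proof -
  let ?n = "degree p"
  have "fps_op y (fps_op z p) = (\<Sum>i\<le>?n. smult (y $ i) ((pderiv ^^ i) (\<Sum>j\<le>?n. smult (z $ j) ((pderiv ^^ j) p))))"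
    using fps_op_bound[OF degree_fps_op] by (simp add: fps_op_def)
  also have "\<dots> = (\<Sum>i\<le>?n. \<Sum>j\<le>?n. smult (y $ i * z $ j) ((pderiv ^^ (i + j)) p))"
    by (simp add: pderiv_funpow_sum pderiv_funpow_smult smult_sum_right funpow_add)
  also have "\<dots> = (\<Sum>(i,j)\<in>{..?n} \<times> {..?n}. smult (y $ i * z $ j) ((pderiv ^^ (i + j)) p))"
    by (simp add: sum.cartesian_product)
  also have "\<dots> = (\<Sum>(i,j)\<in>{(i,j). i + j \<le> ?n}. smult (y $ i * z $ j) ((pderiv ^^ (i + j)) p))"
    by (rule sum.mono_neutral_right) (auto dest: le_degree_if_pderiv_funpow)
  also have "\<dots> = (\<Sum>(k,i)\<in>(SIGMA k:{..?n}. {..k}). smult (y $ i * z $ (k - i)) ((pderiv ^^ k) p))"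
    by (rule sum.reindex_bij_witness[of _ "\<lambda>(k,i). (i,k-i)" "\<lambda>(i,j). (i+j,i)"]) auto
  also have "\<dots> = (\<Sum>k\<le>?n. \<Sum>i\<le>k. smult (y $ i * z $ (k - i)) ((pderiv ^^ k) p))"
    by (simp add: sum.Sigma)
  also have "\<dots> = fps_op (y * z) p"
    by (simp add: fps_op_def fps_mult_nth smult_sum_left atLeast0AtMost)
  finally show ?thesis by simp
qed

lemma fps_op_add: "fps_op (y + z) p = fps_op y p + fps_op z p"
  by (simp add: fps_op_def smult_add_left sum.distrib)

lemma fps_op_const: "fps_op (fps_const c) p = smult c p"
proof -
  have "fps_op (fps_const c) p = (\<Sum>j\<le>degree p. if j = 0 then smult c p else 0)"
    unfolding fps_op_def by (rule sum.cong) auto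
  then show ?thesis by simp
qed

lemma fps_op_X: "fps_op fps_X p = pderiv p"
proof -
  have "fps_op fps_X p = (\<Sum>j\<le>Suc (degree p). if j = 1 then pderiv p else 0)"
    by (subst fps_op_bound[of p "Suc (degree p)"], simp, rule sum.cong) auto
  then show ?thesis by (simp del: sum.atMost_Suc)
qed

lemma fps_op_pderiv: "fps_op y (pderiv p) = pderiv (fps_op y p)"
  by (metis fps_op_X fps_op_mult mult.commute)

definition geo :: "real \<Rightarrow> real fps" where
  "geo x = Abs_fps (\<lambda>n. x ^ n)"

lemma geo_nth [simp]: "geo x $ n = x ^ n"
  by (simp add: geo_def)

lemma geo_mult: "(1 - fps_const x * fps_X) * geo x = 1"
proof (rule fps_ext)
  fix n show "((1 - fps_const x * fps_X) * geo x) $ n = 1 $ n"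
    by (cases n) (simp_all add: algebra_simps)
qed

lemma poly_exp_tendsto_0:
  fixes q :: "real poly"
  assumes "x > 0"
  shows "((\<lambda>s. exp (- (s / x)) * poly q s) \<longlongrightarrow> 0) at_top"
proof -
  have mono: "((\<lambda>s. s ^ i * exp (- (s / x))) \<longlongrightarrow> 0) at_top" for i
  proof -
    have "((\<lambda>s. x ^ i * ((s / x) ^ i / exp (s / x))) \<longlongrightarrow> x ^ i * 0) at_top"
      using assms
      by (intro tendsto_mult tendsto_const filterlim_compose[OF tendsto_power_div_exp_0])
         (use filterlim_tendsto_pos_mult_at_top[OF tendsto_const _ filterlim_ident, of "1/x"] in simp)
    then show ?thesis using assms by (simp add: power_divide exp_minus field_simps)
  qed
  have "((\<lambda>s. \<Sum>i\<le>degree q. coeff q i * (s ^ i * exp (- (s / x)))) \<longlongrightarrow> (\<Sum>i\<le>degree q. coeff q i * 0)) at_top"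
    by (intro tendsto_sum tendsto_mult tendsto_const mono)
  then show ?thesis by (simp add: poly_altdef sum_distrib_left mult_ac)
qed

text \<open>The polynomial solution of q - x q' = p averages p(s + x u) against the density exp(-u),
  so it inherits nonnegativity. The integral is avoided: exp(-s/x) q(s) is nonincreasing and tends
  to 0 at infinity.\<close>

lemma resolvent_nonneg_pos:
  fixes p q :: "real poly"
  assumes pq: "q - smult x (pderiv q) = p" and p: "\<And>s. poly p s \<ge> 0" and x: "x > 0"
  shows "poly q s \<ge> 0"
proof (rule ccontr)
  assume "\<not> poly q s \<ge> 0"
  define h where "h t = exp (- (t / x)) * poly q t" for t
  have der: "(h has_real_derivative - (exp (- (t / x)) / x * poly p t)) (at t)" for t
  proof -
    have "(h has_real_derivative (exp (- (t / x)) * (- (1 / x)) * poly q t + exp (- (t / x)) * poly (pderiv q) t)) (at t)"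
      unfolding h_def using x by (auto intro!: derivative_eq_intros)
    moreover have "poly p t = poly q t - x * poly (pderiv q) t"
      using pq by auto
    then have q: "poly q t = poly p t + x * poly (pderiv q) t" by simp
    have "exp (- (t / x)) * (- (1 / x)) * poly q t + exp (- (t / x)) * poly (pderiv q) t
        = - (exp (- (t / x)) / x * poly p t)"
      unfolding q using x by (simp add: field_simps)
    ultimately show ?thesis by simp
  qed
  have le: "h t \<le> h s" if "s \<le> t" for t
    by (rule DERIV_nonpos_imp_nonincreasing[OF that])
       (use der p x in \<open>force intro!: exI mult_nonneg_nonneg divide_nonneg_pos\<close>)
  have "(h \<longlongrightarrow> 0) at_top"
    unfolding h_def by (rule poly_exp_tendsto_0[OF x])
  then have "0 \<le> h s"
    by (rule tendsto_upperbound) (use le in \<open>auto simp: eventually_at_top_linorder\<close>)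
  then show False
    using \<open>\<not> poly q s \<ge> 0\<close> by (simp add: h_def zero_le_mult_iff)
qed

lemma resolvent_nonneg:
  fixes p q :: "real poly"
  assumes pq: "q - smult x (pderiv q) = p" and p: "\<And>s. poly p s \<ge> 0"
  shows "poly q s \<ge> 0"
proof (cases x "0::real" rule: linorder_cases)
  case less
  \<comment> \<open>Reflecting the variable replaces \<open>x\<close> by \<open>- x\<close>.\<close>
  let ?r = "[:0, -1::real:]"
  have "pcompose q ?r - smult (-x) (pderiv (pcompose q ?r)) = pcompose p ?r"
    using pq by (auto simp: pderiv_pcompose pcompose_diff pcompose_smult pderiv_pCons)
  from resolvent_nonneg_pos[OF this, of "-s"] show ?thesis
    using p less by (simp add: poly_pcompose)
next
  case equal
  then show ?thesis using p[of s] pq by simp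
next
  case greater
  then show ?thesis by (rule resolvent_nonneg_pos[OF pq p])
qed

text \<open>Pointwise nonnegativity alone is kept by resolvents but not by the second derivative, as
  (t^2 - 1)^2 shows; all even derivatives are included so that X^2 acts on the class as
  well.\<close>

definition even_convex :: "real poly \<Rightarrow> bool" where
  "even_convex p \<longleftrightarrow> (\<forall>i s. poly ((pderiv ^^ (2 * i)) p) s \<ge> 0)"

text \<open>A multiplicative substitute for nonnegative even coefficients. Those are not stable
  under products: X - X^3 has no negative even coefficient, its square has one.\<close>

definition fpos :: "real fps \<Rightarrow> bool" where
  "fpos y \<longleftrightarrow> (\<forall>p. even_convex p \<longrightarrow> even_convex (fps_op y p))"

lemma fpos_one [simp]: "fpos 1"
  using fps_op_const[of 1] by (simp add: fpos_def)

lemma fpos_add: "fpos y \<Longrightarrow> fpos z \<Longrightarrow> fpos (y + z)"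
  by (auto simp: fpos_def even_convex_def fps_op_add pderiv_funpow_add)

lemma fpos_mult: "fpos y \<Longrightarrow> fpos z \<Longrightarrow> fpos (y * z)"
  by (auto simp: fpos_def fps_op_mult)

lemma fpos_const: "c \<ge> 0 \<Longrightarrow> fpos (fps_const c)"
  by (auto simp: fpos_def even_convex_def fps_op_const pderiv_funpow_smult)

lemma fpos_zero [simp]: "fpos 0"
  using fpos_const[of 0] by simp

lemma fpos_power: "fpos y \<Longrightarrow> fpos (y ^ k)"
  by (induction k) (auto intro: fpos_mult)

lemma fpos_sum: "(\<And>a. a \<in> A \<Longrightarrow> fpos (f a)) \<Longrightarrow> fpos (sum f A)"
  by (induction A rule: infinite_finite_induct) (auto intro: fpos_add)

lemma fpos_X2: "fpos (fps_X ^ 2)"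
  unfolding fpos_def
proof (intro allI impI)
  fix p assume p: "even_convex p"
  have "fps_op (fps_X ^ 2) p = (pderiv ^^ 2) p"
    by (simp add: power2_eq_square fps_op_mult fps_op_X numeral_2_eq_2)
  moreover have "(pderiv ^^ (2 * i)) ((pderiv ^^ 2) p) = (pderiv ^^ (2 * Suc i)) p" for i
    unfolding mult_Suc_right add.commute[of 2] funpow_add by simp
  ultimately show "even_convex (fps_op (fps_X ^ 2) p)"
    using p unfolding even_convex_def by metis
qed

text \<open>\<open>geo x\<close> acts as the inverse of 1 - x D, which commutes with derivatives, so
  \<open>resolvent_nonneg\<close> applies to each even derivative. Together with
  \<open>fpos_mult\<close> and \<open>fpos_nth_even\<close> this is Hunter's positivity.\<close>

lemma fpos_geo: "fpos (geo x)"
  unfolding fpos_def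
proof (intro allI impI)
  fix p assume p: "even_convex p"
  define q where "q = fps_op (geo x) p"
  have "fps_op (1 - fps_const x * fps_X) q = p"
    unfolding q_def by (metis fps_op_mult geo_mult fps_op_const fps_const_1_eq_1 smult_1_left)
  moreover have "fps_op (1 - fps_const x * fps_X) q = q - smult x (pderiv q)"
  proof -
    have "1 - fps_const x * fps_X = fps_const 1 + fps_const (-x) * (fps_X::real fps)"
      by (simp flip: fps_const_neg)
    then show ?thesis
      by (simp only: fps_op_add fps_op_mult fps_op_const fps_op_X) simp
  qed
  ultimately have eq: "q - smult x (pderiv q) = p" by simp
  show "even_convex (fps_op (geo x) p)"
    unfolding even_convex_def
  proof (intro allI)
    fix i s
    have "(pderiv ^^ (2*i)) q - smult x (pderiv ((pderiv ^^ (2*i)) q)) = (pderiv ^^ (2*i)) p"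
      unfolding eq[symmetric]
      by (metis (no_types, lifting) add_diff_cancel diff_add_cancel funpow_swap1 pderiv_funpow_add pderiv_funpow_smult)
    then show "0 \<le> poly ((pderiv ^^ (2 * i)) (fps_op (geo x) p)) s"
      unfolding q_def[symmetric] by (rule resolvent_nonneg) (use p in \<open>auto simp: even_convex_def\<close>)
  qed
qed

lemma pderiv_funpow_monom: "j \<le> n \<Longrightarrow> (pderiv ^^ j) (monom (1::real) n) = monom (fact n / fact (n - j)) (n - j)"
proof (induction j)
  case (Suc j)
  then have "fact (n - j) = real (n - j) * fact (n - Suc j)"
    by (metis Suc_diff_le Suc_leD diff_Suc_Suc fact_Suc of_nat_fact of_nat_mult)
  with Suc show ?case by (simp add: pderiv_monom)
qed simp

text \<open>Test the operator on t^(2n), which is \<open>even_convex\<close>, and evaluate at 0: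
  only the derivative of order 2n survives.\<close>

lemma fpos_nth_even:
  assumes "fpos y"
  shows "y $ (2 * n) \<ge> 0"
proof -
  let ?m = "monom (1::real) (2 * n)"
  have "even_convex ?m"
    unfolding even_convex_def
  proof (intro allI)
    fix i s
    show "0 \<le> poly ((pderiv ^^ (2 * i)) ?m) s"
    proof (cases "i \<le> n")
      case True
      then have "even (2 * n - 2 * i)" by simp
      then show ?thesis using True by (simp add: pderiv_funpow_monom poly_monom zero_le_even_power)
    qed (simp add: pderiv_funpow_eq_0 degree_monom_eq)
  qed
  then have "even_convex (fps_op y ?m)"
    using assms by (simp add: fpos_def)
  then have "0 \<le> poly (fps_op y ?m) 0"
    by (metis even_convex_def funpow_0 mult_0_right)
  also have "poly (fps_op y ?m) 0 = (\<Sum>j\<le>2*n. if j = 2 * n then y $ j * fact (2 * n) else 0)"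
    unfolding fps_op_def poly_sum degree_monom_eq[OF one_neq_zero]
    by (rule sum.cong) (auto simp: pderiv_funpow_monom poly_monom)
  finally have "0 \<le> y $ (2 * n) * fact (2 * n)" by simp
  moreover have "(0::real) < fact (2 * n)" by simp
  ultimately show ?thesis
    by (simp only: zero_le_mult_iff) linarith
qed

section \<open>Moment series of two-point measures\<close>

definition fnn :: "real fps \<Rightarrow> bool" where
  "fnn y \<longleftrightarrow> (\<forall>n. y $ n \<ge> 0)"

lemma fnn_add: "fnn y \<Longrightarrow> fnn z \<Longrightarrow> fnn (y + z)"
  by (simp add: fnn_def)

lemma fnn_mult: "fnn y \<Longrightarrow> fnn z \<Longrightarrow> fnn (y * z)"
  by (simp add: fnn_def fps_mult_nth sum_nonneg)

lemma fnn_one: "fnn 1"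
  by (simp add: fnn_def)

lemma fnn_const: "c \<ge> 0 \<Longrightarrow> fnn (fps_const c)"
  by (simp add: fnn_def)

lemma fnn_X: "fnn fps_X"
  by (simp add: fnn_def)

lemma fnn_power: "fnn y \<Longrightarrow> fnn (y ^ k)"
  by (induction k) (simp_all add: fnn_mult fnn_one)

text \<open>Powers are monotone for the order induced by any set that contains 0 and 1 and is closed
  under sums and products; the predicate is abstract to serve both \<open>fnn\<close> and
  \<open>fpos\<close>.\<close>

lemma power_add_diff_closed:
  fixes y z :: "'a :: comm_ring_1"
  assumes "P y" "P z" "P 1" "\<And>u v. P u \<Longrightarrow> P v \<Longrightarrow> P (u + v)" "\<And>u v. P u \<Longrightarrow> P v \<Longrightarrow> P (u * v)" "P 0"
  shows "P ((y + z) ^ k - y ^ k)"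
proof (induction k)
  case (Suc k)
  have yk: "P ((y + z) ^ k)" for k by (induction k) (use assms in auto)
  have "(y + z) ^ Suc k - y ^ Suc k = y * ((y + z) ^ k - y ^ k) + z * (y + z) ^ k"
    by (simp add: algebra_simps)
  then show ?case using Suc yk[of k] assms by simp
qed (use assms in simp)

lemma fnn_power_mono:
  assumes "fnn y" "fnn (z - y)"
  shows "(y ^ k) $ n \<le> (z ^ k) $ n"
proof -
  have "fnn ((y + (z - y)) ^ k - y ^ k)"
    by (rule power_add_diff_closed[of fnn])
      (use assms in \<open>auto intro: fnn_add fnn_mult fnn_one fnn_const[of 0, simplified]\<close>)
  then show ?thesis by (simp add: fnn_def)
qed

lemma fpos_power_mono:
  assumes "fpos y" "fpos (z - y)"
  shows "(y ^ k) $ (2 * n) \<le> (z ^ k) $ (2 * n)"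
proof -
  have "fpos ((y + (z - y)) ^ k - y ^ k)"
    by (rule power_add_diff_closed[of fpos]) (use assms in \<open>auto intro: fpos_add fpos_mult\<close>)
  from fpos_nth_even[OF this, of n] show ?thesis by simp
qed

text \<open>The series 1 / (1 - c X^2): for c \<ge> 0, the moments of equal masses at plus and minus
  the root of c.\<close>

definition geo2 :: "real \<Rightarrow> real fps" where
  "geo2 c = Abs_fps (\<lambda>n. if even n then c ^ (n div 2) else 0)"

lemma geo2_nth: "geo2 c $ n = (if even n then c ^ (n div 2) else 0)"
  by (simp add: geo2_def)

lemma geo2_mult: "(1 - fps_const c * fps_X ^ 2) * geo2 c = 1"
proof (rule fps_ext)
  fix n show "((1 - fps_const c * fps_X ^ 2) * geo2 c) $ n = 1 $ n"
  proof (cases "n < 2")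
    case True
    then have "n = 0 \<or> n = 1" by auto
    then show ?thesis by (auto simp: geo2_nth algebra_simps mult.assoc)
  next
    case False
    then obtain m where "n = m + 2" by (metis add.commute le_Suc_ex not_less)
    then show ?thesis by (simp add: geo2_nth left_diff_distrib mult.assoc fps_X_power_mult_nth)
  qed
qed

lemma fnn_geo2: "c \<ge> 0 \<Longrightarrow> fnn (geo2 c)"
  by (simp add: fnn_def geo2_nth)

definition fps_reflect :: "real fps \<Rightarrow> real fps" where
  "fps_reflect y = Abs_fps (\<lambda>n. (-1) ^ n * y $ n)"

lemma fps_reflect_nth [simp]: "fps_reflect y $ n = (-1) ^ n * y $ n"
  by (simp add: fps_reflect_def)

lemma fps_reflect_mult: "fps_reflect (y * z) = fps_reflect y * fps_reflect z"
proof (rule fps_ext)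
  fix n
  have "(-1) ^ n * (y $ i * z $ (n - i)) = ((-1) ^ i * y $ i) * ((-1) ^ (n - i) * z $ (n - i))" if "i \<le> n" for i
    using that by (metis (no_types, lifting) le_add_diff_inverse mult.assoc mult.left_commute power_add)
  then show "fps_reflect (y * z) $ n = (fps_reflect y * fps_reflect z) $ n"
    unfolding fps_reflect_nth fps_mult_nth sum_distrib_left by (intro sum.cong) auto
qed

lemma fps_reflect_one: "fps_reflect 1 = 1"
  by (rule fps_ext) simp

lemma fps_reflect_power: "fps_reflect (y ^ k) = fps_reflect y ^ k"
  by (induction k) (simp_all add: fps_reflect_mult fps_reflect_one)

text \<open>Even coefficients do not see the reflection of a measure at 0, so one sign among its
  parameters can be fixed at will.\<close>

lemma power_nth_reflect: "(fps_reflect y ^ k) $ (2 * n) = (y ^ k) $ (2 * n)"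
  by (simp flip: fps_reflect_power)

text \<open>The moment series of a probability measure supported on two points with first two
  moments \<open>-\<delta>\<close> and \<open>c\<close>, where \<open>d\<close> is the sum of the two points.\<close>

definition tp_den :: "real \<Rightarrow> real \<Rightarrow> real \<Rightarrow> real fps" where
  "tp_den c \<delta> d = 1 - fps_const d * fps_X - fps_const (c + \<delta> * d) * fps_X ^ 2"

definition tp_num :: "real \<Rightarrow> real \<Rightarrow> real fps" where
  "tp_num \<delta> d = 1 - fps_const (d + \<delta>) * fps_X"

definition tp :: "real \<Rightarrow> real \<Rightarrow> real \<Rightarrow> real fps" where
  "tp c \<delta> d = tp_num \<delta> d * inverse (tp_den c \<delta> d)"

lemma tp_den_nth_0 [simp]: "tp_den c \<delta> d $ 0 = 1"
  by (simp add: tp_den_def)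

lemma tp_den_inverse: "tp_den c \<delta> d * inverse (tp_den c \<delta> d) = 1"
  by (rule inverse_mult_eq_1') simp

lemma mult_inverse_pair:
  fixes a b u v :: "'a :: comm_monoid_mult"
  assumes "a * u = 1" "b * v = 1"
  shows "(a * b) * (u * v) = 1"
proof -
  have "(a * b) * (u * v) = (a * u) * (b * v)" by (simp only: mult_ac)
  then show ?thesis by (simp add: assms)
qed

lemma fps_mult_right_cancel: "(a :: real fps) * h = 1 \<Longrightarrow> y * a = z * a \<Longrightarrow> y = z"
proof -
  assume "a * h = 1" "y * a = z * a"
  then show ?thesis by auto
qed

text \<open>Isolates the deviation from the symmetric series with the same second moment: the mean
  gives the linear term, the sum of the two points the cubic one. The signs of \<delta> and d decide
  which comparison is available.\<close>

lemma tp_eq: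
  "tp c \<delta> d = geo2 c * (1 - fps_const \<delta> * fps_X + fps_const ((c - \<delta>^2) * d) * fps_X ^ 3 * inverse (tp_den c \<delta> d))"
  (is "_ = geo2 c * (1 - ?e * ?X + ?h * ?X ^ 3 * ?I)")
proof (rule fps_mult_right_cancel)
  show "((1 - fps_const c * ?X ^ 2) * tp_den c \<delta> d) * (geo2 c * ?I) = 1"
    using mult_inverse_pair[OF geo2_mult tp_den_inverse] .
  have 1: "tp_num \<delta> d * (1 - fps_const c * ?X ^ 2) = tp_den c \<delta> d * (1 - ?e * ?X) + ?h * ?X ^ 3"
    by (simp add: tp_num_def tp_den_def algebra_simps power2_eq_square power3_eq_cube
        flip: fps_const_add fps_const_sub fps_const_mult)
  have "tp c \<delta> d * ((1 - fps_const c * ?X ^ 2) * tp_den c \<delta> d)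
      = tp_num \<delta> d * (1 - fps_const c * ?X ^ 2) * (tp_den c \<delta> d * ?I)"
    by (simp add: tp_def)
  also have "\<dots> = tp_den c \<delta> d * (1 - ?e * ?X) + ?h * ?X ^ 3"
    by (simp add: 1 tp_den_inverse)
  also have "\<dots> = ((1 - fps_const c * ?X ^ 2) * geo2 c) * (tp_den c \<delta> d * (1 - ?e * ?X) + ?h * ?X ^ 3 * (tp_den c \<delta> d * ?I))"
    by (simp add: geo2_mult tp_den_inverse)
  also have "\<dots> = (geo2 c * (1 - ?e * ?X + ?h * ?X ^ 3 * ?I)) * ((1 - fps_const c * ?X ^ 2) * tp_den c \<delta> d)"
    by (simp add: algebra_simps)
  finally show "tp c \<delta> d * ((1 - fps_const c * ?X ^ 2) * tp_den c \<delta> d) = \<dots>" .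
qed

lemma inverse_eqI: "(y :: real fps) * z = 1 \<Longrightarrow> inverse y = z"
  by (metis fps_inverse_unique mult.commute)

lemma tp_den_factor:
  assumes "d = \<alpha> - \<beta>" "c + \<delta> * d = \<alpha> * \<beta>"
  shows "inverse (tp_den c \<delta> d) = geo \<alpha> * geo (- \<beta>)"
proof (rule inverse_eqI)
  have "tp_den c \<delta> d = (1 - fps_const \<alpha> * fps_X) * (1 - fps_const (- \<beta>) * fps_X)"
    unfolding tp_den_def assms(2) unfolding assms(1)
    by (simp add: algebra_simps power2_eq_square flip: fps_const_mult fps_const_sub fps_const_neg)
  then show "tp_den c \<delta> d * (geo \<alpha> * geo (- \<beta>)) = 1"
    using mult_inverse_pair[OF geo_mult geo_mult] by simp
qed

text \<open>\<alpha> and -\<beta> are the two support points, the roots of t^2 = d t + c + \<delta>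
  d. The last two bounds say that the mean -\<delta> lies between them, which makes the weights
  nonnegative.\<close>

lemma tp_roots:
  fixes c \<delta> d :: real
  assumes c: "c \<ge> \<delta>^2" and pos: "(d + 2 * \<delta>)^2 + 4 * (c - \<delta>^2) > 0"
  obtains \<alpha> \<beta> where "d = \<alpha> - \<beta>" "c + \<delta> * d = \<alpha> * \<beta>" "\<alpha> + \<beta> > 0" "- \<alpha> \<le> \<delta>" "\<delta> \<le> \<beta>"
proof -
  define q where "q = sqrt (d^2 + 4 * (c + \<delta> * d))"
  have e: "d^2 + 4 * (c + \<delta> * d) = (d + 2 * \<delta>)^2 + 4 * (c - \<delta>^2)"
    by (simp add: power2_eq_square algebra_simps)
  have q: "q^2 = d^2 + 4 * (c + \<delta> * d)" "q > 0"
    unfolding q_def by (rule real_sqrt_pow2, use pos e in linarith, rule real_sqrt_gt_zero, use pos e in linarith)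
  have le: "\<bar>d + 2 * \<delta>\<bar> \<le> q"
  proof -
    have "(d + 2 * \<delta>)^2 \<le> q^2" unfolding q(1) e using c by simp
    then show ?thesis using q(2) abs_le_square_iff[of "d + 2 * \<delta>" q] by simp
  qed
  show ?thesis
  proof (rule that[of "(d + q) / 2" "(q - d) / 2"])
    have "(d + q) / 2 * ((q - d) / 2) = (q^2 - d^2) / 4"
      by (simp add: field_simps power2_eq_square)
    then show "c + \<delta> * d = (d + q) / 2 * ((q - d) / 2)"
      by (simp add: q(1))
  qed (use le q(2) in \<open>auto simp: field_simps\<close>)
qed

lemma fpos_tp_den:
  assumes "c \<ge> \<delta>^2" "(d + 2 * \<delta>)^2 + 4 * (c - \<delta>^2) > 0"
  shows "fpos (inverse (tp_den c \<delta> d))"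
  by (rule tp_roots[OF assms]) (auto simp: tp_den_factor intro!: fpos_mult fpos_geo)

lemma fpos_tp_aux:
  assumes "- \<alpha> \<le> \<delta>" "\<delta> \<le> \<beta>" "\<alpha> + \<beta> > 0"
  shows "fpos ((1 - fps_const (\<alpha> - \<beta> + \<delta>) * fps_X) * (geo \<alpha> * geo (- \<beta>)))"
proof -
  \<comment> \<open>The weights of the points \<alpha> and -\<beta>, determined by total mass 1 and
    mean -\<delta>.\<close>
  define p where "p = (\<beta> - \<delta>) / (\<alpha> + \<beta>)"
  define q where "q = (\<alpha> + \<delta>) / (\<alpha> + \<beta>)"
  have pq: "p + q = 1" "q * \<alpha> - p * \<beta> = \<alpha> - \<beta> + \<delta>" "p \<ge> 0" "q \<ge> 0"
    using assms(3) assms by (simp_all add: p_def q_def divide_simps) (simp_all add: algebra_simps)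
  have "1 - fps_const (\<alpha> - \<beta> + \<delta>) * fps_X = fps_const (p + q) - fps_const (q * \<alpha> - p * \<beta>) * (fps_X::real fps)"
    using pq by simp
  also have "\<dots> = fps_const p * (1 - fps_const (- \<beta>) * fps_X) + fps_const q * (1 - fps_const \<alpha> * fps_X)"
    by (simp add: algebra_simps flip: fps_const_mult fps_const_sub fps_const_neg fps_const_add)
  finally have "(1 - fps_const (\<alpha> - \<beta> + \<delta>) * fps_X) * (geo \<alpha> * geo (- \<beta>))
      = fps_const p * geo \<alpha> * ((1 - fps_const (- \<beta>) * fps_X) * geo (- \<beta>)) + fps_const q * geo (-\<beta>) * ((1 - fps_const \<alpha> * fps_X) * geo \<alpha>)"
    by (simp only: ring_distribs mult_ac)
  also have "\<dots> = fps_const p * geo \<alpha> + fps_const q * geo (-\<beta>)"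
    by (simp add: geo_mult)
  finally show ?thesis
    by (simp add: fpos_add fpos_mult fpos_const fpos_geo pq)
qed

lemma fpos_tp:
  assumes "c \<ge> \<delta>^2" "(d + 2 * \<delta>)^2 + 4 * (c - \<delta>^2) > 0"
  shows "fpos (tp c \<delta> d)"
proof -
  obtain \<alpha> \<beta> where *: "d = \<alpha> - \<beta>" "c + \<delta> * d = \<alpha> * \<beta>" "\<alpha> + \<beta> > 0" "- \<alpha> \<le> \<delta>" "\<delta> \<le> \<beta>"
    by (rule tp_roots[OF assms])
  have "tp c \<delta> d = (1 - fps_const (\<alpha> - \<beta> + \<delta>) * fps_X) * (geo \<alpha> * geo (- \<beta>))"
    unfolding tp_def tp_num_def tp_den_factor[OF *(1,2)] by (simp only: *(1))
  then show ?thesis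
    using fpos_tp_aux[OF *(4,5,3)] by simp
qed

text \<open>Either both points are nonnegative, or the linear recursion for the reciprocal has the
  nonnegative coefficients d and \<alpha> \<beta>.\<close>

lemma fnn_tp_den:
  assumes "c \<ge> \<delta>^2" "(d + 2 * \<delta>)^2 + 4 * (c - \<delta>^2) > 0" "d \<ge> 0"
  shows "fnn (inverse (tp_den c \<delta> d))"
proof -
  obtain \<alpha> \<beta> where *: "d = \<alpha> - \<beta>" "c + \<delta> * d = \<alpha> * \<beta>" "\<alpha> + \<beta> > 0"
    by (rule tp_roots[OF assms(1,2)])
  show ?thesis
  proof (cases "\<beta> \<le> 0")
    case True
    with * show ?thesis
      unfolding tp_den_factor[OF *(1,2)] by (intro fnn_mult) (auto simp: fnn_def)
  next
    case False
    with * assms(3) have B: "c + \<delta> * d \<ge> 0" by simp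
    define I where "I = inverse (tp_den c \<delta> d)"
    have "tp_den c \<delta> d * I = 1"
      unfolding I_def by (rule tp_den_inverse)
    then have rec: "I = 1 + fps_const d * (fps_X * I) + fps_const (c + \<delta> * d) * (fps_X ^ 2 * I)"
      by (simp add: tp_den_def left_diff_distrib mult.assoc diff_eq_eq add_ac)
    have "I $ n \<ge> 0" for n
    proof (induction n rule: less_induct)
      case (less n)
      have "I $ n = (if n = 0 then 1 else 0) + d * (if n = 0 then 0 else I $ (n - 1))
          + (c + \<delta> * d) * (if n < 2 then 0 else I $ (n - 2))"
        using arg_cong[OF rec, of "\<lambda>y. y $ n"]
        by (simp only: fps_add_nth fps_one_nth fps_mult_left_const_nth fps_X_mult_nth fps_X_power_mult_nth)
      then show ?case using less assms(3) B by simp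
    qed
    then have "fnn I" by (simp add: fnn_def)
    then show ?thesis by (simp add: I_def)
  qed
qed

lemma tp_bound_nonneg_mean:
  assumes "c \<ge> \<delta>^2" "(d + 2 * \<delta>)^2 + 4 * (c - \<delta>^2) > 0" "d \<ge> 0" "\<delta> \<le> 0"
  shows "(geo2 c ^ k) $ n \<le> (tp c \<delta> d ^ k) $ n"
proof (rule fnn_power_mono)
  have c: "c \<ge> 0" using assms(1) by (metis order_trans zero_le_power2)
  show "fnn (geo2 c)" by (rule fnn_geo2[OF c])
  have "tp c \<delta> d - geo2 c = geo2 c * (fps_const (- \<delta>) * fps_X + fps_const ((c - \<delta>^2) * d) * fps_X ^ 3 * inverse (tp_den c \<delta> d))"
    unfolding tp_eq by (simp add: ring_distribs flip: fps_const_neg)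
  then show "fnn (tp c \<delta> d - geo2 c)"
    using assms c by (auto intro!: fnn_mult fnn_add fnn_const fnn_power fnn_X fnn_geo2 fnn_tp_den mult_nonneg_nonneg)
qed

text \<open>Only the linear term of \<open>tp_eq\<close> is left, and reflection makes its sign
  positive without changing the even coefficients.\<close>

lemma tp_bound_degenerate:
  assumes "c \<ge> 0" "\<delta> \<ge> 0" "(c - \<delta>^2) * d = 0"
  shows "(geo2 c ^ k) $ (2 * n) \<le> (tp c \<delta> d ^ k) $ (2 * n)"
proof -
  define z where "z = fps_const \<delta> * (geo2 c * fps_X)"
  have tp: "tp c \<delta> d = geo2 c - z"
    unfolding tp_eq assms(3) z_def by (simp add: algebra_simps)
  have "fnn z"
    unfolding z_def by (intro fnn_mult fnn_const fnn_X fnn_geo2 assms)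
  have "fps_reflect (tp c \<delta> d) = geo2 c + z"
  proof (rule fps_ext)
    fix n
    show "fps_reflect (tp c \<delta> d) $ n = (geo2 c + z) $ n"
      unfolding tp z_def by (cases "even n") (simp_all add: geo2_nth)
  qed
  then have "((geo2 c + z) ^ k) $ (2 * n) = (tp c \<delta> d ^ k) $ (2 * n)"
    by (metis power_nth_reflect)
  moreover have le: "(geo2 c ^ k) $ (2 * n) \<le> ((geo2 c + z) ^ k) $ (2 * n)"
  proof (rule fnn_power_mono)
    show "fnn (geo2 c)" by (rule fnn_geo2[OF assms(1)])
    have "geo2 c + z - geo2 c = z" by simp
    then show "fnn (geo2 c + z - geo2 c)" using \<open>fnn z\<close> by (simp only:)
  qed
  ultimately show ?thesis
    by argo
qed

section \<open>Two-point measures with negative mean: the key identity and its positivity\<close>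

text \<open>The core of \<open>tp_key_identity\<close>, freed of powers. The coefficient 2 \<delta>
  d + 2 (j + 2) B of X U is chosen so that the left side agrees with (j + 1) \<delta> D^2 up to the
  first power of X; what remains is then a multiple of d X^2.\<close>

lemma tp_key_ring:
  fixes X g d c \<delta> B j D U S :: "'a :: comm_ring_1"
  assumes "g = d + \<delta>" "c = B - \<delta> * d" "D = 1 - d * X - B * X^2" "U = 1 - g * X"
    "S = (1 - d * X)^2 - c * X^2"
  shows "D * ((j + 1) * g * S - U * (- 2 * d * (1 - d * X) - 2 * c * X) + (2 * \<delta> * d + 2 * (j + 2) * B) * X * U)
      + (j + 3) * U * (- d - 2 * B * X) * S
    = (j + 1) * \<delta> * D^2 + d * X^2 * (2 * U * ((2 * c + \<delta> * d) - B * (d + 2 * \<delta>) * X)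
        + (j + 1) * ((B + \<delta>^2) - 2 * B * (d + 2 * \<delta>) * X + B * (B + g^2) * X^2))"
  unfolding assms by (simp add: algebra_simps power2_eq_square)

abbreviation fc :: "real \<Rightarrow> real fps" where "fc \<equiv> fps_const"

text \<open>Up to the factor X, the numerator of the derivative of \<open>tp\<close> as \<delta>
  decreases; see \<open>fder_tp\<close>.\<close>

definition tp_quad :: "real \<Rightarrow> real \<Rightarrow> real fps" where
  "tp_quad c d = (1 - fc d * fps_X)^2 - fc c * fps_X^2"

text \<open>Brings the series that governs the directional derivative in
  \<open>tp_derivative_nonpos\<close> into a shape from which \<open>tp_key_pos\<close> can read off
  membership in \<open>fpos\<close>.\<close>

lemma tp_key_identity:
  fixes c \<delta> d :: real and j :: nat
  defines "U \<equiv> tp_num \<delta> d" and "I \<equiv> inverse (tp_den c \<delta> d)" and "S \<equiv> tp_quad c d" and "B \<equiv> c + \<delta> * d"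
  shows "fps_deriv (- (U ^ (j + 1) * I ^ (j + 3) * S))
      + fc (2 * \<delta> * d + 2 * (real j + 2) * B) * fps_X * (U ^ (j + 1) * I ^ (j + 3))
    = U ^ j * I ^ (j + 4) * (fc ((real j + 1) * \<delta>) * tp_den c \<delta> d ^ 2
       + fc d * fps_X^2 * (2 * U * (fc (2 * c + \<delta> * d) - fc (B * (d + 2 * \<delta>)) * fps_X)
        + fc (real j + 1) * (fc (B + \<delta>^2) - fc (2 * B * (d + 2 * \<delta>)) * fps_X + fc (B * (B + (d + \<delta>)^2)) * fps_X^2)))"
proof -
  define D where "D = tp_den c \<delta> d"
  define P where "P = U ^ j * I ^ (j + 3)"
  define J where "J = fc (real j)"
  define X where "X = (fps_X :: real fps)"
  have DI: "D * I = 1"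
    unfolding D_def I_def by (rule tp_den_inverse)
  have D: "D = 1 - fc d * X - fc B * X^2"
    by (simp add: D_def tp_den_def B_def X_def)
  have dX: "fps_deriv X = 1" by (simp add: X_def)
  have dD: "fps_deriv D = - fc d - 2 * fc B * X"
    unfolding D by (simp add: dX power2_eq_square algebra_simps)
  have U: "U = 1 - fc (d + \<delta>) * X"
    by (simp add: U_def tp_num_def X_def)
  have dU: "fps_deriv U = - fc (d + \<delta>)"
    unfolding U by (simp add: dX)
  have S: "S = (1 - fc d * X)^2 - fc c * X^2"
    by (simp add: S_def tp_quad_def X_def)
  have dS: "fps_deriv S = - 2 * fc d * (1 - fc d * X) - 2 * fc c * X"
    unfolding S by (simp add: dX power2_eq_square algebra_simps)
  have dI: "fps_deriv I = - (fps_deriv D * I ^ 2)"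
    unfolding I_def D_def by (subst fps_inverse_deriv) (simp_all add: power2_eq_square)
  have J1: "of_nat (Suc j) = J + 1" "of_nat (j + 3) = J + 3"
    by (simp_all add: J_def fps_of_nat[symmetric] flip: fps_const_add)
  have dUj: "fps_deriv (U ^ (j + 1)) = - ((J + 1) * fc (d + \<delta>) * U ^ j)"
    unfolding Suc_eq_plus1[symmetric]
    by (simp only: fps_deriv_power' dU J1 diff_Suc_1 mult_minus_left mult_minus_right)
  have dIj: "fps_deriv (I ^ (j + 3)) = - (J + 3) * fps_deriv D * I * I ^ (j + 3)"
    by (simp add: fps_deriv_power' dI J1 del: of_nat_Suc of_nat_add)
       (simp add: algebra_simps power_add power2_eq_square power3_eq_cube)
  have Uj: "U ^ (j + 1) = U * U ^ j" by simp
  have T: "fc (2 * \<delta> * d + 2 * (real j + 2) * B) = 2 * fc \<delta> * fc d + 2 * (J + 2) * fc B"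
    by (simp add: J_def numeral_fps_const flip: fps_const_add fps_const_mult)
  have E: "fc ((real j + 1) * \<delta>) = (J + 1) * fc \<delta>" "fc (2 * c + \<delta> * d) = 2 * fc c + fc \<delta> * fc d"
    "fc (B * (d + 2 * \<delta>)) = fc B * (fc d + 2 * fc \<delta>)" "fc (B + \<delta>^2) = fc B + fc \<delta>^2"
    "fc (2 * B * (d + 2 * \<delta>)) = 2 * fc B * (fc d + 2 * fc \<delta>)"
    "fc (B * (B + (d + \<delta>)^2)) = fc B * (fc B + fc (d + \<delta>)^2)" "fc (real j + 1) = J + 1"
    by (simp_all add: J_def numeral_fps_const power2_eq_square flip: fps_const_add fps_const_mult)
  define V where "V = U ^ (j + 1)"
  define W where "W = I ^ (j + 3)"
  have V: "V = U * U ^ j" by (simp add: V_def)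
  have "fps_deriv (- (V * W * S)) = - (fps_deriv V * W * S + V * fps_deriv W * S + V * W * fps_deriv S)"
    by (simp add: algebra_simps)
  also have "\<dots> = P * ((J + 1) * fc (d + \<delta>) * S + (J + 3) * U * fps_deriv D * I * S - U * fps_deriv S)"
    unfolding dUj[folded V_def] dIj[folded W_def] unfolding V P_def W_def[symmetric]
    by (simp add: algebra_simps del: fps_const_neg fps_const_add fps_deriv_power)
  finally have "fps_deriv (- (U ^ (j + 1) * I ^ (j + 3) * S))
      + fc (2 * \<delta> * d + 2 * (real j + 2) * B) * X * (U ^ (j + 1) * I ^ (j + 3))
    = P * ((J + 1) * fc (d + \<delta>) * S + (J + 3) * U * fps_deriv D * I * S - U * fps_deriv S
         + (2 * fc \<delta> * fc d + 2 * (J + 2) * fc B) * X * U)"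
    unfolding T V_def[symmetric] W_def[symmetric] by (simp add: V P_def W_def[symmetric] algebra_simps)
  also have "\<dots> = P * I * (D * ((J + 1) * fc (d + \<delta>) * S - U * fps_deriv S + (2 * fc \<delta> * fc d + 2 * (J + 2) * fc B) * X * U)
         + (J + 3) * U * fps_deriv D * S)"
  proof -
    have "P * I * (D * ((J + 1) * fc (d + \<delta>) * S - U * fps_deriv S + (2 * fc \<delta> * fc d + 2 * (J + 2) * fc B) * X * U)
         + (J + 3) * U * fps_deriv D * S)
      = P * ((D * I) * ((J + 1) * fc (d + \<delta>) * S - U * fps_deriv S + (2 * fc \<delta> * fc d + 2 * (J + 2) * fc B) * X * U)
         + (J + 3) * U * fps_deriv D * I * S)"
      by (simp only: algebra_simps)
    then show ?thesis unfolding DI by (simp add: algebra_simps)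
  qed
  also have "\<dots> = P * I * ((J + 1) * fc \<delta> * D^2 + fc d * X^2 * (2 * U * ((2 * fc c + fc \<delta> * fc d) - fc B * (fc d + 2 * fc \<delta>) * X)
        + (J + 1) * ((fc B + fc \<delta>^2) - 2 * fc B * (fc d + 2 * fc \<delta>) * X + fc B * (fc B + fc (d + \<delta>)^2) * X^2)))"
    unfolding dD dS
    by (subst tp_key_ring[where c = "fc c" and B = "fc B", OF _ _ D U S]) (simp_all add: B_def)
  also have "P * I = U ^ j * I ^ (j + 4)"
    by (simp add: P_def numeral_eq_Suc mult_ac)
  finally show ?thesis
    unfolding X_def D_def
    by (simp only: E)
qed

text \<open>The negative linear terms in X have to be absorbed. The linear factor becomes a
  combination of 1 and U, where U I = f is in \<open>fpos\<close>; the quadratic one becomes a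
  combination of A^2 and 1 + B X^2, where A cancels a factor \<open>geo \<alpha>\<close> of
  I.\<close>

lemma tp_key_pos:
  fixes c \<delta> d :: real and j :: nat
  assumes \<delta>: "\<delta> > 0" and c: "\<delta>^2 < c" and d: "d > 0"
  defines "U \<equiv> tp_num \<delta> d" and "I \<equiv> inverse (tp_den c \<delta> d)" and "B \<equiv> c + \<delta> * d"
  shows "fpos (U ^ j * I ^ (j + 4) * (fc ((real j + 1) * \<delta>) * tp_den c \<delta> d ^ 2
       + fc d * fps_X^2 * (2 * U * (fc (2 * c + \<delta> * d) - fc (B * (d + 2 * \<delta>)) * fps_X)
        + fc (real j + 1) * (fc (B + \<delta>^2) - fc (2 * B * (d + 2 * \<delta>)) * fps_X + fc (B * (B + (d + \<delta>)^2)) * fps_X^2))))"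
proof -
  have pos: "(d + 2 * \<delta>)^2 + 4 * (c - \<delta>^2) > 0"
    using c by (intro add_nonneg_pos) auto
  obtain \<alpha> \<beta> where ab: "d = \<alpha> - \<beta>" "c + \<delta> * d = \<alpha> * \<beta>" "\<alpha> + \<beta> > 0" "- \<alpha> \<le> \<delta>" "\<delta> \<le> \<beta>"
    by (rule tp_roots[OF less_imp_le[OF c] pos])
  have B: "B = \<alpha> * \<beta>" "B > 0"
    using ab \<delta> d by (auto simp: B_def)
  define D where "D = tp_den c \<delta> d"
  define f where "f = tp c \<delta> d"
  have f: "fpos f" and I: "fpos I"
    using fpos_tp[OF less_imp_le[OF c] pos] fpos_tp_den[OF less_imp_le[OF c] pos]
    by (simp_all add: f_def I_def)
  have fU: "f = U * I" by (simp add: f_def tp_def U_def I_def)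
  have DI: "D * I = 1"
    unfolding D_def I_def by (rule tp_den_inverse)
  have If: "I = geo \<alpha> * geo (- \<beta>)"
    unfolding I_def by (rule tp_den_factor[OF ab(1,2)])
  define A where "A = 1 - fc \<alpha> * fps_X"
  have A: "A * geo \<alpha> = 1" unfolding A_def by (rule geo_mult)
  \<comment> \<open>The coefficients of the linear factor in terms of U and 1; y1 is forced by the
    X-term and y0 by the constant term.\<close>
  define y1 where "y1 = B * (d + 2 * \<delta>) / (d + \<delta>)"
  define y0 where "y0 = d * (c - \<delta>^2) / (d + \<delta>)"
  have y: "y1 \<ge> 0" "y0 \<ge> 0"
    using \<delta> c d B by (auto simp: y1_def y0_def)
  have y01: "y0 + y1 = 2 * c + \<delta> * d"
    using \<delta> d unfolding y1_def y0_def B_def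
    by (simp add: divide_simps) (simp add: algebra_simps power2_eq_square)
  have y1g: "y1 * (d + \<delta>) = B * (d + 2 * \<delta>)"
    using \<delta> d by (simp add: y1_def)
  have L: "fc (2 * c + \<delta> * d) - fc (B * (d + 2 * \<delta>)) * fps_X = fc y0 + fc y1 * U"
    unfolding y01[symmetric] y1g[symmetric] U_def tp_num_def
    by (simp add: algebra_simps flip: fps_const_add fps_const_mult)
  \<comment> \<open>Matching with z1 A^2 + z0 (1 + B X^2): the X-term fixes z1, and the constant
    term then leaves a perfect square for z0.\<close>
  define z1 where "z1 = \<beta> * (\<alpha> - \<beta> + 2 * \<delta>)"
  define z0 where "z0 = (\<beta> - \<delta>)^2"
  have z: "z1 \<ge> 0" "z0 \<ge> 0"
    using ab \<delta> d by (auto simp: z1_def z0_def)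
  have "fc (B + \<delta>^2) - fc (2 * B * (d + 2 * \<delta>)) * fps_X + fc (B * (B + (d + \<delta>)^2)) * fps_X^2
     = fc (z1 + z0) - fc (2 * z1 * \<alpha>) * fps_X + fc (z1 * \<alpha>^2 + z0 * B) * fps_X^2"
  proof -
    have "z1 + z0 = B + \<delta>^2" "2 * z1 * \<alpha> = 2 * B * (d + 2 * \<delta>)" "z1 * \<alpha>^2 + z0 * B = B * (B + (d + \<delta>)^2)"
      unfolding z1_def z0_def B(1) ab(1) by (simp_all add: algebra_simps power2_eq_square)
    then show ?thesis by simp
  qed
  also have "\<dots> = fc z1 * A^2 + fc z0 * (1 + fc B * fps_X^2)"
    unfolding A_def by (simp add: algebra_simps power2_eq_square numeral_fps_const fps_numeral_simps flip: fps_const_add fps_const_mult)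
  finally have Q: "fc (B + \<delta>^2) - fc (2 * B * (d + 2 * \<delta>)) * fps_X + fc (B * (B + (d + \<delta>)^2)) * fps_X^2
     = fc z1 * A^2 + fc z0 * (1 + fc B * fps_X^2)" .
  have e: "U ^ j * I ^ (j + 4) = f ^ j * I ^ 4"
    by (simp add: fU power_mult_distrib power_add)
  have t1: "I ^ 4 * D ^ 2 = I ^ 2"
  proof -
    have "I ^ 4 * D ^ 2 = (D * I) ^ 2 * I ^ 2"
      by (simp add: power_mult_distrib power4_eq_xxxx power2_eq_square mult_ac)
    then show ?thesis by (simp add: DI)
  qed
  have t2: "I ^ 4 * U = f * I ^ 3" "I ^ 4 * U * U = f ^ 2 * I ^ 2"
    by (simp_all add: fU power_mult_distrib power4_eq_xxxx power2_eq_square power3_eq_cube mult_ac)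
  have t3: "I ^ 4 * A ^ 2 = I ^ 2 * geo (-\<beta>) ^ 2"
  proof -
    have "I ^ 4 * A ^ 2 = I ^ 2 * (A * geo \<alpha>) ^ 2 * geo (-\<beta>) ^ 2"
      by (simp add: If power_mult_distrib power4_eq_xxxx power2_eq_square mult_ac)
    then show ?thesis by (simp add: A)
  qed
  define X2 where "X2 = (fps_X ^ 2 :: real fps)"
  have X2: "fpos X2" unfolding X2_def by (rule fpos_X2)
  have "U ^ j * I ^ (j + 4) * (fc ((real j + 1) * \<delta>) * D ^ 2
       + fc d * fps_X^2 * (2 * U * (fc (2 * c + \<delta> * d) - fc (B * (d + 2 * \<delta>)) * fps_X)
        + fc (real j + 1) * (fc (B + \<delta>^2) - fc (2 * B * (d + 2 * \<delta>)) * fps_X + fc (B * (B + (d + \<delta>)^2)) * fps_X^2)))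
     = f ^ j * (fc ((real j + 1) * \<delta>) * (I ^ 4 * D ^ 2) + fc d * X2 * (fc 2 * (fc y0 * (I ^ 4 * U) + fc y1 * (I ^ 4 * U * U))
        + fc (real j + 1) * (fc z1 * (I ^ 4 * A ^ 2) + fc z0 * (I ^ 4 * (1 + fc B * X2)))))"
    unfolding e L Q X2_def by (simp only: algebra_simps numeral_fps_const[symmetric])
  moreover have "fpos \<dots>"
    unfolding t2(2) unfolding t1 t2(1) t3
    by (intro fpos_mult fpos_add fpos_power fpos_const fpos_one fpos_geo f I X2 mult_nonneg_nonneg)
       (use y z \<delta> d B(2) in auto)
  ultimately show ?thesis
    unfolding D_def by (simp only:)
qed

section \<open>Coefficientwise differentiation and continuity of families of power series\<close>

definition fder :: "(real \<Rightarrow> real fps) \<Rightarrow> real fps \<Rightarrow> real \<Rightarrow> bool" where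
  "fder F F' x \<longleftrightarrow> (\<forall>n. ((\<lambda>s. F s $ n) has_real_derivative F' $ n) (at x))"

lemma fder_mult:
  assumes "fder F F' x" "fder G G' x"
  shows "fder (\<lambda>s. F s * G s) (F' * G x + F x * G') x"
  unfolding fder_def fps_mult_nth fps_add_nth sum.distrib[symmetric]
proof
  fix n
  have "((\<lambda>s. \<Sum>i=0..n. F s $ i * G s $ (n - i)) has_real_derivative
      (\<Sum>i=0..n. F' $ i * G x $ (n - i) + G' $ (n - i) * F x $ i)) (at x)"
    using assms by (intro DERIV_sum DERIV_mult) (auto simp: fder_def)
  then show "((\<lambda>s. \<Sum>i=0..n. F s $ i * G s $ (n - i)) has_real_derivative
      (\<Sum>i=0..n. F' $ i * G x $ (n - i) + F x $ i * G' $ (n - i))) (at x)"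
    by (simp only: mult.commute[of "F x $ _"])
qed

lemma fder_power:
  assumes "fder F F' x"
  shows "fder (\<lambda>s. F s ^ k) (of_nat k * F x ^ (k - 1) * F') x"
proof (induction k)
  case 0
  then show ?case by (simp add: fder_def)
next
  case (Suc k)
  have e: "F' * F x ^ k + F x * (of_nat k * F x ^ (k - 1) * F') = of_nat (Suc k) * F x ^ (Suc k - 1) * F'"
    by (cases k) (simp_all add: algebra_simps)
  show ?case
    using fder_mult[OF assms Suc.IH] unfolding e by simp
qed

lemma inverse_nth_rec:
  fixes G :: "real fps"
  assumes "G $ 0 = 1"
  shows "inverse G $ n = (if n = 0 then 1 else - (\<Sum>i=1..n. G $ i * inverse G $ (n - i)))"
proof -
  have "(G * inverse G) $ n = 1 $ n"
    using assms by (simp add: inverse_mult_eq_1')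
  then show ?thesis
    using assms by (simp add: fps_mult_nth sum.atLeast_Suc_atMost split: if_splits)
qed

text \<open>The recursion for the reciprocal shows that each coefficient is differentiable; the
  value of the derivative is then forced by differentiating the product with G, which is constantly
  1.\<close>

lemma fder_inverse:
  assumes G: "fder G G' x" and 1: "\<And>s. G s $ 0 = 1"
  shows "fder (\<lambda>s. inverse (G s)) (- (G' * inverse (G x) ^ 2)) x"
proof -
  have "\<exists>h. ((\<lambda>s. inverse (G s) $ n) has_real_derivative h) (at x)" for n
  proof (induction n rule: less_induct)
    case (less n)
    then obtain h where h: "\<And>i. i < n \<Longrightarrow> ((\<lambda>s. inverse (G s) $ i) has_real_derivative h i) (at x)"
      by metis
    show ?case
    proof (cases "n = 0")
      case True
      then show ?thesis using 1 by (auto intro!: exI[of _ 0])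
    next
      case False
      have "((\<lambda>s. - (\<Sum>i=1..n. G s $ i * inverse (G s) $ (n - i))) has_real_derivative
          - (\<Sum>i=1..n. G' $ i * inverse (G x) $ (n - i) + h (n - i) * G x $ i)) (at x)"
        using G by (intro DERIV_minus DERIV_sum DERIV_mult h) (auto simp: fder_def)
      then show ?thesis
        using False by (subst inverse_nth_rec[OF 1]) auto
    qed
  qed
  then obtain h where h: "\<And>n. ((\<lambda>s. inverse (G s) $ n) has_real_derivative h n) (at x)"
    by metis
  define H where "H = Abs_fps h"
  have H: "fder (\<lambda>s. inverse (G s)) H x"
    using h by (simp add: fder_def H_def)
  have eq: "G s * inverse (G s) = 1" for s
    using 1 by (simp add: inverse_mult_eq_1')
  have 0: "fder (\<lambda>s. 1) (G' * inverse (G x) + G x * H) x"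
    using fder_mult[OF G H] by (simp only: eq)
  have "(G' * inverse (G x) + G x * H) $ n = 0" for n
    using 0 unfolding fder_def by (metis DERIV_const DERIV_unique)
  then have "G' * inverse (G x) + G x * H = 0"
    by (intro fps_ext) simp
  then have "inverse (G x) * (G' * inverse (G x) + G x * H) = 0" by simp
  then have "(G x * inverse (G x)) * H = - (G' * inverse (G x) ^ 2)"
    by (simp add: algebra_simps power2_eq_square eq_neg_iff_add_eq_0)
  then show ?thesis using H by (simp add: eq)
qed

definition fcont :: "('a::topological_space \<Rightarrow> real fps) \<Rightarrow> bool" where
  "fcont F \<longleftrightarrow> (\<forall>n. continuous_on UNIV (\<lambda>z. F z $ n))"

lemma fcont_mult: "fcont F \<Longrightarrow> fcont G \<Longrightarrow> fcont (\<lambda>z. F z * G z)"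
  by (auto simp: fcont_def fps_mult_nth intro!: continuous_intros)

lemma fcont_power: "fcont F \<Longrightarrow> fcont (\<lambda>z. F z ^ k)"
  by (induction k) (auto simp: fcont_mult, simp add: fcont_def)

lemma fcont_inverse:
  assumes G: "fcont G" and 1: "\<And>s. G s $ 0 = 1"
  shows "fcont (\<lambda>z. inverse (G z))"
  unfolding fcont_def
proof
  fix n show "continuous_on UNIV (\<lambda>z. inverse (G z) $ n)"
  proof (induction n rule: less_induct)
    case (less n)
    show ?case
    proof (cases "n = 0")
      case False
      have "continuous_on UNIV (\<lambda>z. - (\<Sum>i=1..n. G z $ i * inverse (G z) $ (n - i)))"
        using G by (intro continuous_intros less.IH) (auto simp: fcont_def)
      then show ?thesis using False by (subst inverse_nth_rec[OF 1]) simp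
    qed (simp add: 1)
  qed
qed

lemma fcont_affine:
  assumes "continuous_on UNIV a" "continuous_on UNIV b"
  shows "fcont (\<lambda>z. 1 - fc (a z) * fps_X - fc (b z) * fps_X ^ 2)"
  unfolding fcont_def
proof
  fix n
  have "(\<lambda>z. (1 - fc (a z) * fps_X - fc (b z) * fps_X ^ 2) $ n)
      = (\<lambda>z. (if n = 0 then 1 else 0) - a z * (if n = 1 then 1 else 0) - b z * (if n = 2 then 1 else 0))"
    by (simp add: fps_X_power_nth fps_X_nth)
  then show "continuous_on UNIV (\<lambda>z. (1 - fc (a z) * fps_X - fc (b z) * fps_X ^ 2) $ n)"
    using assms by (simp only:) (intro continuous_intros)
qed

lemma fcont_tp:
  "fcont (\<lambda>z. tp c (fst z) (snd z))"
proof -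
  have "fcont (\<lambda>z. tp_num (fst z) (snd z))"
    using fcont_affine[of "\<lambda>z. snd z + fst z" "\<lambda>z. 0"]
    by (simp add: tp_num_def continuous_intros)
  moreover have "fcont (\<lambda>z. inverse (tp_den c (fst z) (snd z)))"
    unfolding tp_den_def by (rule fcont_inverse) (auto intro!: fcont_affine continuous_intros)
  ultimately show ?thesis
    unfolding tp_def by (rule fcont_mult)
qed

lemma fder_tp:
  fixes c \<delta> d u v :: real
  defines "I \<equiv> inverse (tp_den c \<delta> d)"
  shows "fder (\<lambda>s. tp c (\<delta> - s * v) (d - s * u))
    (I ^ 2 * (fps_X * (fc v * tp_quad c d - fc (u * (c - \<delta>^2)) * fps_X ^ 2))) 0"
proof -
  define X where "X = (fps_X :: real fps)"
  have U: "fder (\<lambda>s. tp_num (\<delta> - s * v) (d - s * u)) (fc (u + v) * X) 0"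
    unfolding fder_def tp_num_def X_def
    by (auto intro!: derivative_eq_intros simp: fps_X_nth)
  have D: "fder (\<lambda>s. tp_den c (\<delta> - s * v) (d - s * u)) (fc u * X + fc (\<delta> * u + d * v) * X^2) 0"
    unfolding fder_def tp_den_def X_def
    by (auto intro!: derivative_eq_intros simp: fps_X_nth fps_X_power_nth)
  have "fder (\<lambda>s. tp c (\<delta> - s * v) (d - s * u))
     (fc (u + v) * X * I + tp_num \<delta> d * (- ((fc u * X + fc (\<delta> * u + d * v) * X^2) * I ^ 2))) 0"
    unfolding tp_def using fder_mult[OF U fder_inverse[OF D]] by (simp add: I_def)
  moreover have "fc (u + v) * X * I + tp_num \<delta> d * (- ((fc u * X + fc (\<delta> * u + d * v) * X^2) * I ^ 2))
     = I ^ 2 * (X * (fc v * tp_quad c d - fc (u * (c - \<delta>^2)) * X ^ 2))"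
  proof -
    have DI: "tp_den c \<delta> d * I = 1"
      unfolding I_def by (rule tp_den_inverse)
    have "fc (u + v) * X * I = (tp_den c \<delta> d * I) * (fc (u + v) * X * I)"
      by (simp add: DI)
    then have "fc (u + v) * X * I + tp_num \<delta> d * (- ((fc u * X + fc (\<delta> * u + d * v) * X^2) * I ^ 2))
      = I ^ 2 * (tp_den c \<delta> d * fc (u + v) * X - tp_num \<delta> d * (fc u * X + fc (\<delta> * u + d * v) * X^2))"
      by (simp add: algebra_simps power2_eq_square)
    also have "tp_den c \<delta> d * fc (u + v) * X - tp_num \<delta> d * (fc u * X + fc (\<delta> * u + d * v) * X^2)
      = X * (fc v * tp_quad c d - fc (u * (c - \<delta>^2)) * X ^ 2)"
      by (simp add: tp_den_def tp_num_def tp_quad_def X_def algebra_simps power2_eq_square numeral_fps_const fps_numeral_simps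
          flip: fps_const_add fps_const_mult fps_const_sub)
    finally show ?thesis .
  qed
  ultimately show ?thesis by (simp add: X_def)
qed

section \<open>Moment series of finitely supported measures\<close>

text \<open>The direction is tuned. The factor a + 1 in v turns the odd coefficient a + 1 of Y S
  into the even coefficient a of a derivative, the factor c - \<delta>^2 matches the one that
  \<open>fder_tp\<close> attaches to u and can be pulled out, and u is the constant of
  \<open>tp_key_identity\<close>.\<close>

lemma tp_derivative_nonpos:
  fixes c \<delta> d :: real and j a :: nat
  assumes \<delta>: "\<delta> > 0" and c: "\<delta>^2 < c" and d: "d > 0" and a: "even a"
  defines "v \<equiv> (real a + 1) * (c - \<delta>^2)" and "u \<equiv> 2 * \<delta> * d + 2 * (real j + 2) * (c + \<delta> * d)"
  obtains l where "l \<le> 0"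
    "((\<lambda>s. (tp c (\<delta> - s * v) (d - s * u) ^ (j + 2)) $ (a + 2)) has_real_derivative l) (at 0)"
proof -
  define I where "I = inverse (tp_den c \<delta> d)"
  define f where "f = tp c \<delta> d"
  define S where "S = tp_quad c d"
  define b where "b = c - \<delta>^2"
  define Y where "Y = tp_num \<delta> d ^ (j + 1) * I ^ (j + 3)"
  define l where "l = (of_nat (j + 2) * f ^ (j + 1) * (I ^ 2 * (fps_X * (fc v * S - fc (u * b) * fps_X ^ 2)))) $ (a + 2)"
  have Y: "f ^ (j + 1) * I ^ 2 = Y"
    by (simp add: f_def tp_def I_def Y_def power_mult_distrib numeral_eq_Suc mult_ac)
  have "of_nat (j + 2) * f ^ (j + 1) * (I ^ 2 * (fps_X * (fc v * S - fc (u * b) * fps_X ^ 2)))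
      = fc (real (j + 2)) * ((f ^ (j + 1) * I ^ 2) * (fps_X * (fc v * S - fc (u * b) * fps_X ^ 2)))"
    by (simp only: fps_of_nat mult.assoc)
  also have "\<dots> = fc (real (j + 2) * b) * (fps_X * (fc (real a + 1) * (Y * S) - fc u * (fps_X * (fps_X * Y))))"
    unfolding Y unfolding v_def b_def[symmetric] unfolding fps_const_mult[symmetric] power2_eq_square
    by (simp only: algebra_simps)
  finally have "l = (fc (real (j + 2) * b) * (fps_X * (fc (real a + 1) * (Y * S) - fc u * (fps_X * (fps_X * Y))))) $ (a + 2)"
    unfolding l_def by (simp only:)
  also have "\<dots> = real (j + 2) * b * ((real a + 1) * (Y * S) $ (a + 1) - u * (fps_X * Y) $ a)"
    by (simp only: fps_mult_left_const_nth fps_X_mult_nth[of "fc _ * _ - _"] fps_X_mult_nth[of "fps_X * _"] fps_sub_nth) simp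
  also have "\<dots> = - (real (j + 2) * b * (fps_deriv (- (Y * S)) + fc u * fps_X * Y) $ a)"
  proof -
    have "(fps_deriv (- (Y * S)) + fc u * fps_X * Y) $ a = - ((real a + 1) * (Y * S) $ (a + 1)) + u * (fps_X * Y) $ a"
      by (simp only: fps_add_nth fps_deriv_nth fps_neg_nth fps_mult_left_const_nth mult.assoc) simp
    then show ?thesis by (simp only:) (simp add: algebra_simps)
  qed
  also have "\<dots> \<le> 0"
  proof -
    have "fpos (fps_deriv (- (Y * S)) + fc u * fps_X * Y)"
      using tp_key_pos[OF \<delta> c d, of j] tp_key_identity[of \<delta> d j c]
      unfolding Y_def S_def I_def u_def by simp
    then have "0 \<le> (fps_deriv (- (Y * S)) + fc u * fps_X * Y) $ a"
      using a fpos_nth_even by (metis evenE)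
    then show ?thesis using c by (auto simp: b_def intro!: mult_nonneg_nonneg)
  qed
  finally have "l \<le> 0" .
  moreover have "((\<lambda>s. (tp c (\<delta> - s * v) (d - s * u) ^ (j + 2)) $ (a + 2)) has_real_derivative l) (at 0)"
    using fder_power[OF fder_tp[of c \<delta> v d u], of "j + 2"]
    unfolding fder_def l_def f_def S_def I_def b_def by simp
  ultimately show ?thesis using that by blast
qed

text \<open>A minimum principle on the rectangle K: a point with \<delta> > 0, \<delta>^2 < c and d
  > 0 can be moved along the direction of \<open>tp_derivative_nonpos\<close> and is no minimum. At
  the remaining points \<open>tp_bound_nonneg_mean\<close> or \<open>tp_bound_degenerate\<close>
  applies.\<close>

lemma tp_bound_neg_mean:
  fixes c \<delta> d :: real
  assumes c0: "c > 0" and \<delta>: "\<delta> \<ge> 0" and c: "\<delta>^2 \<le> c" and d: "d \<ge> 0"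
  shows "(geo2 c ^ (j + 2)) $ (2 * r) \<le> (tp c \<delta> d ^ (j + 2)) $ (2 * r)"
proof (cases r)
  case 0
  then show ?thesis
    by (simp add: fps_nth_power_0 geo2_nth tp_def tp_num_def)
next
  case (Suc r')
  define a where "a = 2 * r'"
  have r: "2 * r = a + 2" by (simp add: Suc a_def)
  define \<Phi> where "\<Phi> z = (tp c (fst z) (snd z) ^ (j + 2)) $ (a + 2)" for z :: "real \<times> real"
  define K where "K = {0..sqrt c} \<times> {0..d}"
  have inK: "(\<delta>, d) \<in> K"
    using \<delta> c d by (auto simp: K_def intro: real_le_rsqrt)
  \<comment> \<open>The derivative along the direction is only known to be nonpositive. The penalty
    \<open>\<epsilon> * \<delta>\<close> decreases strictly along it and makes the derivative
    negative; it disappears as \<epsilon> tends to 0.\<close>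
  have bound: "(geo2 c ^ (j + 2)) $ (2 * r) \<le> \<Phi> (\<delta>, d) + \<epsilon> * \<delta>" if \<epsilon>: "\<epsilon> > 0" for \<epsilon>
  proof -
    have "compact K" by (auto simp: K_def intro: compact_Times)
    moreover have "continuous_on K (\<lambda>z. \<Phi> z + \<epsilon> * fst z)"
    proof -
      have "continuous_on UNIV \<Phi>"
        using fcont_power[OF fcont_tp, of c "j + 2"] unfolding \<Phi>_def fcont_def by (rule spec)
      then have "continuous_on K \<Phi>" by (rule continuous_on_subset) simp
      then show ?thesis by (intro continuous_intros)
    qed
    ultimately obtain z where z: "z \<in> K" "\<And>y. y \<in> K \<Longrightarrow> \<Phi> z + \<epsilon> * fst z \<le> \<Phi> y + \<epsilon> * fst y"
      using continuous_attains_inf[of K "\<lambda>z. \<Phi> z + \<epsilon> * fst z"] inK by blast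
    obtain \<delta>0 d0 where z0: "z = (\<delta>0, d0)" by (cases z)
    have K0: "0 \<le> \<delta>0" "\<delta>0 \<le> sqrt c" "0 \<le> d0" "d0 \<le> d"
      using z(1) by (auto simp: z0 K_def)
    have c\<delta>0: "\<delta>0^2 \<le> c"
      using power_mono[OF K0(2,1), of 2] c0 by simp
    have "(geo2 c ^ (j + 2)) $ (2 * r) \<le> \<Phi> z"
    proof (cases "\<delta>0 = 0 \<or> (c - \<delta>0^2) * d0 = 0")
      case True
      then show ?thesis
      proof
        assume "\<delta>0 = 0"
        then have "(geo2 c ^ (j + 2)) $ (2 * r) \<le> (tp c \<delta>0 d0 ^ (j + 2)) $ (2 * r)"
          using K0(3) c0 by (intro tp_bound_nonneg_mean) (auto intro: add_nonneg_pos)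
        then show ?thesis by (simp only: \<Phi>_def z0 fst_conv snd_conv r)
      next
        assume "(c - \<delta>0^2) * d0 = 0"
        then have "(geo2 c ^ (j + 2)) $ (2 * r) \<le> (tp c \<delta>0 d0 ^ (j + 2)) $ (2 * r)"
          by (intro tp_bound_degenerate K0(1) less_imp_le[OF c0])
        then show ?thesis by (simp only: \<Phi>_def z0 fst_conv snd_conv r)
      qed
    next
      case False
      then have pos: "\<delta>0 > 0" "\<delta>0^2 < c" "d0 > 0"
        using K0 c\<delta>0 by (auto simp: less_le)
      define v where "v = (real a + 1) * (c - \<delta>0^2)"
      define u where "u = 2 * \<delta>0 * d0 + 2 * (real j + 2) * (c + \<delta>0 * d0)"
      have "c + \<delta>0 * d0 > 0"
        using pos c0 by (intro add_pos_pos mult_pos_pos)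
      moreover have "0 < 2 * (real j + 2)" by simp
      ultimately have vu: "v > 0" "u > 0"
        unfolding v_def u_def using pos by (simp_all add: add_pos_pos)
      obtain l where l: "l \<le> 0"
        "((\<lambda>s. (tp c (\<delta>0 - s * v) (d0 - s * u) ^ (j + 2)) $ (a + 2)) has_real_derivative l) (at 0)"
        using tp_derivative_nonpos[OF pos, of a j] unfolding v_def[symmetric] u_def[symmetric]
        by (auto simp: a_def)
      define g where "g s = (tp c (\<delta>0 - s * v) (d0 - s * u) ^ (j + 2)) $ (a + 2) + \<epsilon> * (\<delta>0 - s * v)" for s
      have "(g has_real_derivative l + \<epsilon> * (- v)) (at 0)"
        unfolding g_def by (rule DERIV_add[OF l(2)]) (auto intro!: derivative_eq_intros)
      moreover have "l + \<epsilon> * (- v) < 0"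
        using l(1) mult_pos_pos[OF \<epsilon> vu(1)] by linarith
      ultimately obtain e where e: "e > 0" "\<And>h. h > 0 \<Longrightarrow> h < e \<Longrightarrow> g (0 + h) < g 0"
        using DERIV_neg_dec_right[of g "l + \<epsilon> * (- v)" 0] by auto
      \<comment> \<open>Both parameters decrease, so staying in \<open>K\<close> only requires that
        neither becomes negative.\<close>
      define h where "h = min (e / 2) (min (\<delta>0 / v) (d0 / u))"
      have h: "h > 0" "h < e" "h \<le> \<delta>0 / v" "h \<le> d0 / u"
        using e(1) vu pos by (auto simp: h_def)
      then have hv: "h * v \<le> \<delta>0" "h * u \<le> d0"
        using vu by (simp_all add: pos_le_divide_eq)
      have "(\<delta>0 - h * v, d0 - h * u) \<in> K"
        using hv K0 h(1) vu by (auto simp: K_def intro: order_trans[rotated])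
      then have "g 0 \<le> g h"
        using z(2) unfolding z0 \<Phi>_def g_def by fastforce
      moreover have "g h < g 0" using e(2)[of h] h by simp
      ultimately show ?thesis by simp
    qed
    also have "\<Phi> z \<le> \<Phi> z + \<epsilon> * fst z"
      using \<epsilon> K0(1) by (simp add: z0)
    also have "\<dots> \<le> \<Phi> (\<delta>, d) + \<epsilon> * \<delta>"
      using z(2)[OF inK] by simp
    finally show ?thesis .
  qed
  have "(geo2 c ^ (j + 2)) $ (2 * r) \<le> \<Phi> (\<delta>, d)"
  proof (rule field_le_epsilon)
    fix e :: real assume e: "e > 0"
    have "(geo2 c ^ (j + 2)) $ (2 * r) \<le> \<Phi> (\<delta>, d) + e / (\<delta> + 1) * \<delta>"
      using \<delta> e by (intro bound) auto
    also have "e / (\<delta> + 1) * \<delta> \<le> e"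
      using \<delta> e by (simp add: field_simps)
    finally show "(geo2 c ^ (j + 2)) $ (2 * r) \<le> \<Phi> (\<delta>, d) + e" by simp
  qed
  then show ?thesis by (simp only: \<Phi>_def fst_conv snd_conv r)
qed

lemma tp_bound:
  assumes "\<delta>^2 < c" "d \<ge> 0"
  shows "(geo2 c ^ (j + 2)) $ (2 * r) \<le> (tp c \<delta> d ^ (j + 2)) $ (2 * r)"
proof -
  have c: "c > 0" using assms(1) by (rule le_less_trans[rotated]) simp
  show ?thesis
  proof (cases "\<delta> \<ge> 0")
    case True
    then show ?thesis by (intro tp_bound_neg_mean c assms less_imp_le[OF assms(1)])
  next
    case False
    then show ?thesis
      using assms by (intro tp_bound_nonneg_mean) (auto intro: add_nonneg_pos)
  qed
qed

section \<open>Gauss quadrature and moment inequalities for finite measures\<close>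

lemma fc_sum: "fc (sum g A) = (\<Sum>a\<in>A. fc (g a))"
  by (induction A rule: infinite_finite_induct) (simp_all flip: fps_const_add)

definition moment_series :: "'i set \<Rightarrow> ('i \<Rightarrow> real) \<Rightarrow> ('i \<Rightarrow> real) \<Rightarrow> real fps" where
  "moment_series A w x = (\<Sum>a\<in>A. fc (w a) * geo (x a))"

lemma moment_series_nth: "moment_series A w x $ n = (\<Sum>a\<in>A. w a * x a ^ n)"
  by (simp add: moment_series_def fps_sum_nth)

lemma fps_reflect_moment_series: "fps_reflect (moment_series A w x) = moment_series A w (\<lambda>a. - x a)"
proof (rule fps_ext)
  fix n
  show "fps_reflect (moment_series A w x) $ n = moment_series A w (\<lambda>a. - x a) $ n"
    by (simp add: moment_series_nth sum_distrib_left power_minus[of "x _"] mult_ac)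
qed

lemma geo_bound: "(geo2 (m^2) ^ k) $ (2 * r) \<le> (geo m ^ k) $ (2 * r)"
proof -
  have *: "(geo2 (m^2) ^ k) $ (2 * r) \<le> (geo m ^ k) $ (2 * r)" if "m \<ge> 0" for m
  proof (rule fnn_power_mono)
    show "fnn (geo2 (m^2))" by (simp add: fnn_geo2)
    show "fnn (geo m - geo2 (m^2))"
      using that by (auto simp: fnn_def geo2_nth simp flip: power_mult)
  qed
  have "fps_reflect (geo m) = geo (- m)"
    by (rule fps_ext) (simp add: power_minus[of m])
  then have "(geo (- m) ^ k) $ (2 * r) = (geo m ^ k) $ (2 * r)"
    by (metis power_nth_reflect)
  then show ?thesis
    using *[of m] *[of "- m"] by (cases "m \<ge> 0") auto
qed

text \<open>A Gauss quadrature step: the two-point measure with the same first four moments has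
  smaller even power coefficients, because the difference of the moment series is an integral
  of \<open>q x ^ 2\<close>, where \<open>q\<close> is the quadratic orthogonal polynomial.\<close>

lemma moment_series_eq_tp:
  fixes w x :: "'i \<Rightarrow> real"
  assumes "finite A" and w1: "(\<Sum>a\<in>A. w a) = 1"
  defines "m \<equiv> (\<Sum>a\<in>A. w a * x a)" and "c \<equiv> (\<Sum>a\<in>A. w a * x a ^ 2)"
  assumes d: "(\<Sum>a\<in>A. w a * x a ^ 3) = m * c + (c - m^2) * d"
  shows "moment_series A w x = tp c (- m) d + fps_X ^ 4 * inverse (tp_den c (- m) d) ^ 2 *
    (\<Sum>a\<in>A. fc (w a * (x a ^ 2 - d * x a - (c - m * d)) ^ 2) * geo (x a))"
proof -
  define q where "q y = y ^ 2 - d * y - (c - m * d)" for y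
  define D where "D = tp_den c (- m) d"
  define I where "I = inverse D"
  define X where "X = (fps_X :: real fps)"
  have DI: "D * I = 1" unfolding D_def I_def by (rule tp_den_inverse)
  \<comment> \<open>Division of \<open>D\<close> by 1 - y X. The remainder is \<open>q y\<close>
    times X^2, since \<open>q\<close> is the polynomial \<open>D\<close> with its coefficients
    reversed.\<close>
  have geoD: "geo y * D = X^2 * (fc (q y) * geo y) + 1 + fc (y - d) * X" for y
  proof -
    have "D = X^2 * fc (q y) + (1 - fc y * X) * (1 + fc (y - d) * X)"
      by (simp add: D_def tp_den_def q_def X_def algebra_simps power2_eq_square
          flip: fps_const_add fps_const_mult fps_const_sub fps_const_neg)
    then have "geo y * D = geo y * (X^2 * fc (q y) + (1 - fc y * X) * (1 + fc (y - d) * X))"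
      by (rule arg_cong)
    also have "\<dots> = X^2 * (fc (q y) * geo y) + ((1 - fc y * X) * geo y) * (1 + fc (y - d) * X)"
      by (simp only: algebra_simps)
    finally have "geo y * D = X^2 * (fc (q y) * geo y) + ((1 - fc y * X) * geo y) * (1 + fc (y - d) * X)" .
    then show ?thesis using geo_mult[of y] by (simp add: X_def)
  qed
  have q0: "(\<Sum>a\<in>A. w a * q (x a)) = 0"
  proof -
    have "(\<Sum>a\<in>A. w a * q (x a)) = (\<Sum>a\<in>A. w a * x a ^ 2) - d * (\<Sum>a\<in>A. w a * x a) - (c - m * d) * (\<Sum>a\<in>A. w a)"
      by (simp add: q_def algebra_simps sum_distrib_left sum_subtractf sum.distrib)
    then show ?thesis by (simp add: w1 m_def c_def)
  qed
  \<comment> \<open>The hypothesis on \<open>d\<close> says exactly that \<open>q\<close> is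
    orthogonal to x; orthogonality to 1 holds for every \<open>d\<close>.\<close>
  have q1: "(\<Sum>a\<in>A. w a * q (x a) * x a) = 0"
  proof -
    have c': "(\<Sum>a\<in>A. w a * (x a * x a)) = c" by (simp add: c_def power2_eq_square)
    have "(\<Sum>a\<in>A. w a * q (x a) * x a) = (\<Sum>a\<in>A. w a * x a ^ 3) - d * (\<Sum>a\<in>A. w a * x a ^ 2) - (c - m * d) * (\<Sum>a\<in>A. w a * x a)"
      by (simp add: q_def algebra_simps sum_distrib_left sum_subtractf sum.distrib power2_eq_square power3_eq_cube)
    then show ?thesis unfolding d by (simp add: m_def[symmetric] c_def[symmetric] c' algebra_simps power2_eq_square)
  qed
  define E where "E = (\<Sum>a\<in>A. fc (w a * q (x a)) * geo (x a))"
  define E2 where "E2 = (\<Sum>a\<in>A. fc (w a * q (x a) ^ 2) * geo (x a))"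
  have E: "E * D = X^2 * E2"
  proof -
    have "E * D = (\<Sum>a\<in>A. fc (w a * q (x a)) * (geo (x a) * D))"
      by (simp add: E_def sum_distrib_right mult.assoc)
    also have "\<dots> = (\<Sum>a\<in>A. X^2 * (fc (w a * q (x a) ^ 2) * geo (x a)) + fc (w a * q (x a)) * (1 - fc d * X) + fc (w a * q (x a) * x a) * X)"
      unfolding geoD by (rule sum.cong) (simp_all add: algebra_simps power2_eq_square
          flip: fps_const_mult fps_const_sub)
    also have "\<dots> = X^2 * E2 + fc (\<Sum>a\<in>A. w a * q (x a)) * (1 - fc d * X) + fc (\<Sum>a\<in>A. w a * q (x a) * x a) * X"
      by (simp add: sum.distrib E2_def sum_distrib_left sum_distrib_right fc_sum)
    finally show ?thesis by (simp add: q0 q1)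
  qed
  have "moment_series A w x * D = (\<Sum>a\<in>A. fc (w a) * (geo (x a) * D))"
    by (simp add: moment_series_def sum_distrib_right mult.assoc)
  also have "\<dots> = (\<Sum>a\<in>A. X^2 * (fc (w a * q (x a)) * geo (x a)) + fc (w a) * (1 - fc d * X) + fc (w a * x a) * X)"
    unfolding geoD by (rule sum.cong) (simp_all add: algebra_simps flip: fps_const_mult fps_const_sub)
  also have "\<dots> = X^2 * E + fc (\<Sum>a\<in>A. w a) * (1 - fc d * X) + fc (\<Sum>a\<in>A. w a * x a) * X"
    by (simp add: sum.distrib E_def sum_distrib_left sum_distrib_right fc_sum)
  also have "\<dots> = X^2 * E + tp_num (- m) d"
    by (simp add: w1 m_def tp_num_def X_def algebra_simps flip: fps_const_add fps_const_neg fps_const_sub)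
  finally have F: "moment_series A w x * D = X^2 * E + tp_num (- m) d" .
  have "moment_series A w x = moment_series A w x * (D * I)" by (simp add: DI)
  also have "\<dots> = (moment_series A w x * D) * I" by (simp only: mult.assoc)
  also have "\<dots> = X^2 * E * (D * I) * I + tp_num (- m) d * I" unfolding F by (simp add: DI algebra_simps)
  also have "X^2 * E * (D * I) * I = X^2 * (E * D) * I^2" by (simp add: power2_eq_square mult_ac)
  also have "\<dots> = X^4 * I^2 * E2" unfolding E by (simp add: power2_eq_square power4_eq_xxxx mult_ac)
  finally show ?thesis
    by (simp add: E2_def q_def X_def I_def D_def tp_def add.commute)
qed

lemma sum_sq_deviation:
  fixes w x :: "'i \<Rightarrow> real"
  assumes "(\<Sum>a\<in>A. w a) = 1"
  shows "(\<Sum>a\<in>A. w a * (x a - (\<Sum>a\<in>A. w a * x a))^2) = (\<Sum>a\<in>A. w a * x a ^ 2) - (\<Sum>a\<in>A. w a * x a)^2"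
proof -
  define m where "m = (\<Sum>a\<in>A. w a * x a)"
  have "(\<Sum>a\<in>A. w a * (x a - m)^2) = (\<Sum>a\<in>A. w a * x a ^ 2) - 2 * m * (\<Sum>a\<in>A. w a * x a) + m^2 * (\<Sum>a\<in>A. w a)"
    by (simp add: power2_eq_square algebra_simps sum.distrib sum_subtractf sum_distrib_left)
  also have "\<dots> = (\<Sum>a\<in>A. w a * x a ^ 2) - m^2"
    by (simp add: assms flip: m_def) (simp add: power2_eq_square)
  finally show ?thesis by (simp add: m_def)
qed

text \<open>Convexity with an explicit quadratic gain, which later controls the variance of the
  squares in the case of equality. Multiplying the tangent inequality by y = c + (y - c) produces
  the next gain.\<close>

lemma power_ge_tangent2:
  fixes y c :: real
  assumes "y \<ge> 0" "c \<ge> 0"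
  shows "c ^ (N + 2) + real (N + 2) * c ^ (N + 1) * (y - c) + real (N + 1) * c ^ N * (y - c)^2 \<le> y ^ (N + 2)"
proof (induction N)
  case 0
  then show ?case by (simp add: power2_eq_square algebra_simps)
next
  case (Suc N)
  have "0 \<le> y * (y ^ (N + 2) - c ^ (N + 2) - real (N + 2) * c ^ (N + 1) * (y - c))"
  proof -
    have "0 \<le> real (N + 1) * c ^ N * (y - c)^2" using assms by simp
    then have "0 \<le> y ^ (N + 2) - c ^ (N + 2) - real (N + 2) * c ^ (N + 1) * (y - c)"
      using Suc.IH by linarith
    then show ?thesis using assms by (intro mult_nonneg_nonneg)
  qed
  also have "\<dots> = y ^ (Suc N + 2) - c ^ (Suc N + 2) - real (Suc N + 2) * c ^ (Suc N + 1) * (y - c)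
      - real (Suc N + 1) * c ^ Suc N * (y - c)^2"
    by (simp add: algebra_simps power2_eq_square)
  finally show ?case by simp
qed

text \<open>Averages \<open>power_ge_tangent2\<close> over y = x^2 at the mean of the squares: the
  linear term drops out and the quadratic one becomes their variance
  \<open>f $ 4 - (f $ 2)^2\<close>.\<close>

lemma moment_series_even_ge:
  fixes w x :: "'i \<Rightarrow> real"
  assumes "finite A" "\<And>a. a \<in> A \<Longrightarrow> w a \<ge> 0" "(\<Sum>a\<in>A. w a) = 1"
  defines "f \<equiv> moment_series A w x"
  shows "(f $ 2) ^ (N + 2) + real (N + 1) * (f $ 2) ^ N * (f $ 4 - (f $ 2)^2) \<le> f $ (2 * (N + 2))"
proof -
  define c where "c = f $ 2"
  have c: "c = (\<Sum>a\<in>A. w a * x a ^ 2)" by (simp add: c_def f_def moment_series_nth)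
  have c0: "c \<ge> 0" unfolding c using assms(2) by (intro sum_nonneg) auto
  have dev: "(\<Sum>a\<in>A. w a * (x a ^ 2 - c)^2) = f $ 4 - c^2"
    using sum_sq_deviation[OF assms(3), of "\<lambda>a. x a ^ 2"]
    by (simp add: c f_def moment_series_nth flip: power_mult)
  have "c ^ (N + 2) + real (N + 1) * c ^ N * (f $ 4 - c^2)
     = (\<Sum>a\<in>A. w a * (c ^ (N + 2) + real (N + 2) * c ^ (N + 1) * (x a ^ 2 - c) + real (N + 1) * c ^ N * (x a ^ 2 - c)^2))"
  proof -
    have expand: "(\<Sum>a\<in>A. w a * (k1 + k2 * (x a ^ 2 - c) + k3 * (x a ^ 2 - c)^2))
      = k1 * (\<Sum>a\<in>A. w a) + k2 * ((\<Sum>a\<in>A. w a * x a ^ 2) - c * (\<Sum>a\<in>A. w a))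
        + k3 * (\<Sum>a\<in>A. w a * (x a ^ 2 - c)^2)" for k1 k2 k3
      by (simp add: distrib_left right_diff_distrib sum.distrib sum_subtractf sum_distrib_left mult_ac)
    then show ?thesis unfolding expand dev assms(3) c[symmetric] by simp
  qed
  also have "\<dots> \<le> (\<Sum>a\<in>A. w a * (x a ^ 2) ^ (N + 2))"
    using assms(2) c0 by (intro sum_mono mult_left_mono power_ge_tangent2) auto
  also have "\<dots> = f $ (2 * (N + 2))"
    by (simp only: f_def moment_series_nth power_mult)
  finally show ?thesis by (simp add: c_def)
qed

text \<open>Cauchy-Schwarz for x^2 - c and x^j. When the variance of x^2 vanishes it yields
  \<open>f $ (j + 2) = f $ 2 * f $ j\<close>, a way to say that x^2 is constant which survives
  passage to a limit.\<close>

lemma moment_series_shift_sq: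
  fixes w x :: "'i \<Rightarrow> real"
  assumes "finite A" "\<And>a. a \<in> A \<Longrightarrow> w a \<ge> 0" "(\<Sum>a\<in>A. w a) = 1"
  defines "f \<equiv> moment_series A w x"
  shows "(f $ (j + 2) - f $ 2 * f $ j)^2 \<le> (f $ 4 - (f $ 2)^2) * f $ (2 * j)"
proof -
  define c where "c = f $ 2"
  have c: "c = (\<Sum>a\<in>A. w a * x a ^ 2)" by (simp add: c_def f_def moment_series_nth)
  have dev: "(\<Sum>a\<in>A. w a * (x a ^ 2 - c)^2) = f $ 4 - c^2"
    using sum_sq_deviation[OF assms(3), of "\<lambda>a. x a ^ 2"]
    by (simp add: c f_def moment_series_nth flip: power_mult)
  have "(\<Sum>a\<in>A. (sqrt (w a) * (x a ^ 2 - c)) * (sqrt (w a) * x a ^ j))^2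
      \<le> (\<Sum>a\<in>A. (sqrt (w a) * (x a ^ 2 - c))^2) * (\<Sum>a\<in>A. (sqrt (w a) * x a ^ j)^2)"
    by (rule Cauchy_Schwarz_ineq_sum)
  also have "(\<Sum>a\<in>A. (sqrt (w a) * (x a ^ 2 - c))^2) = (\<Sum>a\<in>A. w a * (x a ^ 2 - c)^2)"
    using assms(2) by (intro sum.cong) (auto simp: power_mult_distrib)
  also have "(\<Sum>a\<in>A. (sqrt (w a) * x a ^ j)^2) = f $ (2 * j)"
    unfolding f_def moment_series_nth
    using assms(2) by (intro sum.cong) (auto simp: power_mult_distrib mult.commute simp flip: power_mult)
  also have "(\<Sum>a\<in>A. (sqrt (w a) * (x a ^ 2 - c)) * (sqrt (w a) * x a ^ j)) = (\<Sum>a\<in>A. w a * x a ^ (j + 2) - c * (w a * x a ^ j))"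
  proof (rule sum.cong)
    fix a assume "a \<in> A"
    then have "sqrt (w a) * sqrt (w a) = w a" using assms(2) by simp
    moreover have "(sqrt (w a) * (x a ^ 2 - c)) * (sqrt (w a) * x a ^ j)
        = (sqrt (w a) * sqrt (w a)) * ((x a ^ 2 - c) * x a ^ j)"
      by (simp only: mult_ac)
    ultimately show "(sqrt (w a) * (x a ^ 2 - c)) * (sqrt (w a) * x a ^ j) = w a * x a ^ (j + 2) - c * (w a * x a ^ j)"
      by (simp add: algebra_simps power_add power2_eq_square)
  qed simp
  also have "\<dots> = f $ (j + 2) - c * f $ j"
    by (simp add: f_def moment_series_nth sum_subtractf sum_distrib_left)
  finally show ?thesis unfolding dev by (simp add: c_def)
qed

text \<open>For k = 1 this is Jensen's inequality for the squares. For k \<ge> 2 the two-point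
  measure of \<open>moment_series_eq_tp\<close> lies between: the difference to it is in
  \<open>fpos\<close>, and \<open>tp_bound\<close> compares it with the symmetric one.\<close>

lemma moment_series_bound:
  fixes w x :: "'i \<Rightarrow> real"
  assumes A: "finite A" and w: "\<And>a. a \<in> A \<Longrightarrow> w a \<ge> 0" and w1: "(\<Sum>a\<in>A. w a) = 1"
  shows "(geo2 (moment_series A w x $ 2) ^ k) $ (2 * r) \<le> (moment_series A w x ^ k) $ (2 * r)"
proof -
  consider "k = 0" | "k = 1" | j where "k = j + 2"
    by (rule nat_cases_2)
  then show ?thesis
  proof cases
    case 2
    let ?f = "moment_series A w x"
    have f0: "?f $ 0 = 1" by (simp add: moment_series_nth w1)
    consider "r = 0" | "r = 1" | N where "r = N + 2"
      by (rule nat_cases_2)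
    then have "(?f $ 2) ^ r \<le> ?f $ (2 * r)"
    proof cases
      case 3
      have "0 \<le> (\<Sum>a\<in>A. w a * (x a ^ 2 - ?f $ 2)^2)"
        using w by (intro sum_nonneg) auto
      also have "\<dots> = ?f $ 4 - (?f $ 2)^2"
        using sum_sq_deviation[OF w1, of "\<lambda>a. x a ^ 2"] by (simp add: moment_series_nth flip: power_mult)
      finally have "0 \<le> real (N + 1) * (?f $ 2) ^ N * (?f $ 4 - (?f $ 2)^2)"
        using w by (intro mult_nonneg_nonneg zero_le_power) (auto simp: moment_series_nth intro!: sum_nonneg)
      then show ?thesis
        using moment_series_even_ge[OF A w w1, of x N] 3 by simp
    qed (auto simp: f0)
    then show ?thesis by (simp add: 2 geo2_nth)
  next
    case (3 j)
    have main: "(geo2 (moment_series A w x $ 2) ^ k) $ (2 * r) \<le> (moment_series A w x ^ k) $ (2 * r)"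
      if x3: "(\<Sum>a\<in>A. w a * x a ^ 3) = m * c + (c - m^2) * d" and m: "m = (\<Sum>a\<in>A. w a * x a)"
        and c: "c = (\<Sum>a\<in>A. w a * x a ^ 2)" and mc: "m^2 < c" and d: "d \<ge> 0" for x m c d
    proof -
      have pos: "(- m)^2 \<le> c" "(d + 2 * (- m))^2 + 4 * (c - (- m)^2) > 0"
        using mc by (auto intro: add_nonneg_pos)
      have "(geo2 c ^ k) $ (2 * r) \<le> (tp c (- m) (d) ^ k) $ (2 * r)"
        unfolding 3 using mc d by (intro tp_bound) auto
      also have "\<dots> \<le> (moment_series A w x ^ k) $ (2 * r)"
      proof (rule fpos_power_mono)
        show "fpos (tp c (- m) (d))" by (rule fpos_tp[OF pos])
        have X4: "fpos (fps_X ^ 4)"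
          using fpos_mult[OF fpos_X2 fpos_X2] by (simp flip: power_add)
        have "fpos (fps_X ^ 4 * inverse (tp_den c (- m) (d)) ^ 2 *
          (\<Sum>a\<in>A. fc (w a * (x a ^ 2 - (d) * x a - (c - m * (d))) ^ 2) * geo (x a)))"
          using w by (intro fpos_mult[OF fpos_mult[OF X4]] fpos_power fpos_sum fpos_tp_den[OF pos]
              fpos_mult[OF fpos_const fpos_geo]) auto
        moreover have "moment_series A w x = tp c (- m) (d) + fps_X ^ 4 * inverse (tp_den c (- m) (d)) ^ 2 *
          (\<Sum>a\<in>A. fc (w a * (x a ^ 2 - (d) * x a - (c - m * (d))) ^ 2) * geo (x a))"
          using moment_series_eq_tp[OF A w1, of x d] x3 unfolding m c by simp
        ultimately show "fpos (moment_series A w x - tp c (- m) (d))" by simp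
      qed
      finally show ?thesis by (simp add: c moment_series_nth)
    qed
    define m where "m = (\<Sum>a\<in>A. w a * x a)"
    define c where "c = (\<Sum>a\<in>A. w a * x a ^ 2)"
    have dev: "(\<Sum>a\<in>A. w a * (x a - m)^2) = c - m^2"
      unfolding m_def c_def by (rule sum_sq_deviation[OF w1])
    show ?thesis
    proof (cases "c = m^2")
      case True
      then have "w a * (x a - m)^2 = 0" if "a \<in> A" for a
        using dev w that A by (simp add: sum_nonneg_eq_0_iff)
      then have "w a = 0 \<or> x a = m" if "a \<in> A" for a
        using that by auto
      then have "moment_series A w x $ n = geo m $ n" for n
      proof -
        have "(\<Sum>a\<in>A. w a * x a ^ n) = (\<Sum>a\<in>A. w a * m ^ n)"
          by (rule sum.cong) (use \<open>\<And>a. a \<in> A \<Longrightarrow> w a = 0 \<or> x a = m\<close> in auto)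
        then show ?thesis by (simp add: moment_series_nth w1 flip: sum_distrib_right)
      qed
      then have "moment_series A w x = geo m" by (intro fps_ext)
      then show ?thesis using geo_bound[of m k r] by simp
    next
      case False
      moreover have "0 \<le> c - m^2"
        unfolding dev[symmetric] using w by (intro sum_nonneg) auto
      ultimately have mc: "m^2 < c" by simp
      define d where "d = ((\<Sum>a\<in>A. w a * x a ^ 3) - m * c) / (c - m^2)"
      have d: "(\<Sum>a\<in>A. w a * x a ^ 3) = m * c + (c - m^2) * d"
        using mc by (simp add: d_def)
      show ?thesis
      proof (cases "d \<ge> 0")
        case True
        then show ?thesis by (intro main[OF d m_def c_def mc])
      next
        case False
        \<comment> \<open>Reflection replaces m and d by their negatives, so the case d \<ge> 0
          applies.\<close>
        let ?y = "\<lambda>a. - x a"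
        have "(geo2 (moment_series A w ?y $ 2) ^ k) $ (2 * r) \<le> (moment_series A w ?y ^ k) $ (2 * r)"
        proof (rule main)
          show "(\<Sum>a\<in>A. w a * ?y a ^ 3) = (- m) * c + (c - (- m)^2) * (- d)"
            using d by (simp add: sum_negf)
        qed (use mc False in \<open>auto simp: m_def c_def sum_negf\<close>)
        then show ?thesis
          unfolding fps_reflect_moment_series[symmetric] by (simp add: power_nth_reflect)
      qed
    qed
  qed simp
qed

section \<open>Moments and free cumulants\<close>

text \<open>W = X M has the compositional inverse Z = X / C. The coefficient of X^N in C^(N+1) Z'
  Z^j is the formal residue of Z^(j-N-1) Z', which is 1 for j = N and 0 for j < N. Expanding the
  first factor of (W' o Z) Z' = 1 in powers of Z therefore isolates one coefficient of W'.\<close>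

lemma lagrange_inversion:
  fixes M C :: "'a :: field_char_0 fps"
  assumes C0: "C $ 0 = 1" and M: "M = C oo (fps_X * M)"
  shows "M $ N = (C ^ (N + 1)) $ N / of_nat (N + 1)"
proof -
  define W where "W = fps_X * M"
  define V where "V = inverse C"
  define Z where "Z = fps_X * V"
  have M0: "M $ 0 = 1" by (subst M) (simp add: C0)
  have W0: "W $ 0 = 0" by (simp add: W_def)
  have V: "C * V = 1" unfolding V_def using C0 by (simp add: inverse_mult_eq_1')
  have V0: "V $ 0 = 1" by (simp add: V_def C0)
  have Z0: "Z $ 0 = 0" "Z $ 1 = 1" by (simp_all add: Z_def V0)
  have ZW: "Z oo W = fps_X"
  proof -
    have CW: "C oo W = M" using M by (simp add: W_def)
    have "M * (V oo W) = (C * V) oo W"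
      by (simp add: fps_compose_mult_distrib[OF W0] CW)
    also have "\<dots> = 1" unfolding V by simp
    finally have "M * (V oo W) = 1" .
    then show ?thesis
      by (simp add: Z_def fps_compose_mult_distrib[OF W0] W0) (simp add: W_def mult.assoc)
  qed
  have WZ: "W oo Z = fps_X"
  proof -
    have inv: "fps_inv Z oo Z = fps_X" using Z0 by (intro fps_inv) auto
    have "W = (fps_inv Z oo Z) oo W" by (simp add: inv W0)
    also have "\<dots> = fps_inv Z oo (Z oo W)" using Z0 W0 by (simp add: fps_compose_assoc)
    also have "\<dots> = fps_inv Z" by (simp add: ZW)
    finally show ?thesis using inv by simp
  qed
  have one: "(fps_deriv W oo Z) * fps_deriv Z = 1"
    using fps_compose_deriv[OF Z0(1), of W] by (simp add: WZ)
  have CZ: "(C ^ (N + 1) * fps_deriv Z * Z ^ j) $ N = (if j = N then 1 else 0)" if j: "j \<le> N" for j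
  proof -
    define i where "i = N - j"
    have N: "N = j + i" using j by (simp add: i_def)
    have VC: "C ^ j * V ^ j = 1" by (simp add: V flip: power_mult_distrib)
    have dV: "C * fps_deriv V = - (fps_deriv C * V)"
    proof -
      have "fps_deriv (C * V) = 0" unfolding V by simp
      then show ?thesis by (simp add: eq_neg_iff_add_eq_0)
    qed
    have "C ^ (N + 1) * fps_deriv Z * Z ^ j = fps_X ^ j * ((C ^ j * V ^ j) * (C ^ i * (C * fps_deriv Z)))"
      by (simp add: N Z_def power_mult_distrib power_add mult_ac)
    also have "\<dots> = fps_X ^ j * (C ^ i * (C * fps_deriv Z))" by (simp add: VC)
    also have "C * fps_deriv Z = C * V + fps_X * (C * fps_deriv V)"
      by (simp add: Z_def algebra_simps)
    also have "\<dots> = 1 - fps_X * (fps_deriv C * V)" by (simp add: V dV)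
    finally have "(C ^ (N + 1) * fps_deriv Z * Z ^ j) $ N = (C ^ i * (1 - fps_X * (fps_deriv C * V))) $ i"
      by (simp add: fps_X_power_mult_nth N)
    also have "\<dots> = (if i = 0 then 1 else 0)"
    \<comment> \<open>For i > 0 the series is C^i - X (C^i)' / i, whose coefficient of order i is
      zero.\<close>
    proof (cases i)
      case (Suc i')
      have "C ^ i * (1 - fps_X * (fps_deriv C * V)) = C ^ i - fps_X * (fps_deriv C * C ^ i' * (C * V))"
        by (simp add: Suc algebra_simps)
      also have "\<dots> = C ^ i - fps_X * (fps_deriv C * C ^ i')" by (simp add: V)
      finally have e: "(C ^ i * (1 - fps_X * (fps_deriv C * V))) $ i = (C ^ i) $ i - (fps_deriv C * C ^ i') $ i'"
        by (simp add: Suc)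
      have "of_nat i * (C ^ i) $ i = (fps_deriv (C ^ i)) $ i'"
        by (simp only: fps_deriv_nth Suc Suc_eq_plus1)
      also have "fps_deriv (C ^ i) = fps_const (of_nat i) * (fps_deriv C * C ^ i')"
        by (simp only: Suc fps_deriv_power diff_Suc_1 mult.assoc)
      finally have "of_nat i * (C ^ i) $ i = of_nat i * (fps_deriv C * C ^ i') $ i'" by simp
      moreover have "of_nat i \<noteq> (0::'a)" unfolding of_nat_eq_0_iff using Suc by simp
      ultimately have "(C ^ i) $ i = (fps_deriv C * C ^ i') $ i'"
        using mult_cancel_left by blast
      then show ?thesis unfolding e by (simp add: Suc)
    qed (simp add: C0)
    finally show ?thesis using j by (auto simp: i_def)
  qed
  have "(C ^ (N + 1)) $ N = (C ^ (N + 1) * ((fps_deriv W oo Z) * fps_deriv Z)) $ N"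
    by (simp add: one)
  also have "\<dots> = ((C ^ (N + 1) * fps_deriv Z) * (fps_deriv W oo Z)) $ N"
    by (simp add: mult_ac)
  also have "\<dots> = (\<Sum>i=0..N. (C ^ (N + 1) * fps_deriv Z) $ (N - i) * (fps_deriv W oo Z) $ i)"
    unfolding fps_mult_nth[of "C ^ (N + 1) * fps_deriv Z"]
    by (rule sum.reindex_bij_witness[of _ "\<lambda>i. N - i" "\<lambda>i. N - i"]) auto
  also have "\<dots> = (\<Sum>i=0..N. (C ^ (N + 1) * fps_deriv Z) $ (N - i) * (\<Sum>j=0..N. fps_deriv W $ j * (Z ^ j) $ i))"
  proof (intro sum.cong refl arg_cong2[where f = "(*)"])
    fix i assume i: "i \<in> {0..N}"
    show "(fps_deriv W oo Z) $ i = (\<Sum>j=0..N. fps_deriv W $ j * (Z ^ j) $ i)"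
      unfolding fps_compose_nth using i Z0(1)
      by (intro sum.mono_neutral_left) (auto simp: startsby_zero_power_prefix)
  qed
  also have "\<dots> = (\<Sum>j=0..N. fps_deriv W $ j * (\<Sum>i=0..N. (C ^ (N + 1) * fps_deriv Z) $ (N - i) * (Z ^ j) $ i))"
    unfolding sum_distrib_left by (subst sum.swap) (simp add: mult_ac)
  also have "\<dots> = (\<Sum>j=0..N. fps_deriv W $ j * (C ^ (N + 1) * fps_deriv Z * Z ^ j) $ N)"
  proof (intro sum.cong refl arg_cong2[where f = "(*)"])
    fix j
    show "(\<Sum>i=0..N. (C ^ (N + 1) * fps_deriv Z) $ (N - i) * (Z ^ j) $ i) = (C ^ (N + 1) * fps_deriv Z * Z ^ j) $ N"
      unfolding fps_mult_nth[of "C ^ (N + 1) * fps_deriv Z"]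
      by (rule sum.reindex_bij_witness[of _ "\<lambda>i. N - i" "\<lambda>i. N - i"]) auto
  qed
  also have "\<dots> = (\<Sum>j=0..N. if j = N then fps_deriv W $ N else 0)"
  proof (intro sum.cong refl)
    fix j assume "j \<in> {0..N}"
    then have "j \<le> N" by simp
    then show "fps_deriv W $ j * (C ^ (N + 1) * fps_deriv Z * Z ^ j) $ N = (if j = N then fps_deriv W $ N else 0)"
      by (simp only: CZ) simp
  qed
  also have "\<dots> = of_nat (N + 1) * M $ N"
  proof -
    have "W $ (N + 1) = M $ N" by (simp add: W_def)
    then show ?thesis by (simp only: sum.delta fps_deriv_nth finite_atLeastAtMost) simp
  qed
  finally show ?thesis by (simp add: field_simps del: of_nat_add of_nat_Suc)
qed

text \<open>The moments of a centered law whose free cumulants are \<open>\<kappa> (n + 2) = f $ n\<close>.\<close>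

definition free_moment :: "'a :: field_char_0 fps \<Rightarrow> nat \<Rightarrow> 'a" where
  "free_moment f n = ((1 + fps_X ^ 2 * f) ^ (n + 1)) $ n / of_nat (n + 1)"

lemma free_moment_expand:
  "free_moment f n = (\<Sum>k\<in>{k. 2 * k \<le> n}. of_nat (n + 1 choose k) * (f ^ k) $ (n - 2 * k)) / of_nat (n + 1)"
proof -
  have "((1 + fps_X ^ 2 * f) ^ (n + 1)) $ n = (\<Sum>k\<le>n+1. (of_nat (n + 1 choose k) * (fps_X ^ 2 * f) ^ k) $ n)"
    unfolding add.commute[of 1] binomial_ring by (simp add: fps_sum_nth)
  also have "\<dots> = (\<Sum>k\<le>n+1. if 2 * k \<le> n then of_nat (n + 1 choose k) * (f ^ k) $ (n - 2 * k) else 0)"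
  proof (rule sum.cong)
    fix k
    have "(of_nat (n + 1 choose k) * (fps_X ^ 2 * f) ^ k) = fps_const (of_nat (n + 1 choose k)) * (fps_X ^ (2 * k) * f ^ k)"
      by (simp add: fps_of_nat power_mult_distrib flip: power_mult)
    then show "(of_nat (n + 1 choose k) * (fps_X ^ 2 * f) ^ k) $ n
        = (if 2 * k \<le> n then of_nat (n + 1 choose k) * (f ^ k) $ (n - 2 * k) else 0)"
      by (simp only: fps_mult_left_const_nth fps_X_power_mult_nth) auto
  qed simp
  also have "\<dots> = (\<Sum>k\<in>{k. 2 * k \<le> n}. of_nat (n + 1 choose k) * (f ^ k) $ (n - 2 * k))"
    by (rule sum.mono_neutral_cong_right) auto
  finally show ?thesis by (simp add: free_moment_def)
qed

lemma finite_double_le [simp]: "finite {k::nat. 2 * k \<le> n}"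
  by (rule finite_subset[of _ "{..n}"]) auto

lemma free_moment_even:
  fixes f :: "real fps"
  shows "free_moment f (2 * n) = (\<Sum>k\<le>n. real (2 * n + 1 choose k) * (f ^ k) $ (2 * (n - k))) / (2 * real n + 1)"
proof -
  have "{k. 2 * k \<le> 2 * n} = {..n}" by auto
  then show ?thesis by (simp add: free_moment_expand right_diff_distrib')
qed

section \<open>Bounds and convergence: from cumulants to moments and back\<close>

lemma power_nth_abs_le:
  fixes g b :: "real fps"
  assumes "\<And>j. \<bar>g $ j\<bar> \<le> b $ j"
  shows "\<bar>(g ^ k) $ n\<bar> \<le> (b ^ k) $ n"
proof (induction k arbitrary: n)
  case (Suc k)
  have "\<bar>(g ^ Suc k) $ n\<bar> \<le> (\<Sum>i=0..n. \<bar>g $ i\<bar> * \<bar>(g ^ k) $ (n - i)\<bar>)"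
    by (simp add: fps_mult_nth sum_abs flip: abs_mult)
  also have "\<dots> \<le> (\<Sum>i=0..n. b $ i * (b ^ k) $ (n - i))"
    by (intro sum_mono mult_mono assms Suc.IH) (auto intro: order_trans[OF _ assms])
  finally show ?case by (simp add: fps_mult_nth)
qed simp

text \<open>Moments are polynomials in the cumulants with nonnegative coefficients, so a majorant of
  the cumulants bounds the moments. This gives bounds uniform over the approximants of a chaos
  element.\<close>

lemma free_moment_abs_le:
  fixes g b :: "real fps"
  assumes "\<And>j. \<bar>g $ j\<bar> \<le> b $ j"
  shows "\<bar>free_moment g n\<bar> \<le> free_moment b n"
proof -
  have "\<bar>\<Sum>k\<in>{k. 2 * k \<le> n}. real (n + 1 choose k) * (g ^ k) $ (n - 2 * k)\<bar>
      \<le> (\<Sum>k\<in>{k. 2 * k \<le> n}. real (n + 1 choose k) * (b ^ k) $ (n - 2 * k))"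
    by (rule order_trans[OF sum_abs], rule sum_mono)
       (simp add: abs_mult mult_left_mono power_nth_abs_le[OF assms])
  then show ?thesis by (simp add: free_moment_expand divide_right_mono)
qed

lemma power_nth_tendsto:
  fixes g :: "nat \<Rightarrow> real fps"
  assumes "\<And>j. j \<le> n \<Longrightarrow> (\<lambda>i. g i $ j) \<longlonglongrightarrow> f $ j"
  shows "(\<lambda>i. (g i ^ k) $ n) \<longlonglongrightarrow> (f ^ k) $ n"
  using assms
proof (induction k arbitrary: n)
  case (Suc k)
  then show ?case by (auto simp: fps_mult_nth intro!: tendsto_intros)
qed simp

lemma free_moment_tendsto:
  fixes g :: "nat \<Rightarrow> real fps"
  assumes "\<And>j. (\<lambda>i. g i $ j) \<longlonglongrightarrow> f $ j"
  shows "(\<lambda>i. free_moment (g i) n) \<longlonglongrightarrow> free_moment f n"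
  unfolding free_moment_expand using assms by (intro tendsto_intros power_nth_tendsto) auto

text \<open>The relation is triangular: the moment of order m + 2 is the m-th coefficient of the
  cumulant series plus a polynomial in earlier ones.\<close>

lemma cumulants_convergent:
  fixes g :: "nat \<Rightarrow> real fps"
  assumes "\<And>n. convergent (\<lambda>i. free_moment (g i) n)"
  shows "convergent (\<lambda>i. g i $ m)"
proof (induction m rule: less_induct)
  case (less m)
  define h where "h = Abs_fps (\<lambda>j. lim (\<lambda>i. g i $ j))"
  have h: "(\<lambda>i. g i $ j) \<longlonglongrightarrow> h $ j" if "j < m" for j
    using less[OF that] by (simp add: h_def convergent_LIMSEQ_iff)
  \<comment> \<open>All terms but k = 1. The term k = 0 is constant, and for k \<ge> 2 the index m +
    2 - 2k is below m.\<close>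
  define R where "R y = (\<Sum>k\<in>{k. 2 * k \<le> m + 2} - {1}. real (m + 3 choose k) * (y ^ k) $ (m + 2 - 2 * k)) / real (m + 3)" for y
  have e: "g i $ m = free_moment (g i) (m + 2) - R (g i)" for i
  proof -
    have "(\<Sum>k\<in>{k. 2 * k \<le> m + 2}. real (m + 3 choose k) * (g i ^ k) $ (m + 2 - 2 * k))
      = real (m + 3) * g i $ m + (\<Sum>k\<in>{k. 2 * k \<le> m + 2} - {1}. real (m + 3 choose k) * (g i ^ k) $ (m + 2 - 2 * k))"
      (is "?S = ?A")
      by (subst sum.remove[of _ 1]) auto
    then have "free_moment (g i) (m + 2) = (real (m + 3) * g i $ m) / real (m + 3) + R (g i)"
    proof -
      assume *: "?S = ?A"
      have "free_moment (g i) (m + 2) = ?S / real (m + 3)"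
        unfolding free_moment_expand by (simp add: numeral_eq_Suc)
      then show ?thesis unfolding * R_def by (simp only: add_divide_distrib)
    qed
    then show ?thesis by simp
  qed
  have "(\<lambda>i. R (g i)) \<longlonglongrightarrow> R h"
  proof -
    have "(\<lambda>i. (g i ^ k) $ (m + 2 - 2 * k)) \<longlonglongrightarrow> (h ^ k) $ (m + 2 - 2 * k)"
      if "k \<in> {k. 2 * k \<le> m + 2} - {1}" for k
    proof (cases "k = 0")
      case False
      with that have "m + 2 - 2 * k < m" by auto
      then show ?thesis by (intro power_nth_tendsto h) auto
    qed simp
    then show ?thesis unfolding R_def by (intro tendsto_intros) auto
  qed
  then have "convergent (\<lambda>i. free_moment (g i) (m + 2) - R (g i))"
    by (intro convergent_diff assms) (auto simp: convergent_def)
  then show ?case by (simp only: e[symmetric])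
qed

section \<open>Extremality of the tetilla cumulants\<close>

lemma geo2_power_mono:
  assumes "0 \<le> c" "c \<le> c'"
  shows "(geo2 c ^ k) $ n \<le> (geo2 c' ^ k) $ n"
  using assms by (intro fnn_power_mono fnn_geo2) (auto simp: fnn_def geo2_nth intro: power_mono)

text \<open>The limit f comes without a measure, so what is known for finite measures reaches it as
  the coefficient inequalities \<open>P1\<close> to \<open>P3\<close>. The moment expansion has
  positive binomials and is compared term by term; equality of the sums thus forces equality of all
  terms.\<close>

lemma tetilla_extremal:
  fixes g :: "nat \<Rightarrow> real fps" and l :: "nat \<Rightarrow> nat \<Rightarrow> real"
  assumes g: "\<And>i. g i = moment_series {..<m i} (\<lambda>a. (l i a)^2) (l i)"
    and lim: "\<And>n. (\<lambda>i. g i $ n) \<longlonglongrightarrow> f $ n"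
    and f0: "f $ 0 = 1" and f2: "f $ 2 \<ge> 1 / 2"
  shows "free_moment (geo2 (1/2)) (2 * n) \<le> free_moment f (2 * n)"
    and "n \<ge> 3 \<Longrightarrow> free_moment f (2 * n) = free_moment (geo2 (1/2)) (2 * n) \<Longrightarrow> f = geo2 (1/2)"
proof -
  \<comment> \<open>\<open>g i $ 0\<close> tends to 1 but need not equal 1; dividing by it gives
    probability weights as soon as it is positive.\<close>
  define w where "w i a = (l i a)^2 / g i $ 0" for i a
  define F where "F i = moment_series {..<m i} (w i) (l i)" for i
  have F: "F i $ n = g i $ n / g i $ 0" for i n
    by (simp add: F_def w_def g moment_series_nth sum_divide_distrib)
  have Flim: "(\<lambda>i. F i $ n) \<longlonglongrightarrow> f $ n" for n
    unfolding F using tendsto_divide[OF lim[of n] lim[of 0]] by (simp add: f0)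
  have ev: "eventually (\<lambda>i. g i $ 0 > 0) sequentially"
    using order_tendstoD(1)[OF lim[of 0], of 0] by (simp add: f0)
  have w: "w i a \<ge> 0" "(\<Sum>a<m i. w i a) = 1" if "g i $ 0 > 0" for i a
  proof -
    show "w i a \<ge> 0" using that by (simp add: w_def)
    show "(\<Sum>a<m i. w i a) = 1"
      using that F[of i 0] by (simp add: F_def moment_series_nth)
  qed
  have c0: "f $ 2 \<ge> 0" using f2 by simp
  have P1: "(geo2 (f $ 2) ^ k) $ (2 * r) \<le> (f ^ k) $ (2 * r)" for k r
  proof (rule tendsto_le)
    show "(\<lambda>i. (F i ^ k) $ (2 * r)) \<longlonglongrightarrow> (f ^ k) $ (2 * r)"
      by (intro power_nth_tendsto Flim)
    have "(\<lambda>i. geo2 (F i $ 2) $ j) \<longlonglongrightarrow> geo2 (f $ 2) $ j" for j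
      by (auto simp: geo2_nth intro!: tendsto_intros Flim)
    then show "(\<lambda>i. (geo2 (F i $ 2) ^ k) $ (2 * r)) \<longlonglongrightarrow> (geo2 (f $ 2) ^ k) $ (2 * r)"
      by (intro power_nth_tendsto)
    show "\<forall>\<^sub>F i in sequentially. (geo2 (F i $ 2) ^ k) $ (2 * r) \<le> (F i ^ k) $ (2 * r)"
      using ev by eventually_elim (auto simp: F_def intro!: moment_series_bound w)
  qed simp
  have P2: "(f $ 2) ^ (N + 2) + real (N + 1) * (f $ 2) ^ N * (f $ 4 - (f $ 2)^2) \<le> f $ (2 * (N + 2))" for N
  proof (rule tendsto_le)
    show "(\<lambda>i. F i $ (2 * (N + 2))) \<longlonglongrightarrow> f $ (2 * (N + 2))" by (rule Flim)
    show "(\<lambda>i. (F i $ 2) ^ (N + 2) + real (N + 1) * (F i $ 2) ^ N * (F i $ 4 - (F i $ 2)^2))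
      \<longlonglongrightarrow> (f $ 2) ^ (N + 2) + real (N + 1) * (f $ 2) ^ N * (f $ 4 - (f $ 2)^2)"
      by (intro tendsto_intros Flim)
    show "\<forall>\<^sub>F i in sequentially. (F i $ 2) ^ (N + 2) + real (N + 1) * (F i $ 2) ^ N * (F i $ 4 - (F i $ 2)^2) \<le> F i $ (2 * (N + 2))"
      using ev unfolding F_def by eventually_elim (intro moment_series_even_ge w finite_lessThan)
  qed simp
  have P3: "(f $ (j + 2) - f $ 2 * f $ j)^2 \<le> (f $ 4 - (f $ 2)^2) * f $ (2 * j)" for j
  proof (rule tendsto_le)
    show "(\<lambda>i. (F i $ 4 - (F i $ 2)^2) * F i $ (2 * j)) \<longlonglongrightarrow> (f $ 4 - (f $ 2)^2) * f $ (2 * j)"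
      by (intro tendsto_intros Flim)
    show "(\<lambda>i. (F i $ (j + 2) - F i $ 2 * F i $ j)^2) \<longlonglongrightarrow> (f $ (j + 2) - f $ 2 * f $ j)^2"
      by (intro tendsto_intros Flim)
    show "\<forall>\<^sub>F i in sequentially. (F i $ (j + 2) - F i $ 2 * F i $ j)^2 \<le> (F i $ 4 - (F i $ 2)^2) * F i $ (2 * j)"
      using ev unfolding F_def by eventually_elim (intro moment_series_shift_sq w finite_lessThan)
  qed simp
  have term_le: "(geo2 (1/2) ^ k) $ (2 * r) \<le> (f ^ k) $ (2 * r)" for k r
    using geo2_power_mono[of "1/2" "f $ 2" k "2 * r"] P1[of k r] f2 by simp
  show "free_moment (geo2 (1/2)) (2 * n) \<le> free_moment f (2 * n)"
    unfolding free_moment_even by (intro divide_right_mono sum_mono mult_left_mono term_le) auto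
  assume n: "n \<ge> 3" and eq: "free_moment f (2 * n) = free_moment (geo2 (1/2)) (2 * n)"
  have "(\<Sum>k\<le>n. real (2 * n + 1 choose k) * ((f ^ k) $ (2 * (n - k)) - (geo2 (1/2) ^ k) $ (2 * (n - k)))) = 0"
    using eq unfolding free_moment_even by (simp add: right_diff_distrib sum_subtractf field_simps)
  then have all: "real (2 * n + 1 choose k) * ((f ^ k) $ (2 * (n - k)) - (geo2 (1/2) ^ k) $ (2 * (n - k))) = 0" if "k \<le> n" for k
    using that term_le by (subst (asm) sum_nonneg_eq_0_iff) auto
  have terms: "(f ^ k) $ (2 * (n - k)) = (geo2 (1/2) ^ k) $ (2 * (n - k))" if "k \<le> n" for k
    using all[OF that] that by (auto simp: binomial_eq_0_iff)
  \<comment> \<open>For n \<ge> 3 the term k = 1 contains the coefficient of order 2 (N + 2) \<ge>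
    4, where \<open>P2\<close> sees the variance of the squares. For n = 2 it would contain
    \<open>f $ 2\<close> only.\<close>
  obtain N where N: "n = N + 3" using n by (metis add.commute le_Suc_ex)
  have "f $ (2 * (N + 2)) = (1/2) ^ (N + 2)"
    using terms[of 1] by (simp add: N geo2_nth)
  moreover have V: "f $ 4 - (f $ 2)^2 \<ge> 0"
    using order_trans[OF zero_le_power2 P3[of 0]] by (simp add: f0)
  ultimately have up: "(f $ 2) ^ (N + 2) + real (N + 1) * (f $ 2) ^ N * (f $ 4 - (f $ 2)^2) \<le> (1/2) ^ (N + 2)"
    using P2[of N] by simp
  have c: "f $ 2 = 1 / 2"
  proof (rule ccontr)
    assume "f $ 2 \<noteq> 1 / 2"
    then have "(1/2) ^ (N + 2) < (f $ 2) ^ (N + 2)"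
      using f2 by (intro power_strict_mono) auto
    moreover have "0 \<le> real (N + 1) * (f $ 2) ^ N * (f $ 4 - (f $ 2)^2)"
      using V c0 by (intro mult_nonneg_nonneg zero_le_power) auto
    ultimately show False using up by simp
  qed
  have V0: "f $ 4 - (f $ 2)^2 = 0"
  proof -
    have "real (N + 1) * (f $ 2) ^ N * (f $ 4 - (f $ 2)^2) \<le> 0" using up by (simp add: c)
    moreover have "real (N + 1) * (f $ 2) ^ N > 0" by (simp add: c)
    ultimately show ?thesis using V by (metis antisym mult_le_0_iff not_le)
  qed
  have step: "f $ (j + 2) = 1 / 2 * f $ j" for j
    using P3[of j] unfolding V0 by (simp add: c)
  \<comment> \<open>The recursion \<open>step\<close> leaves the odd coefficients free up to the
    first. The term k = n - 1 contains the square of \<open>f $ 1\<close> with a positive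
    factor.\<close>
  have f1: "f $ 1 = 0"
  proof -
    have sq: "(h ^ k) $ 2 = real k * h $ 2 + real (k choose 2) * (h $ 1)^2" if "h $ 0 = 1" for h :: "real fps" and k
    proof (induction k)
      case (Suc k)
      have h1: "(h ^ k) $ 1 = real k * h $ 1"
        by (induction k) (simp_all add: fps_mult_nth that fps_nth_power_0 algebra_simps)
      have "real (Suc k choose 2) = real (k choose 2) + real k"
        by (simp add: numeral_2_eq_2)
      then show ?case using Suc h1
        by (simp add: fps_mult_nth that fps_nth_power_0 numeral_2_eq_2 algebra_simps)
    qed simp
    have "(f ^ (N + 2)) $ 2 = (geo2 (1/2) ^ (N + 2)) $ 2"
      using terms[of "N + 2"] by (simp add: N)
    moreover have h: "geo2 (1/2) $ 0 = 1" "geo2 (1/2) $ 1 = 0" "geo2 (1/2) $ 2 = 1/2"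
      by (simp_all add: geo2_nth)
    ultimately have "real (N + 2) * (1/2) + real (N + 2 choose 2) * (f $ 1)^2 = real (N + 2) * (1/2) + real (N + 2 choose 2) * 0^2"
      by (simp only: sq[OF f0] sq[OF h(1)] h c)
    then have "real (N + 2 choose 2) * (f $ 1)^2 = real (N + 2 choose 2) * 0^2"
      by (simp only: add_left_cancel)
    then have "real (N + 2 choose 2) * (f $ 1)^2 = 0" by simp
    then show ?thesis by (auto simp: binomial_eq_0_iff)
  qed
  show "f = geo2 (1/2)"
  proof (rule fps_ext)
    fix n
    show "f $ n = geo2 (1/2) $ n"
    proof (induction n rule: less_induct)
      case (less n)
      consider "n = 0" | "n = 1" | j where "n = j + 2"
        by (rule nat_cases_2)
      then show ?case
      proof cases
        case 3
        then show ?thesis using less[of j] step[of j] by (auto simp: geo2_nth)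
      qed (use f0 f1 in \<open>auto simp: geo2_nth\<close>)
    qed
  qed
qed

section \<open>Tracial von Neumann algebras\<close>

lemma cinner_add_left: "cinner (x + y) z = cinner x z + cinner y (z::'h::chilbert_space)"
  by (metis cinner_add_right cinner_commute complex_cnj_add)

lemma cinner_scaleC_left: "cinner (c *\<^sub>C x) (y::'h::chilbert_space) = cnj c * cinner x y"
  by (metis cinner_scaleC_right cinner_commute complex_cnj_mult)

lemma cinner_zero_right [simp]: "cinner x (0::'h::chilbert_space) = 0"
  using cinner_add_right[of x 0 0] by simp

lemma cinner_diff_left: "cinner (x - y) z = cinner x z - cinner y (z::'h::chilbert_space)"
  using cinner_add_left[of "x - y" y z] by (simp add: algebra_simps)

lemma cinner_eqI:
  assumes "\<And>z. cinner x z = cinner y (z::'h::chilbert_space)"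
  shows "x = y"
proof -
  have "cinner (x - y) (x - y) = 0"
    using assms[of "x - y"] by (simp add: cinner_diff_left)
  then show ?thesis by (simp add: cinner_norm)
qed

lemma apply_bop_inject_ext: "(\<And>x. apply_bop A x = apply_bop B x) \<Longrightarrow> A = B"
  by (metis apply_bop_inject ext)

lemma is_adjoint_unique: "is_adjoint A B \<Longrightarrow> is_adjoint A B' \<Longrightarrow> B = B'"
  unfolding is_adjoint_def by (intro apply_bop_inject_ext cinner_eqI) metis

lemma adj_eq: "is_adjoint A B \<Longrightarrow> adj A = B"
  unfolding adj_def using is_adjoint_unique by blast

lemma is_adjoint_sym: "is_adjoint A B \<Longrightarrow> is_adjoint B A"
  unfolding is_adjoint_def by (metis cinner_commute)

lemma is_adjoint_mult: "is_adjoint A B \<Longrightarrow> is_adjoint C D \<Longrightarrow> is_adjoint (A * C) (D * B)"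
  unfolding is_adjoint_def by (simp add: times_bop.rep_eq)

lemma is_adjoint_add: "is_adjoint A B \<Longrightarrow> is_adjoint C D \<Longrightarrow> is_adjoint (A + C) (B + D)"
  unfolding is_adjoint_def by (simp add: plus_bop.rep_eq cinner_add_right cinner_add_left)

lemma is_adjoint_scaleC: "is_adjoint A B \<Longrightarrow> is_adjoint (c *\<^sub>C A) (cnj c *\<^sub>C B)"
  unfolding is_adjoint_def by (simp add: scaleC_bop.rep_eq cinner_scaleC_right cinner_scaleC_left)

lemma scaleC_of_real_bop: "r *\<^sub>R (A::'h::chilbert_space bop) = complex_of_real r *\<^sub>C A"
  by (simp add: scaleC_of_real)

lemma is_adjoint_scaleR: "is_adjoint A B \<Longrightarrow> is_adjoint (r *\<^sub>R A) (r *\<^sub>R B)"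
  using is_adjoint_scaleC[of A B "complex_of_real r"] by (simp add: scaleC_of_real_bop)

lemma is_adjoint_one: "is_adjoint 1 1"
  unfolding is_adjoint_def by (simp add: one_bop.rep_eq)

lemma is_adjoint_zero: "is_adjoint 0 (0::'h::chilbert_space bop)"
  using is_adjoint_scaleR[OF is_adjoint_one, of 0] by simp

lemma is_adjoint_power: "is_adjoint A B \<Longrightarrow> is_adjoint (A ^ n) (B ^ n)"
proof (induction n)
  case (Suc n)
  then have "is_adjoint (A * A ^ n) (B ^ n * B)" by (intro is_adjoint_mult)
  then show ?case by (simp add: power_commutes)
qed (simp add: is_adjoint_one)

lemma is_adjoint_sum: "(\<And>a. a \<in> A \<Longrightarrow> is_adjoint (f a) (g a)) \<Longrightarrow> is_adjoint (sum f A) (sum g A)"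
  by (induction A rule: infinite_finite_induct) (auto simp: is_adjoint_zero intro: is_adjoint_add)

lemma scaleC_mult_left: "(c *\<^sub>C A) * B = c *\<^sub>C (A * (B::'h::chilbert_space bop))"
  by transfer simp

lemma scaleC_mult_right: "A * (c *\<^sub>C B) = c *\<^sub>C (A * (B::'h::chilbert_space bop))"
  by transfer (simp add: bounded_clinear_def)

lemma commutant_zero: "0 \<in> commutant S"
  by (simp add: commutant_def)

lemma commutant_one: "1 \<in> commutant S"
  by (simp add: commutant_def)

lemma commutant_add: "A \<in> commutant S \<Longrightarrow> B \<in> commutant S \<Longrightarrow> A + B \<in> commutant S"
  by (simp add: commutant_def distrib_left distrib_right)

lemma commutant_mult: "A \<in> commutant S \<Longrightarrow> B \<in> commutant S \<Longrightarrow> A * B \<in> commutant S"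
  unfolding commutant_def by (auto simp: mult.assoc) (metis mult.assoc)

lemma commutant_scaleC: "A \<in> commutant S \<Longrightarrow> c *\<^sub>C A \<in> commutant S"
  by (simp add: commutant_def scaleC_mult_left scaleC_mult_right)

locale tracial =
  fixes M :: "'h::chilbert_space bop set" and \<phi> :: "'h bop \<Rightarrow> complex"
  assumes free_space: "free_probability_space M \<phi>"
begin

lemma bicommutant: "commutant (commutant M) = M"
  using free_space by (simp add: free_probability_space_def von_neumann_algebra_def)

lemma M_zero [simp, intro]: "0 \<in> M" using commutant_zero bicommutant by metis
lemma M_one [simp, intro]: "1 \<in> M" using commutant_one bicommutant by metis
lemma M_add [simp, intro]: "A \<in> M \<Longrightarrow> B \<in> M \<Longrightarrow> A + B \<in> M" using commutant_add bicommutant by metis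
lemma M_mult [simp, intro]: "A \<in> M \<Longrightarrow> B \<in> M \<Longrightarrow> A * B \<in> M" using commutant_mult bicommutant by metis
lemma M_scaleC [simp, intro]: "A \<in> M \<Longrightarrow> c *\<^sub>C A \<in> M" using commutant_scaleC bicommutant by metis
lemma M_scaleR [simp, intro]: "A \<in> M \<Longrightarrow> r *\<^sub>R A \<in> M" by (simp add: scaleC_of_real_bop)
lemma M_uminus [simp, intro]: "A \<in> M \<Longrightarrow> - A \<in> M" using M_scaleR[of A "-1"] by simp
lemma M_minus [simp, intro]: "A \<in> M \<Longrightarrow> B \<in> M \<Longrightarrow> A - B \<in> M" using M_add[of A "- B"] by simp
lemma M_power [simp, intro]: "A \<in> M \<Longrightarrow> A ^ n \<in> M" by (induction n) auto
lemma M_sum [intro]: "(\<And>a. a \<in> I \<Longrightarrow> f a \<in> M) \<Longrightarrow> sum f I \<in> M"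
  by (induction I rule: infinite_finite_induct) auto

lemma phi_add: "A \<in> M \<Longrightarrow> B \<in> M \<Longrightarrow> \<phi> (A + B) = \<phi> A + \<phi> B"
  and phi_scaleC: "A \<in> M \<Longrightarrow> \<phi> (c *\<^sub>C A) = c * \<phi> A"
  and phi_one [simp]: "\<phi> 1 = 1"
  and phi_pos: "A \<in> M \<Longrightarrow> \<phi> (adj A * A) \<in> \<real>\<^sub>\<ge>\<^sub>0"
  and phi_trace: "A \<in> M \<Longrightarrow> B \<in> M \<Longrightarrow> \<phi> (A * B) = \<phi> (B * A)"
  using free_space by (auto simp: free_probability_space_def)

lemma phi_scaleR: "A \<in> M \<Longrightarrow> \<phi> (r *\<^sub>R A) = of_real r * \<phi> A"
  by (simp add: scaleC_of_real_bop phi_scaleC)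

lemma phi_zero [simp]: "\<phi> 0 = 0" using phi_scaleR[of 0 0] by simp

lemma phi_minus: "A \<in> M \<Longrightarrow> B \<in> M \<Longrightarrow> \<phi> (A - B) = \<phi> A - \<phi> B"
  using phi_add[of A "(-1) *\<^sub>R B"] phi_scaleR[of B "-1"] by simp

lemma phi_sum: "(\<And>a. a \<in> I \<Longrightarrow> f a \<in> M) \<Longrightarrow> \<phi> (sum f I) = (\<Sum>a\<in>I. \<phi> (f a))"
  by (induction I rule: infinite_finite_induct) (auto simp: phi_add M_sum)

lemma M_adjoint: "A \<in> M \<Longrightarrow> \<exists>B\<in>M. is_adjoint A B"
  using free_space by (simp add: free_probability_space_def von_neumann_algebra_def)

lemma adj_is_adjoint: "A \<in> M \<Longrightarrow> is_adjoint A (adj A)"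
  using M_adjoint adj_eq by metis

lemma M_adj [simp, intro]: "A \<in> M \<Longrightarrow> adj A \<in> M"
  using M_adjoint adj_eq by metis

definition sqnorm :: "'h bop \<Rightarrow> real" where
  "sqnorm A = Re (\<phi> (adj A * A))"

lemma sqnorm_eq: "A \<in> M \<Longrightarrow> \<phi> (adj A * A) = of_real (sqnorm A)"
  using phi_pos[of A] by (auto simp: sqnorm_def elim!: nonneg_Reals_cases)

lemma sqnorm_nonneg: "A \<in> M \<Longrightarrow> sqnorm A \<ge> 0"
  using phi_pos[of A] by (auto simp: sqnorm_def elim!: nonneg_Reals_cases)

lemma sqnorm_add_scale:
  assumes A: "A \<in> M" and B: "B \<in> M"
  shows "of_real (sqnorm (A + c *\<^sub>C B))
    = of_real (sqnorm A) + c * \<phi> (adj A * B) + cnj c * \<phi> (adj B * A) + (c * cnj c) * of_real (sqnorm B)"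
proof -
  have "adj (A + c *\<^sub>C B) = adj A + cnj c *\<^sub>C adj B"
    by (intro adj_eq is_adjoint_add is_adjoint_scaleC adj_is_adjoint A B)
  then have "adj (A + c *\<^sub>C B) * (A + c *\<^sub>C B)
      = adj A * A + c *\<^sub>C (adj A * B) + cnj c *\<^sub>C (adj B * A) + (c * cnj c) *\<^sub>C (adj B * B)"
    by (simp add: distrib_left distrib_right scaleC_mult_left scaleC_mult_right scaleC_scaleC mult.commute scaleC_add_right add_ac)
  then show ?thesis
    using A B by (simp add: phi_add phi_scaleC flip: sqnorm_eq)
qed

text \<open>Hermitian symmetry by polarization: positivity makes the values of \<phi> at the squares
  of A + B and A + i B real.\<close>

lemma phi_adj_commute:
  assumes A: "A \<in> M" and B: "B \<in> M"
  shows "\<phi> (adj B * A) = cnj (\<phi> (adj A * B))"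
proof -
  have "Im (\<phi> (adj A * B) + \<phi> (adj B * A)) = 0"
    using arg_cong[OF sqnorm_add_scale[OF A B, of 1], of Im] by simp
  moreover have "Re (\<phi> (adj A * B)) - Re (\<phi> (adj B * A)) = 0"
    using arg_cong[OF sqnorm_add_scale[OF A B, of \<i>], of Im] by simp
  ultimately show ?thesis by (simp add: complex_eq_iff)
qed

lemma phi_cauchy_schwarz:
  assumes A: "A \<in> M" and B: "B \<in> M"
  shows "cmod (\<phi> (adj A * B)) ^ 2 \<le> sqnorm A * sqnorm B"
proof -
  define s where "s = \<phi> (adj A * B)"
  define t where "t = cmod s ^ 2"
  have ss: "s * cnj s = of_real t" unfolding t_def by (rule complex_norm_square[symmetric])
  have q: "0 \<le> sqnorm A - 2 * x * t + x ^ 2 * t * sqnorm B" for x :: real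
  proof -
    \<comment> \<open>The phase of \<open>s\<close> is put into the scalar, so that a real quadratic
      in \<open>x\<close> results.\<close>
    define c where "c = - of_real x * cnj s"
    have "complex_of_real (sqnorm (A + c *\<^sub>C B)) = of_real (sqnorm A) + c * s + cnj c * cnj s + (c * cnj c) * of_real (sqnorm B)"
      using sqnorm_add_scale[OF A B, of c] phi_adj_commute[OF A B] by (simp add: s_def)
    also have "\<dots> = of_real (sqnorm A) - 2 * of_real x * (s * cnj s) + of_real x ^ 2 * (s * cnj s) * of_real (sqnorm B)"
      by (simp add: c_def algebra_simps power2_eq_square)
    also have "\<dots> = complex_of_real (sqnorm A - 2 * x * t + x ^ 2 * t * sqnorm B)"
      by (simp add: ss)
    finally have "sqnorm (A + c *\<^sub>C B) = sqnorm A - 2 * x * t + x ^ 2 * t * sqnorm B"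
      by (simp only: of_real_eq_iff)
    then show ?thesis using sqnorm_nonneg[of "A + c *\<^sub>C B"] A B by simp
  qed
  have t0: "t \<ge> 0" by (simp add: t_def)
  have a0: "sqnorm A \<ge> 0" by (rule sqnorm_nonneg[OF A])
  show ?thesis
  proof (cases "sqnorm B = 0")
    case True
    have "t \<le> 0"
    proof (rule ccontr)
      assume "\<not> t \<le> 0"
      then show False using q[of "(sqnorm A + 1) / t"] True a0 by simp
    qed
    then show ?thesis using t0 True by (simp add: t_def s_def)
  next
    case False
    then have b: "sqnorm B > 0" using sqnorm_nonneg[OF B] by simp
    have "0 \<le> sqnorm A - t / sqnorm B"
      using q[of "1 / sqnorm B"] b by (simp add: power2_eq_square)
    then show ?thesis using b by (simp add: t_def s_def field_simps)
  qed
qed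

end

section \<open>Semicircular moments\<close>

definition sc_integral :: "real \<Rightarrow> nat \<Rightarrow> real" where
  "sc_integral v n = integral {- 2 * sqrt v .. 2 * sqrt v} (\<lambda>x. x ^ n * sqrt (4 * v - x\<^sup>2))"

definition sc_moment :: "real \<Rightarrow> nat \<Rightarrow> real" where
  "sc_moment v n = (LINT x|semicircle_distribution v. x ^ n)"

lemma sc_moment_eq:
  assumes v: "v > 0"
  shows "sc_moment v n = sc_integral v n / (2 * pi * v)"
proof -
  let ?S = "{- 2 * sqrt v .. 2 * sqrt v}"
  define g where "g x = sqrt (4 * v - x\<^sup>2) / (2 * pi * v) * indicator ?S x" for x
  have dens: "ennreal (sqrt (4 * v - x\<^sup>2) / (2 * pi * v)) * indicator ?S x = ennreal (g x)" for x
    by (simp add: g_def indicator_def)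
  have g0: "g x \<ge> 0" for x
  proof (cases "x \<in> ?S")
    case True
    then have "\<bar>x\<bar> \<le> 2 * sqrt v" by auto
    then have "\<bar>x\<bar>\<^sup>2 \<le> (2 * sqrt v)\<^sup>2" by (intro power_mono) auto
    then have "x\<^sup>2 \<le> 4 * v" using v by (simp add: power_mult_distrib)
    then show ?thesis using v by (simp add: g_def)
  qed (simp add: g_def)
  have "sc_moment v n = (LINT x|lborel. g x *\<^sub>R x ^ n)"
    unfolding sc_moment_def semicircle_distribution_def dens
  proof (rule integral_density)
    show "AE x in lborel. 0 \<le> g x" by (simp add: g0)
    show "g \<in> borel_measurable lborel" unfolding g_def by measurable
  qed simp
  also have "\<dots> = (LINT x:?S|lborel. x ^ n * sqrt (4 * v - x\<^sup>2)) / (2 * pi * v)"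
    unfolding set_lebesgue_integral_def
    by (subst integral_divide_zero[symmetric]) (auto simp: g_def field_simps intro!: Bochner_Integration.integral_cong)
  also have "(LINT x:?S|lborel. x ^ n * sqrt (4 * v - x\<^sup>2)) = sc_integral v n"
    unfolding sc_integral_def
    by (intro set_borel_integral_eq_integral borel_integrable_atLeastAtMost') (auto intro!: continuous_intros)
  finally show ?thesis .
qed

text \<open>Integrates the derivative of x^m (4 v - x^2)^(3/2), which vanishes at both endpoints.
  For m = 0 the truncated index m - 1 is multiplied by 0, and the first moment vanishes.\<close>

lemma sc_integral_rec:
  assumes v: "v > 0"
  shows "(real m + 3) * sc_integral v (m + 1) = 4 * v * real m * sc_integral v (m - 1)"
proof -
  let ?R = "2 * sqrt v"
  define H where "H x = x ^ m * ((4 * v - x\<^sup>2) * sqrt (4 * v - x\<^sup>2))" for x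
  define h where "h n x = x ^ n * sqrt (4 * v - x\<^sup>2)" for n :: nat and x
  have int: "(h n has_integral sc_integral v n) {- ?R .. ?R}" for n
    unfolding sc_integral_def h_def
    by (simp, intro integrable_integral integrable_continuous_interval continuous_intros)
  have R2: "?R\<^sup>2 = 4 * v" using v by (simp add: power_mult_distrib)
  have der: "(H has_vector_derivative (4 * v * real m * h (m - 1) x - (real m + 3) * h (m + 1) x)) (at x)"
    if x: "x \<in> {- ?R <..< ?R}" for x
  proof -
    have "\<bar>x\<bar> < ?R" using x by auto
    then have "\<bar>x\<bar>\<^sup>2 < ?R\<^sup>2" by (intro power_strict_mono) auto
    then have pos: "4 * v - x\<^sup>2 > 0" by (simp only: R2 power2_abs diff_gt_0_iff_gt)
    define s where "s = sqrt (4 * v - x\<^sup>2)"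
    have s: "s > 0" "s * s = 4 * v - x\<^sup>2" using pos by (simp_all add: s_def)
    have "(H has_real_derivative
        real m * x ^ (m - 1) * ((4 * v - x\<^sup>2) * s) + x ^ m * ((- (2 * x)) * s + (4 * v - x\<^sup>2) * (- (2 * x) * (inverse s / 2)))) (at x)"
      unfolding H_def s_def using pos
      by (auto intro!: derivative_eq_intros simp: field_simps)
    moreover have "real m * x ^ (m - 1) * ((4 * v - x\<^sup>2) * s) + x ^ m * ((- (2 * x)) * s + (4 * v - x\<^sup>2) * (- (2 * x) * (inverse s / 2)))
      = 4 * v * real m * h (m - 1) x - (real m + 3) * h (m + 1) x"
    proof -
      have e1: "(4 * v - x\<^sup>2) * (- (2 * x) * (inverse s / 2)) = - x * s"
        unfolding s(2)[symmetric] using s(1) by (simp add: field_simps)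
      have e2: "real m * x ^ (m - 1) * x\<^sup>2 = real m * x ^ (m + 1)"
        by (cases m) (simp_all add: power2_eq_square)
      have "real m * x ^ (m - 1) * ((4 * v - x\<^sup>2) * s) + x ^ m * ((- (2 * x)) * s + - x * s)
        = 4 * v * real m * (x ^ (m - 1) * s) - (real m * x ^ (m - 1) * x\<^sup>2) * s - 3 * (x ^ (m + 1) * s)"
        by (simp add: algebra_simps)
      then show ?thesis
        unfolding e1 e2 h_def s_def[symmetric] by (simp add: algebra_simps del: power_Suc)
    qed
    ultimately show ?thesis by (simp add: has_real_derivative_iff_has_vector_derivative)
  qed
  have "((\<lambda>x. 4 * v * real m * h (m - 1) x - (real m + 3) * h (m + 1) x) has_integral H ?R - H (- ?R)) {- ?R .. ?R}"
    using v der unfolding H_def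
    by (intro fundamental_theorem_of_calculus_interior) (auto intro!: continuous_intros)
  moreover have "((\<lambda>x. 4 * v * real m * h (m - 1) x - (real m + 3) * h (m + 1) x) has_integral
      4 * v * real m * sc_integral v (m - 1) - (real m + 3) * sc_integral v (m + 1)) {- ?R .. ?R}"
    by (intro has_integral_diff has_integral_mult_right int)
  ultimately have "H ?R - H (- ?R) = 4 * v * real m * sc_integral v (m - 1) - (real m + 3) * sc_integral v (m + 1)"
    by (rule has_integral_unique)
  moreover have "H ?R = 0" "H (- ?R) = 0"
    unfolding H_def power2_minus R2 by simp_all
  ultimately show ?thesis by simp
qed

text \<open>Turns the two-term recursion into the Catalan convolution. With G the moment series, K =
  1 - 2 v X^2 G and Q = 1 - 4 v X^2, the recursion reads K' Q = -4 v X K. Hence K^2 / Q is constant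
  and K^2 = Q, a quadratic equation for G.\<close>

lemma sc_moment_rec:
  assumes v: "v > 0" and one: "sc_moment v 0 = 1"
  shows "sc_moment v (Suc n) = v * (\<Sum>s<n. sc_moment v s * sc_moment v (n - 1 - s))"
proof -
  define c where "c = sc_moment v"
  have rec: "(real m + 3) * c (m + 1) = 4 * v * real m * c (m - 1)" for m
    using sc_integral_rec[OF v, of m] v unfolding c_def sc_moment_eq[OF v] by (simp add: field_simps)
  define G where "G = Abs_fps c"
  define K where "K = 1 - fc (2 * v) * fps_X ^ 2 * G"
  define Q where "Q = 1 - fc (4 * v) * fps_X ^ 2"
  have K: "K $ n = (if n = 0 then 1 else if n = 1 then 0 else - 2 * v * c (n - 2))" for n
    by (auto simp: K_def G_def mult.assoc fps_X_power_mult_nth)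
  have Krec: "real (n + 2) * K $ (n + 2) = 4 * v * (real n - 1) * K $ n" for n
  proof -
    consider "n = 0" | "n = 1" | m where "n = m + 2"
      by (rule nat_cases_2)
    then show ?thesis
    proof cases
      case 1
      then show ?thesis using one by (simp add: K c_def)
    next
      case 2
      then show ?thesis using rec[of 0] by (simp add: K)
    next
      case 3
      then show ?thesis using rec[of "m + 1"] by (simp add: K algebra_simps)
    qed
  qed
  have KQ: "fps_deriv K * Q = - (fc (4 * v) * (fps_X * K))"
  proof (rule fps_ext)
    fix n
    have "(fps_deriv K * Q) $ n = (fps_deriv K - fc (4 * v) * (fps_X * (fps_X * fps_deriv K))) $ n"
      by (simp add: Q_def algebra_simps power2_eq_square)
    also have "\<dots> = (- (fc (4 * v) * (fps_X * K))) $ n"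
    proof (cases n)
      case 0
      then show ?thesis by (simp add: K)
    next
      case (Suc m)
      then show ?thesis
        using Krec[of m] by (cases m) (simp_all add: algebra_simps)
    qed
    finally show "(fps_deriv K * Q) $ n = (- (fc (4 * v) * (fps_X * K))) $ n" .
  qed
  have Q': "fps_deriv Q = - (fc (8 * v) * fps_X)"
    by (simp add: Q_def power2_eq_square algebra_simps)
  have "fps_deriv (K ^ 2) * Q = 2 * K * (fps_deriv K * Q)"
    by (simp add: power2_eq_square algebra_simps)
  also have "\<dots> = K ^ 2 * fps_deriv Q"
    unfolding KQ Q' by (simp add: power2_eq_square algebra_simps numeral_fps_const)
  finally have eq: "fps_deriv (K ^ 2) * Q = K ^ 2 * fps_deriv Q" .
  have Q0: "Q $ 0 = 1" by (simp add: Q_def)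
  then have QI: "Q * inverse Q = 1" by (simp add: inverse_mult_eq_1')
  have "fps_deriv (K ^ 2 * inverse Q) = (fps_deriv (K ^ 2) * Q - K ^ 2 * fps_deriv Q) * inverse Q ^ 2"
  proof -
    have "fps_deriv (K ^ 2 * inverse Q) = fps_deriv (K ^ 2) * inverse Q * (Q * inverse Q) - K ^ 2 * (fps_deriv Q * inverse Q ^ 2)"
      using Q0 by (subst QI) (simp add: fps_inverse_deriv algebra_simps power2_eq_square)
    then show ?thesis by (simp add: algebra_simps power2_eq_square)
  qed
  then have "fps_deriv (K ^ 2 * inverse Q) = 0" by (simp add: eq)
  then obtain k where k: "K ^ 2 * inverse Q = fc k"
    by (metis fps_deriv_eq_0_iff)
  have "k = (K ^ 2 * inverse Q) $ 0" by (simp add: k)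
  also have "\<dots> = 1" by (simp add: K Q0 fps_nth_power_0)
  finally have "k = 1" .
  have "K ^ 2 = (K ^ 2 * inverse Q) * Q" using QI by (simp add: mult_ac)
  then have "K ^ 2 = Q" by (simp add: k \<open>k = 1\<close>)
  have "fc (4 * v) * fps_X ^ 2 * G = fc (4 * v) * fps_X ^ 2 * (1 + fc v * fps_X ^ 2 * G ^ 2)"
  proof -
    have n: "fc (4 * v) = 4 * fc v" "fc (2 * v) = 2 * fc v"
      by (simp_all add: numeral_fps_const)
    show ?thesis
      using \<open>K ^ 2 = Q\<close> unfolding K_def Q_def n
      by (simp add: power2_eq_square algebra_simps)
  qed
  then have "G = 1 + fc v * (fps_X ^ 2 * G ^ 2)"
    using v by (simp add: mult.assoc)
  then have "G $ Suc n = (1 + fc v * (fps_X ^ 2 * G ^ 2)) $ Suc n" by simp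
  then have "c (Suc n) = v * (if n = 0 then 0 else (G ^ 2) $ (n - 1))"
    by (simp add: G_def fps_X_power_mult_nth)
  also have "(if n = 0 then 0 else (G ^ 2) $ (n - 1)) = (\<Sum>s<n. c s * c (n - 1 - s))"
    by (cases n) (auto simp: power2_eq_square fps_mult_nth G_def lessThan_Suc_atMost atLeast0AtMost)
  finally show ?thesis by (simp add: c_def)
qed

context tracial begin

text \<open>Total mass 1 is obtained from the law being a probability measure, not from the area of
  a half disc.\<close>

lemma semicircular_moments:
  assumes "semicircular \<phi> v X" "v > 0"
  shows "\<phi> (X ^ n) = of_real (sc_moment v n)" "sc_moment v 0 = 1"
proof -
  have law: "is_law \<phi> X (semicircle_distribution v)"
    using assms by (simp add: semicircular_def)
  then show "\<phi> (X ^ n) = of_real (sc_moment v n)"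
    by (simp add: is_law_def sc_moment_def)
  show "sc_moment v 0 = 1"
    using law by (simp add: is_law_def sc_moment_def prob_space.prob_space)
qed

lemma semicircular_rec:
  assumes "semicircular \<phi> v X" "v > 0"
  shows "\<phi> (X ^ Suc n) = of_real v * (\<Sum>s<n. \<phi> (X ^ s) * \<phi> (X ^ (n - 1 - s)))"
  unfolding semicircular_moments(1)[OF assms] sc_moment_rec[OF assms(2) semicircular_moments(2)[OF assms], of n]
  by simp

end

section \<open>The Schwinger-Dyson equation\<close>

text \<open>The linear extension of t^n \<mapsto> c n. Taking operators or scalars for the values
  covers both evaluation at an operator and functionals of a polynomial.\<close>

definition lin :: "(nat \<Rightarrow> 'b::complex_vector) \<Rightarrow> complex poly \<Rightarrow> 'b" where
  "lin c p = (\<Sum>n\<le>degree p. coeff p n *\<^sub>C c n)"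

lemma scaleC_zero_left [simp]: "0 *\<^sub>C (x::'b::complex_vector) = 0"
  using scaleC_of_real[of 0 x] by simp

lemma scaleC_one [simp]: "1 *\<^sub>C (x::'b::complex_vector) = x"
  using scaleC_of_real[of 1 x] by simp

lemma scaleC_sum_right: "c *\<^sub>C sum f A = (\<Sum>a\<in>A. c *\<^sub>C (f a::'b::complex_vector))"
  by (induction A rule: infinite_finite_induct) (simp_all add: scaleC_zero_right scaleC_add_right)

lemma lin_bound: "degree p \<le> N \<Longrightarrow> lin c p = (\<Sum>n\<le>N. coeff p n *\<^sub>C c n)"
  unfolding lin_def by (rule sum.mono_neutral_left) (auto simp: coeff_eq_0)

lemma lin_0 [simp]: "lin c 0 = 0"
  by (simp add: lin_def)

lemma lin_add: "lin c (p + q) = lin c p + lin c q"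
proof -
  let ?N = "max (degree p) (degree q)"
  show ?thesis
    using lin_bound[of p ?N c] lin_bound[of q ?N c] lin_bound[of "p + q" ?N c] degree_add_le_max[of p q]
    by (simp add: scaleC_add_left sum.distrib)
qed

lemma lin_smult: "lin c (smult a p) = a *\<^sub>C lin c p"
  using lin_bound[of "smult a p" "degree p" c]
  by (simp add: degree_smult_le lin_def scaleC_sum_right scaleC_scaleC)

lemma lin_pCons: "lin c (pCons a p) = a *\<^sub>C c 0 + lin (\<lambda>n. c (Suc n)) p"
proof -
  have "lin c (pCons a p) = (\<Sum>n\<le>Suc (degree p). coeff (pCons a p) n *\<^sub>C c n)"
    by (rule lin_bound) (simp add: degree_pCons_le)
  then show ?thesis
    by (simp only: sum.atMost_Suc_shift coeff_pCons_0 coeff_pCons_Suc lin_def)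
qed

lemma lin_cong_add: "lin (\<lambda>n. c n + c' n) p = lin c p + lin c' p"
  by (simp add: lin_def scaleC_add_right sum.distrib)

instantiation complex :: complex_vector
begin
definition scaleC_complex :: "complex \<Rightarrow> complex \<Rightarrow> complex" where "scaleC_complex c x = c * x"
instance by standard (simp_all add: scaleC_complex_def algebra_simps scaleR_conv_of_real)
end

lemma lin_cong_scale: "lin (\<lambda>n. a * c n) p = a * lin c p" for c :: "nat \<Rightarrow> complex"
  by (simp add: lin_def scaleC_complex_def sum_distrib_left mult_ac)

definition pe :: "complex poly \<Rightarrow> 'h::chilbert_space bop \<Rightarrow> 'h bop" where
  "pe p A = lin (\<lambda>n. A ^ n) p"

lemma pe_0 [simp]: "pe 0 A = 0" and pe_add: "pe (p + q) A = pe p A + pe q A"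
  and pe_smult: "pe (smult a p) A = a *\<^sub>C pe p A"
  by (simp_all add: pe_def lin_add lin_smult)

lemma lin_mult_left: "lin (\<lambda>n. A * c n) p = A * lin c p" for A :: "'h::chilbert_space bop"
  by (simp add: lin_def sum_distrib_left scaleC_mult_right)

lemma pe_pCons: "pe (pCons a p) A = a *\<^sub>C 1 + A * pe p A"
  by (simp add: pe_def lin_pCons lin_mult_left)

lemma pe_mult: "pe (p * q) A = pe p A * pe q A"
  by (induction p) (simp_all add: pe_pCons pe_add pe_smult distrib_right scaleC_mult_left mult.assoc)

lemma generated_power: "A ^ n \<in> generated_algebra A"
  by (induction n) (auto intro: generated_algebra.intros)

lemma generated_pe: "pe p A \<in> generated_algebra A"
  by (induction p) (use generated_algebra.scale[OF generated_algebra.one, of 0] in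
    \<open>auto simp: pe_pCons intro: generated_algebra.intros\<close>)

lemma generated_center: "B \<in> generated_algebra A \<Longrightarrow> B - c *\<^sub>C 1 \<in> generated_algebra A"
proof -
  assume "B \<in> generated_algebra A"
  then have "B + (- c) *\<^sub>C 1 \<in> generated_algebra A"
    by (intro generated_algebra.intros)
  moreover have "(- c) *\<^sub>C (1::'a bop) = - (c *\<^sub>C 1)"
    using scaleC_add_left[of "- c" c "1::'a bop"] by (simp add: eq_neg_iff_add_eq_0)
  ultimately show ?thesis by simp
qed

lemma not_distinct_adj_split:
  "\<not> distinct_adj xs \<Longrightarrow> \<exists>us x vs. xs = us @ x # x # vs"
proof (induction xs)
  case (Cons a xs)
  show ?case
  proof (cases "distinct_adj xs")
    case True
    then obtain ys where "xs = a # ys"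
      using Cons.prems by (cases xs) auto
    then show ?thesis by (metis append_Nil)
  next
    case False
    then show ?thesis using Cons.IH by (metis append_Cons)
  qed
qed simp

context tracial begin

lemma generated_in_M: "A \<in> M \<Longrightarrow> B \<in> generated_algebra A \<Longrightarrow> B \<in> M"
  by (rotate_tac, induction rule: generated_algebra.induct) auto

lemma pe_in_M: "A \<in> M \<Longrightarrow> pe p A \<in> M"
  using generated_in_M generated_pe by blast

text \<open>The difference quotient of p at A, framed by U and V, with \<phi> applied to both tensor
  legs.\<close>

definition bd :: "complex poly \<Rightarrow> 'h bop \<Rightarrow> 'h bop \<Rightarrow> 'h bop \<Rightarrow> complex" where
  "bd p U A V = lin (\<lambda>n. \<Sum>s<n. \<phi> (U * A ^ s) * \<phi> (A ^ (n - 1 - s) * V)) p"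

lemma bd_0 [simp]: "bd 0 U A V = 0" and bd_add: "bd (p + q) U A V = bd p U A V + bd q U A V"
  and bd_smult: "bd (smult a p) U A V = a * bd p U A V"
  by (simp_all add: bd_def lin_add lin_smult scaleC_complex_def)

lemma phi_lin_left:
  "A \<in> M \<Longrightarrow> V \<in> M \<Longrightarrow> lin (\<lambda>n. \<phi> (A ^ n * V)) p = \<phi> (pe p A * V)"
  by (simp add: lin_def pe_def sum_distrib_right phi_sum scaleC_mult_left phi_scaleC scaleC_complex_def)

lemma bd_pCons:
  assumes "U \<in> M" "A \<in> M" "V \<in> M"
  shows "bd (pCons a p) U A V = \<phi> U * \<phi> (pe p A * V) + bd p (U * A) A V"
proof -
  have "(\<Sum>s<Suc n. \<phi> (U * A ^ s) * \<phi> (A ^ (Suc n - 1 - s) * V))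
      = \<phi> U * \<phi> (A ^ n * V) + (\<Sum>s<n. \<phi> (U * A * A ^ s) * \<phi> (A ^ (n - 1 - s) * V))" for n
    by (subst sum.lessThan_Suc_shift) (auto simp: mult.assoc intro!: sum.cong)
  then show ?thesis
    unfolding bd_def lin_pCons lin_cong_add by (simp add: lin_cong_scale lin_cong_add phi_lin_left assms scaleC_complex_def)
qed

lemma bd_add_U:
  assumes "U \<in> M" "U' \<in> M" "A \<in> M"
  shows "bd p (U + U') A V = bd p U A V + bd p U' A V"
proof -
  have "\<phi> ((U + U') * A ^ s) = \<phi> (U * A ^ s) + \<phi> (U' * A ^ s)" for s
    using assms by (simp add: distrib_right phi_add)
  then show ?thesis
    by (simp add: bd_def distrib_right sum.distrib lin_cong_add)
qed

lemma bd_scale_U: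
  assumes "U \<in> M" "A \<in> M"
  shows "bd p (c *\<^sub>C U) A V = c * bd p U A V"
proof -
  have "\<phi> ((c *\<^sub>C U) * A ^ s) = c * \<phi> (U * A ^ s)" for s
    using assms by (simp add: scaleC_mult_left phi_scaleC)
  then show ?thesis
    by (simp add: bd_def mult.assoc lin_cong_scale flip: sum_distrib_left)
qed

lemma bd_add_V:
  assumes "V \<in> M" "V' \<in> M" "A \<in> M"
  shows "bd p U A (V + V') = bd p U A V + bd p U A V'"
proof -
  have "\<phi> (A ^ s * (V + V')) = \<phi> (A ^ s * V) + \<phi> (A ^ s * V')" for s
    using assms by (simp add: distrib_left phi_add)
  then show ?thesis
    by (simp add: bd_def distrib_left sum.distrib lin_cong_add)
qed

lemma bd_scale_V:
  assumes "V \<in> M" "A \<in> M"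
  shows "bd p U A (c *\<^sub>C V) = c * bd p U A V"
proof -
  have "\<phi> (A ^ s * (c *\<^sub>C V)) = c * \<phi> (A ^ s * V)" for s
    using assms by (simp add: scaleC_mult_right phi_scaleC)
  then show ?thesis
    by (simp add: bd_def mult.left_commute lin_cong_scale flip: sum_distrib_left)
qed

text \<open>The Leibniz rule, needed to merge neighbouring factors in the same variable.\<close>

lemma bd_mult:
  assumes "U \<in> M" "A \<in> M" "V \<in> M"
  shows "bd (p * q) U A V = bd p U A (pe q A * V) + bd q (U * pe p A) A V"
  using assms(1)
proof (induction p arbitrary: U)
  case 0
  have "bd q 0 A V = 0" using bd_scale_U[of 0 A q 0 V] assms by simp
  then show ?case by simp
next
  case (pCons a p)
  note m = pCons.prems assms(2,3) pe_in_M[OF assms(2)]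
  have "bd (pCons a p * q) U A V = a * bd q U A V + (\<phi> U * \<phi> (pe (p * q) A * V) + bd (p * q) (U * A) A V)"
    using m by (simp add: bd_add bd_smult bd_pCons)
  also have "bd (p * q) (U * A) A V = bd p (U * A) A (pe q A * V) + bd q (U * A * pe p A) A V"
    using m by (intro pCons.IH) auto
  also have "a * bd q U A V + (\<phi> U * \<phi> (pe (p * q) A * V) + (bd p (U * A) A (pe q A * V) + bd q (U * A * pe p A) A V))
     = bd (pCons a p) U A (pe q A * V) + bd q (U * pe (pCons a p) A) A V"
  proof -
    have "U * pe (pCons a p) A = a *\<^sub>C U + U * A * pe p A"
      by (simp add: pe_pCons distrib_left scaleC_mult_right mult.assoc)
    then show ?thesis
      using m by (simp add: bd_pCons bd_add_U bd_scale_U pe_mult mult.assoc)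
  qed
  finally show ?case .
qed

end

text \<open>\<open>X_rec\<close> is the Schwinger-Dyson equation for powers of one variable; it is
  the form in which the semicircle law enters.\<close>

locale free_family = tracial M \<phi> for M :: "'h::chilbert_space bop set" and \<phi> +
  fixes I :: "'i set" and X :: "'i \<Rightarrow> 'h bop" and v :: "'i \<Rightarrow> real"
  assumes X_M: "i \<in> I \<Longrightarrow> X i \<in> M"
    and free: "freely_independent \<phi> I X"
    and X_rec: "i \<in> I \<Longrightarrow> \<phi> (X i ^ Suc n) = of_real (v i) * (\<Sum>s<n. \<phi> (X i ^ s) * \<phi> (X i ^ (n - 1 - s)))"
begin

text \<open>Words of polynomials labelled by their variable: freeness speaks of alternating
  products, which cannot be recognized from the operators alone.\<close>

fun ev :: "('i \<times> complex poly) list \<Rightarrow> 'h bop" where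
  "ev [] = 1"
| "ev ((k, p) # ps) = pe p (X k) * ev ps"

text \<open>The free difference quotient in the direction \<open>X i\<close> of \<open>U * ev ps * V\<close>, restricted to the
  occurrences of \<open>X i\<close> in \<open>ps\<close>, with \<open>\<phi>\<close> applied to both tensor legs.\<close>

fun fdq :: "'i \<Rightarrow> 'h bop \<Rightarrow> ('i \<times> complex poly) list \<Rightarrow> 'h bop \<Rightarrow> complex" where
  "fdq i U [] V = 0"
| "fdq i U ((k, p) # ps) V = (if k = i then bd p U (X k) (ev ps * V) else 0) + fdq i (U * pe p (X k)) ps V"

definition valid :: "('i \<times> complex poly) list \<Rightarrow> bool" where
  "valid ps \<longleftrightarrow> fst ` set ps \<subseteq> I"

lemma valid_simps [simp]:
  "valid []" "valid ((k, p) # ps) \<longleftrightarrow> k \<in> I \<and> valid ps" "valid (ps @ qs) \<longleftrightarrow> valid ps \<and> valid qs"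
  by (auto simp: valid_def)

lemma ev_M [simp]: "valid ps \<Longrightarrow> ev ps \<in> M"
  by (induction ps rule: ev.induct) (auto simp: pe_in_M X_M)

lemma ev_append: "ev (ps @ qs) = ev ps * ev qs"
  by (induction ps rule: ev.induct) (simp_all add: mult.assoc)

lemma fdq_append:
  "fdq i U (ps @ qs) V = fdq i U ps (ev qs * V) + fdq i (U * ev ps) qs V"
  by (induction i U ps V rule: fdq.induct) (simp_all add: ev_append mult.assoc)

lemma fdq_add_U:
  assumes "valid ps" "U \<in> M" "U' \<in> M"
  shows "fdq i (U + U') ps V = fdq i U ps V + fdq i U' ps V"
  using assms by (induction ps arbitrary: U U') (auto simp: bd_add_U X_M pe_in_M distrib_right)

lemma fdq_scale_U:
  assumes "valid ps" "U \<in> M"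
  shows "fdq i (c *\<^sub>C U) ps V = c * fdq i U ps V"
  using assms by (induction ps arbitrary: U) (auto simp: bd_scale_U X_M pe_in_M scaleC_mult_left distrib_left)

lemma fdq_add_V:
  assumes "valid ps" "V \<in> M" "V' \<in> M"
  shows "fdq i U ps (V + V') = fdq i U ps V + fdq i U ps V'"
  using assms by (induction ps arbitrary: U) (auto simp: bd_add_V X_M pe_in_M distrib_left)

lemma fdq_scale_V:
  assumes "valid ps" "V \<in> M"
  shows "fdq i U ps (c *\<^sub>C V) = c * fdq i U ps V"
  using assms by (induction ps arbitrary: U) (auto simp: bd_scale_V X_M pe_in_M scaleC_mult_right distrib_left)

text \<open>Integration by parts against a free semicircular family, for the word
  \<open>ps\<close>.\<close>

definition SD :: "'i \<Rightarrow> ('i \<times> complex poly) list \<Rightarrow> bool" where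
  "SD i ps \<longleftrightarrow> \<phi> (X i * ev ps) = of_real (v i) * fdq i 1 ps 1"

lemma SD_split: "SD i (us @ (k, p) # vs) \<longleftrightarrow> \<phi> (X i * (ev us * (pe p (X k) * ev vs))) = of_real (v i) *
    (fdq i 1 us (pe p (X k) * ev vs) + ((if k = i then bd p (ev us) (X k) (ev vs) else 0) + fdq i (ev us * pe p (X k)) vs 1))"
  by (simp add: SD_def ev_append fdq_append)

lemma SD_add:
  assumes i: "i \<in> I" and val: "valid us" "valid vs" "k \<in> I"
    and S: "SD i (us @ (k, p) # vs)" "SD i (us @ (k, q) # vs)"
  shows "SD i (us @ (k, p + q) # vs)"
proof -
  note m = X_M[OF i] X_M[OF val(3)] pe_in_M[OF X_M[OF val(3)]] ev_M[OF val(1)] ev_M[OF val(2)]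
  show ?thesis
    using S m val unfolding SD_split
    by (simp add: pe_add distrib_left distrib_right phi_add fdq_add_V fdq_add_U bd_add)
qed

lemma SD_const:
  assumes i: "i \<in> I" and val: "valid us" "valid vs" "k \<in> I" and S: "SD i (us @ vs)"
  shows "SD i (us @ (k, [:c:]) # vs)"
proof -
  note m = X_M[OF i] X_M[OF val(3)] ev_M[OF val(1)] ev_M[OF val(2)]
  have pe: "pe [:c:] (X k) = c *\<^sub>C 1" by (simp add: pe_pCons)
  have bd: "bd [:c:] (ev us) (X k) (ev vs) = 0"
    using m by (simp add: bd_pCons)
  show ?thesis
    using S m val unfolding SD_split pe bd
    by (simp add: SD_def ev_append fdq_append scaleC_mult_left scaleC_mult_right phi_scaleC fdq_scale_V fdq_scale_U algebra_simps)
qed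

lemma SD_merge:
  assumes i: "i \<in> I" and val: "valid us" "valid vs" "k \<in> I" and S: "SD i (us @ (k, p * q) # vs)"
  shows "SD i (us @ (k, p) # (k, q) # vs)"
proof -
  note m = X_M[OF i] X_M[OF val(3)] pe_in_M[OF X_M[OF val(3)]] ev_M[OF val(1)] ev_M[OF val(2)]
  show ?thesis
    using S m unfolding SD_split
    by (simp add: pe_mult mult.assoc bd_mult fdq_append)
qed

definition centered :: "('i \<times> complex poly) list \<Rightarrow> bool" where
  "centered ps \<longleftrightarrow> (\<forall>(k, p)\<in>set ps. \<phi> (pe p (X k)) = 0)"

lemma ev_prod_list: "ev ps = prod_list (map snd (map (\<lambda>(k, p). (k, pe p (X k))) ps))"
  by (induction ps rule: ev.induct) simp_all

lemma free_vanish: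
  assumes "qs \<noteq> []" "distinct_adj (map fst qs)" "\<And>k a. (k, a) \<in> set qs \<Longrightarrow> k \<in> I \<and> a \<in> generated_algebra (X k) \<and> \<phi> a = 0"
  shows "\<phi> (prod_list (map snd qs)) = 0"
proof -
  have "\<forall>k. Suc k < length qs \<longrightarrow> fst (qs ! k) \<noteq> fst (qs ! Suc k)"
    using assms(2) by (auto simp: distinct_adj_conv_nth)
  then show ?thesis
    using free assms(1,3) unfolding freely_independent_def by blast
qed

abbreviation items :: "('i \<times> complex poly) list \<Rightarrow> ('i \<times> 'h bop) list" where
  "items \<equiv> map (\<lambda>(k, p). (k, pe p (X k)))"

lemma items_props:
  assumes "valid ps" "centered ps" "(k, a) \<in> set (items ps)"
  shows "k \<in> I \<and> a \<in> generated_algebra (X k) \<and> \<phi> a = 0"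
  using assms by (auto simp: valid_def centered_def generated_pe)

lemma map_fst_items [simp]: "map fst (items ps) = map fst ps"
  by auto

lemma ev_vanish:
  assumes "ps \<noteq> []" "valid ps" "centered ps" "distinct_adj (map fst ps)"
  shows "\<phi> (ev ps) = 0"
  unfolding ev_prod_list
proof (rule free_vanish)
  show "items ps \<noteq> []" using assms(1) by simp
  show "distinct_adj (map fst (items ps))" unfolding map_fst_items by (rule assms(4))
qed (use items_props[OF assms(2,3)] in blast)

lemma phi_center: "A \<in> M \<Longrightarrow> \<phi> (A - \<phi> A *\<^sub>C 1) = 0"
  by (simp add: phi_minus phi_scaleC)

lemma ev_vanish_left:
  assumes "ps \<noteq> []" "valid ps" "centered ps" "distinct_adj (map fst ps)" "i \<in> I" "fst (hd ps) \<noteq> i"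
    and A: "A \<in> generated_algebra (X i)"
  shows "\<phi> (A * ev ps) = 0"
proof -
  have AM: "A \<in> M" by (rule generated_in_M[OF X_M[OF assms(5)] A])
  let ?A = "A - \<phi> A *\<^sub>C 1"
  have "\<phi> (prod_list (map snd ((i, ?A) # items ps))) = 0"
  proof (rule free_vanish)
    have "distinct_adj (i # map fst ps)"
      using assms(1,4,6) by (cases ps) auto
    then show "distinct_adj (map fst ((i, ?A) # items ps))"
      by (simp only: list.map fst_conv map_fst_items)
    fix k a assume "(k, a) \<in> set ((i, ?A) # items ps)"
    then consider "k = i" "a = ?A" | "(k, a) \<in> set (items ps)" by (simp only: set_append set_simps) blast
    then show "k \<in> I \<and> a \<in> generated_algebra (X k) \<and> \<phi> a = 0"
      by cases (use items_props[OF assms(2,3)] assms(5) generated_center[OF A] phi_center[OF AM] in blast)+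
  qed simp
  then have "\<phi> (?A * ev ps) = 0" by (simp only: ev_prod_list list.map snd_conv prod_list.Cons)
  moreover have "\<phi> (?A * ev ps) = \<phi> (A * ev ps) - \<phi> A * \<phi> (ev ps)"
    using AM assms(2) by (simp add: left_diff_distrib phi_minus scaleC_mult_left phi_scaleC)
  ultimately show ?thesis using ev_vanish[OF assms(1-4)] by simp
qed

lemma ev_vanish_right:
  assumes "ps \<noteq> []" "valid ps" "centered ps" "distinct_adj (map fst ps)" "i \<in> I" "fst (last ps) \<noteq> i"
    and A: "A \<in> generated_algebra (X i)"
  shows "\<phi> (ev ps * A) = 0"
proof -
  have AM: "A \<in> M" by (rule generated_in_M[OF X_M[OF assms(5)] A])
  let ?A = "A - \<phi> A *\<^sub>C 1"
  have "\<phi> (prod_list (map snd (items ps @ [(i, ?A)]))) = 0"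
  proof (rule free_vanish)
    have "distinct_adj (map fst ps @ [i])"
      using assms(1,4,6) by (auto simp: distinct_adj_append_iff last_map)
    then show "distinct_adj (map fst (items ps @ [(i, ?A)]))"
      by (simp only: map_append list.map fst_conv map_fst_items)
    fix k a assume "(k, a) \<in> set (items ps @ [(i, ?A)])"
    then consider "k = i" "a = ?A" | "(k, a) \<in> set (items ps)" by (simp only: set_append set_simps) blast
    then show "k \<in> I \<and> a \<in> generated_algebra (X k) \<and> \<phi> a = 0"
      by cases (use items_props[OF assms(2,3)] assms(5) generated_center[OF A] phi_center[OF AM] in blast)+
  qed simp
  then have "\<phi> (ev ps * ?A) = 0" by (simp add: ev_prod_list)
  moreover have "\<phi> (ev ps * ?A) = \<phi> (ev ps * A) - \<phi> A * \<phi> (ev ps)"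
    using AM assms(2) by (simp add: right_diff_distrib phi_minus scaleC_mult_right phi_scaleC)
  ultimately show ?thesis using ev_vanish[OF assms(1-4)] by simp
qed

lemma lin_eq_0: "(\<And>n. c n = 0) \<Longrightarrow> lin c p = (0::complex)"
  by (simp add: lin_def scaleC_complex_def)

text \<open>In each term the left leg is a centered alternating word times a power of a variable
  other than its last one, so freeness makes its trace zero.\<close>

lemma fdq_vanish:
  assumes "us \<noteq> []" "valid (us @ ps)" "centered (us @ ps)" "distinct_adj (map fst (us @ ps))"
  shows "fdq i (ev us) ps V = 0"
  using assms
proof (induction ps arbitrary: us)
  case (Cons kp ps)
  obtain k p where kp: "kp = (k, p)" by (cases kp)
  have us: "valid us" "k \<in> I" "centered us" "distinct_adj (map fst us)" "fst (last us) \<noteq> k"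
    using Cons.prems by (auto simp: kp centered_def distinct_adj_append_iff last_map)
  have "\<phi> (ev us * X k ^ s) = 0" for s
    using us Cons.prems(1) by (intro ev_vanish_right[of us k] generated_power)
  then have "bd p (ev us) (X k) W = 0" for W
    by (simp add: bd_def lin_eq_0)
  moreover have "fdq i (ev us * pe p (X k)) ps V = 0"
    using Cons.IH[of "us @ [(k, p)]"] Cons.prems by (simp add: kp ev_append)
  ultimately show ?case by (auto simp: kp)
qed simp

text \<open>Freeness makes both sides vanish, except for a word with one slot in the variable i;
  there the claim is the linear extension of \<open>X_rec\<close>.\<close>

lemma SD_centered:
  assumes i: "i \<in> I" and "valid ps" "centered ps" "distinct_adj (map fst ps)"
  shows "SD i ps"
proof (cases ps)
  case Nil
  have "\<phi> (X i) = 0" using X_rec[OF i, of 0] by simp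
  then show ?thesis by (simp add: Nil SD_def)
next
  case (Cons kp qs)
  obtain k p where kp: "kp = (k, p)" by (cases kp)
  have k: "k \<in> I" and qs: "valid qs" "centered qs" "distinct_adj (map fst qs)"
    using assms by (auto simp: Cons kp centered_def distinct_adj_Cons)
  have hd: "qs \<noteq> [] \<Longrightarrow> fst (hd qs) \<noteq> k"
    using assms(4) by (cases qs) (auto simp: Cons kp)
  note m = X_M[OF i] X_M[OF k] pe_in_M[OF X_M[OF k]] ev_M[OF qs(1)]
  have "fdq i (ev [(k, p)]) qs 1 = 0"
    using assms by (intro fdq_vanish) (auto simp: Cons kp)
  then have fdq: "fdq i 1 ps 1 = (if k = i then bd p 1 (X k) (ev qs) else 0)"
    by (simp add: Cons kp)
  show ?thesis
  proof (cases "k = i")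
    case False
    have "\<phi> (X i * ev ps) = 0"
      using assms False generated_algebra.gen[of "X i"]
      by (intro ev_vanish_left[of ps i]) (auto simp: Cons kp)
    then show ?thesis using False by (simp add: SD_def fdq)
  next
    case True
    show ?thesis
    proof (cases "qs = []")
      case True
      have "\<phi> (X i * pe p (X i)) = of_real (v i) * bd p 1 (X i) 1"
      proof -
        have "\<phi> (X i * pe p (X i)) = lin (\<lambda>n. \<phi> (X i ^ Suc n)) p"
          using m by (simp add: pe_def lin_def sum_distrib_left phi_sum scaleC_mult_right phi_scaleC scaleC_complex_def)
        then show ?thesis
          unfolding X_rec[OF i] lin_cong_scale by (simp add: bd_def)
      qed
      then show ?thesis using True \<open>k = i\<close> fdq by (simp add: SD_def Cons kp)
    next
      case False
      have "\<phi> (A * ev qs) = 0" if "A \<in> generated_algebra (X i)" for A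
        using ev_vanish_left[OF False qs i _ that] hd[OF False] \<open>k = i\<close> by simp
      note z = this
      have "\<phi> (X i * pe p (X i) * ev qs) = 0"
        by (intro z generated_algebra.mult generated_algebra.gen generated_pe)
      moreover have "bd p 1 (X i) (ev qs) = 0"
        using z[OF generated_power] by (simp add: bd_def lin_eq_0)
      ultimately show ?thesis using \<open>k = i\<close> fdq by (simp add: SD_def Cons kp mult.assoc)
    qed
  qed
qed

theorem schwinger_dyson:
  assumes i: "i \<in> I" and "valid ps"
  shows "SD i ps"
  using assms(2)
proof (induction "length ps" arbitrary: ps rule: less_induct)
  case (less ps)
  note short = less.hyps
  show ?case
  proof (cases "distinct_adj (map fst ps)")
    case False
    then obtain us' x vs' where s: "map fst ps = us' @ x # x # vs'"
      using not_distinct_adj_split by blast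
    then obtain us ps' where 1: "ps = us @ ps'" "map fst us = us'" "map fst ps' = x # x # vs'"
      by (auto simp: map_eq_append_conv)
    then obtain p q vs where 2: "ps' = (x, p) # (x, q) # vs"
      by (auto simp: map_eq_Cons_conv)
    have ps: "ps = us @ (x, p) # (x, q) # vs" using 1 2 by simp
    show ?thesis
      unfolding ps using less.prems ps i
      by (intro SD_merge short) auto
  next
    case True
    define bad where "bad qs = {j. j < length qs \<and> \<phi> (pe (snd (qs ! j)) (X (fst (qs ! j)))) \<noteq> 0}" for qs
    have "SD i qs" if "length qs = length ps" "map fst qs = map fst ps" "valid qs" for qs
      using that
    proof (induction "card (bad qs)" arbitrary: qs rule: less_induct)
      case (less qs)
      show ?case
      proof (cases "bad qs = {}")
        case True
        then have "centered qs"
          unfolding centered_def bad_def by (fastforce simp: in_set_conv_nth)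
        then show ?thesis
          using i less.prems \<open>distinct_adj (map fst ps)\<close> by (intro SD_centered) auto
      next
        case False
        then obtain j where j: "j < length qs" "j \<in> bad qs" by (auto simp: bad_def)
        obtain k p where kp: "qs ! j = (k, p)" by (cases "qs ! j")
        define us where "us = take j qs"
        define vs where "vs = drop (Suc j) qs"
        have qs: "qs = us @ (k, p) # vs"
          using id_take_nth_drop[OF j(1)] by (simp add: us_def vs_def kp)
        have lus: "length us = j" using j by (simp add: us_def)
        have val: "valid us" "valid vs" "k \<in> I" using less.prems(3) by (simp_all add: qs)
        define c where "c = \<phi> (pe p (X k))"
        define p' where "p' = p + [:- c:]"
        have p: "p = p' + [:c:]" by (simp add: p'_def)
        have "\<phi> (pe p' (X k)) = 0"
          using val pe_in_M[OF X_M[OF val(3)]]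
          by (simp add: p'_def pe_add pe_pCons phi_add phi_scaleC c_def[symmetric])
        have "bad (us @ (k, p') # vs) \<subseteq> bad qs - {j}"
        proof
          fix l assume l: "l \<in> bad (us @ (k, p') # vs)"
          then have "l \<noteq> j" using \<open>\<phi> (pe p' (X k)) = 0\<close> by (auto simp: bad_def nth_append lus)
          moreover have "(us @ (k, p') # vs) ! l = qs ! l" if "l \<noteq> j"
            using that by (auto simp: qs nth_append lus nth_Cons split: nat.split)
          ultimately show "l \<in> bad qs - {j}"
            using l by (auto simp: bad_def qs)
        qed
        then have "card (bad (us @ (k, p') # vs)) < card (bad qs)"
          using j(2) by (intro psubset_card_mono) (auto simp: bad_def)
        then have "SD i (us @ (k, p') # vs)"
          using less.prems by (intro less.hyps) (auto simp: qs)
        moreover have "SD i (us @ (k, [:c:]) # vs)"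
        proof (rule SD_const[OF i val])
          show "SD i (us @ vs)"
            using less.prems(1) val by (intro short) (auto simp: qs)
        qed
        ultimately show ?thesis
          unfolding qs by (subst p) (rule SD_add[OF i val])
      qed
    qed
    then show ?thesis using less.prems by simp
  qed
qed

end

section \<open>Quadratic forms in free semicircular variables\<close>

lemma of_real_power_fps:
  "(Abs_fps (\<lambda>n. complex_of_real (f $ n)) ^ k) $ n = of_real ((f ^ k) $ n)"
proof (induction k arbitrary: n)
  case (Suc k)
  then show ?case by (simp add: fps_mult_nth)
qed simp

lemma free_moment_of_real:
  "free_moment (Abs_fps (\<lambda>n. complex_of_real (f $ n))) N = of_real (free_moment f N)"
  by (simp add: free_moment_expand of_real_power_fps)

context free_family begin

definition linM :: "('h bop \<Rightarrow> complex) \<Rightarrow> bool" where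
  "linM L \<longleftrightarrow> (\<forall>A\<in>M. \<forall>B\<in>M. L (A + B) = L A + L B) \<and> (\<forall>c. \<forall>A\<in>M. L (c *\<^sub>C A) = c * L A)"

lemma linM_sum:
  assumes L: "linM L" and f: "\<And>a. a \<in> A \<Longrightarrow> f a \<in> M"
  shows "L (sum f A) = (\<Sum>a\<in>A. L (f a))"
proof -
  have "L 0 = 0" using L[unfolded linM_def] M_zero scaleC_zero_left[of "0::'h bop"] by (metis mult_zero_left)
  then show ?thesis
    using f by (induction A rule: infinite_finite_induct) (use L in \<open>auto simp: linM_def M_sum\<close>)
qed

abbreviation letter :: "'i \<Rightarrow> 'i \<times> complex poly" where "letter k \<equiv> (k, [:0, 1:])"

lemma pe_X [simp]: "pe [:0, 1:] A = (A :: 'h bop)"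
  by (simp add: pe_pCons)

lemma linM_quadratic:
  assumes L: "linM L"
  shows "L (\<Sum>k\<in>I. \<Sum>l\<in>I. c k l *\<^sub>R (X k * X l)) = (\<Sum>k\<in>I. \<Sum>l\<in>I. of_real (c k l) * L (X k * X l))"
proof -
  have scale: "L (c k l *\<^sub>R (X k * X l)) = of_real (c k l) * L (X k * X l)" if "k \<in> I" "l \<in> I" for k l
    using L X_M[OF that(1)] X_M[OF that(2)] unfolding linM_def by (simp add: scaleC_of_real_bop)
  have "L (\<Sum>k\<in>I. \<Sum>l\<in>I. c k l *\<^sub>R (X k * X l)) = (\<Sum>k\<in>I. L (\<Sum>l\<in>I. c k l *\<^sub>R (X k * X l)))"
    by (rule linM_sum[OF L]) (auto intro!: M_sum simp: X_M)
  also have "\<dots> = (\<Sum>k\<in>I. \<Sum>l\<in>I. L (c k l *\<^sub>R (X k * X l)))"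
    by (intro sum.cong refl linM_sum[OF L]) (simp add: X_M)
  also have "\<dots> = (\<Sum>k\<in>I. \<Sum>l\<in>I. of_real (c k l) * L (X k * X l))"
    by (intro sum.cong refl scale)
  finally show ?thesis .
qed

lemma bd_X: "U \<in> M \<Longrightarrow> A \<in> M \<Longrightarrow> V \<in> M \<Longrightarrow> bd [:0, 1:] U A V = \<phi> U * \<phi> V"
  by (simp add: bd_pCons pe_pCons)

end

locale free_quadratic = free_family +
  fixes a :: "'b \<Rightarrow> 'b \<Rightarrow> real"
  assumes finite_I: "finite I" and a_sym: "i \<in> I \<Longrightarrow> j \<in> I \<Longrightarrow> a i j = a j i"
begin

definition F :: "'a bop" where
  "F = (\<Sum>k\<in>I. \<Sum>l\<in>I. a k l *\<^sub>R (X k * X l))"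

lemma F_M [simp]: "F \<in> M"
  unfolding F_def by (auto intro!: M_sum simp: X_M)

lemma linM_F: "linM L \<Longrightarrow> L F = (\<Sum>k\<in>I. \<Sum>l\<in>I. of_real (a k l) * L (X k * X l))"
  unfolding F_def by (rule linM_quadratic)

text \<open>The difference quotient of F^N in the direction X i: s copies of F precede the
  differentiated one, in which either letter can be hit.\<close>

definition fdqF :: "'b \<Rightarrow> nat \<Rightarrow> 'a bop \<Rightarrow> 'a bop \<Rightarrow> complex" where
  "fdqF i N U V = (\<Sum>s<N. \<Sum>k\<in>I. \<Sum>l\<in>I. of_real (a k l) *
     ((if k = i then \<phi> (U * F ^ s) * \<phi> (X l * F ^ (N - 1 - s) * V) else 0)
      + (if l = i then \<phi> (U * F ^ s * X k) * \<phi> (F ^ (N - 1 - s) * V) else 0)))"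

lemma fdqF_Suc:
  "fdqF i (Suc N) U V = (\<Sum>k\<in>I. \<Sum>l\<in>I. of_real (a k l) *
     ((if k = i then \<phi> U * \<phi> (X l * F ^ N * V) else 0) + (if l = i then \<phi> (U * X k) * \<phi> (F ^ N * V) else 0)))
    + fdqF i N (U * F) V"
proof -
  have shift: "(\<Sum>s<Suc N. f s) = f 0 + (\<Sum>s<N. f (Suc s))" for f :: "nat \<Rightarrow> complex"
    by (rule sum.lessThan_Suc_shift)
  have e: "U * F ^ Suc s = U * F * F ^ s" "Suc N - 1 - Suc s = N - 1 - s" "U * F ^ 0 = U" "Suc N - 1 - 0 = N" for s
    by (simp_all add: mult.assoc)
  show ?thesis
    unfolding fdqF_def shift e ..
qed

lemma linM_fdqF:
  assumes U: "U \<in> M"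
  shows "linM (\<lambda>Y. fdqF i N (U * Y) V)"
  unfolding linM_def
proof (intro conjI ballI allI)
  fix A C c assume A: "A \<in> M" and C: "C \<in> M"
  have add: "\<phi> (U * (A + C) * F ^ s) = \<phi> (U * A * F ^ s) + \<phi> (U * C * F ^ s)" for s
    using U A C by (simp add: distrib_left distrib_right phi_add)
  have addX: "\<phi> (U * (A + C) * F ^ s * X k) = \<phi> (U * A * F ^ s * X k) + \<phi> (U * C * F ^ s * X k)" if "k \<in> I" for s k
    using U A C X_M[OF that] by (simp add: distrib_left distrib_right phi_add)
  show "fdqF i N (U * (A + C)) V = fdqF i N (U * A) V + fdqF i N (U * C) V"
    unfolding fdqF_def sum.distrib[symmetric]
  proof (intro sum.cong refl)
    fix s k l assume "k \<in> I"
    show "of_real (a k l) * ((if k = i then \<phi> (U * (A + C) * F ^ s) * \<phi> (X l * F ^ (N - 1 - s) * V) else 0)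
          + (if l = i then \<phi> (U * (A + C) * F ^ s * X k) * \<phi> (F ^ (N - 1 - s) * V) else 0))
      = of_real (a k l) * ((if k = i then \<phi> (U * A * F ^ s) * \<phi> (X l * F ^ (N - 1 - s) * V) else 0)
          + (if l = i then \<phi> (U * A * F ^ s * X k) * \<phi> (F ^ (N - 1 - s) * V) else 0))
        + of_real (a k l) * ((if k = i then \<phi> (U * C * F ^ s) * \<phi> (X l * F ^ (N - 1 - s) * V) else 0)
          + (if l = i then \<phi> (U * C * F ^ s * X k) * \<phi> (F ^ (N - 1 - s) * V) else 0))"
      unfolding add addX[OF \<open>k \<in> I\<close>] by (cases "k = i"; cases "l = i") (simp_all only: simp_thms if_True if_False ring_distribs add_0_left add_0_right mult_zero_right add_ac)
  qed
next
  fix c A assume A: "A \<in> M"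
  have scale: "\<phi> (U * (c *\<^sub>C A) * F ^ s) = c * \<phi> (U * A * F ^ s)" for s
    using U A by (simp add: scaleC_mult_left scaleC_mult_right phi_scaleC)
  have scaleX: "\<phi> (U * (c *\<^sub>C A) * F ^ s * X k) = c * \<phi> (U * A * F ^ s * X k)" if "k \<in> I" for s k
    using U A X_M[OF that] by (simp add: scaleC_mult_left scaleC_mult_right phi_scaleC)
  show "fdqF i N (U * (c *\<^sub>C A)) V = c * fdqF i N (U * A) V"
    unfolding fdqF_def sum_distrib_left
  proof (intro sum.cong refl)
    fix s k l assume "k \<in> I"
    show "of_real (a k l) * ((if k = i then \<phi> (U * (c *\<^sub>C A) * F ^ s) * \<phi> (X l * F ^ (N - 1 - s) * V) else 0)
          + (if l = i then \<phi> (U * (c *\<^sub>C A) * F ^ s * X k) * \<phi> (F ^ (N - 1 - s) * V) else 0))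
      = c * (of_real (a k l) * ((if k = i then \<phi> (U * A * F ^ s) * \<phi> (X l * F ^ (N - 1 - s) * V) else 0)
          + (if l = i then \<phi> (U * A * F ^ s * X k) * \<phi> (F ^ (N - 1 - s) * V) else 0)))"
      unfolding scale scaleX[OF \<open>k \<in> I\<close>] by (cases "k = i"; cases "l = i") (simp_all only: simp_thms if_True if_False add_0_left add_0_right mult_zero_left mult_zero_right ring_distribs mult_ac)
  qed
qed

text \<open>Avoids expanding F^N into words: one factor F at a time is moved into \<open>us\<close>
  as a pair of letters and recovered by linearity. This is why \<open>us\<close> is arbitrary in the
  induction.\<close>

lemma schwinger_dyson_F:
  assumes i: "i \<in> I" and "valid us" "valid vs"
  shows "\<phi> (X i * (ev us * F ^ N * ev vs)) = of_real (v i) *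
    (fdq i 1 us (F ^ N * ev vs) + fdqF i N (ev us) (ev vs) + fdq i (ev us * F ^ N) vs 1)"
  using assms(2)
proof (induction N arbitrary: us)
  case 0
  then show ?case
    using schwinger_dyson[OF i, of "us @ vs"] assms(3)
    by (simp add: SD_def ev_append fdq_append fdqF_def)
next
  case (Suc N)
  let ?V = "F ^ N * ev vs"
  note m = X_M[OF i] ev_M[OF Suc.prems] ev_M[OF assms(3)]
  define L where "L Y = \<phi> (X i * (ev us * Y * F ^ N * ev vs))" for Y
  define L1 where "L1 Y = fdq i 1 us (Y * ?V)" for Y
  define L2 where "L2 Y = fdqF i N (ev us * Y) (ev vs)" for Y
  define L3 where "L3 Y = fdq i (ev us * Y * F ^ N) vs 1" for Y
  define E where "E k l = (if k = i then \<phi> (ev us) * \<phi> (X l * F ^ N * ev vs) else 0) + (if l = i then \<phi> (ev us * X k) * \<phi> ?V else 0)" for k l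
  have lin: "linM L" "linM L1" "linM L2" "linM L3"
  proof -
    show "linM L" using m unfolding linM_def L_def
      by (auto simp: distrib_left distrib_right phi_add scaleC_mult_left scaleC_mult_right phi_scaleC)
    show "linM L1" using m Suc.prems unfolding linM_def L1_def
      by (auto simp: distrib_right fdq_add_V scaleC_mult_left fdq_scale_V)
    show "linM L2" unfolding L2_def by (rule linM_fdqF[OF m(2)])
    show "linM L3" using m assms(3) unfolding linM_def L3_def
      by (auto simp: distrib_left distrib_right fdq_add_U scaleC_mult_left scaleC_mult_right fdq_scale_U)
  qed
  have step: "L (X k * X l) = of_real (v i) * (L1 (X k * X l) + E k l + L2 (X k * X l) + L3 (X k * X l))"
    if "k \<in> I" "l \<in> I" for k l
  proof -
    note mk = X_M[OF that(1)] X_M[OF that(2)]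
    have val: "valid (us @ [letter k, letter l])" using that Suc.prems by simp
    have ev: "ev (us @ [letter k, letter l]) = ev us * (X k * X l)"
      by (simp add: ev_append)
    have "fdq i 1 (us @ [letter k, letter l]) ?V = L1 (X k * X l) + E k l"
      unfolding E_def using m mk by (cases "k = i"; cases "l = i") (simp_all add: fdq_append bd_X L1_def mult.assoc)
    then show ?thesis
      using Suc.IH[OF val] unfolding ev by (simp add: L_def L2_def L3_def mult.assoc)
  qed
  have "\<phi> (X i * (ev us * F ^ Suc N * ev vs)) = L F" by (simp add: L_def mult.assoc)
  also have "\<dots> = (\<Sum>k\<in>I. \<Sum>l\<in>I. of_real (a k l) * (of_real (v i) * (L1 (X k * X l) + E k l + L2 (X k * X l) + L3 (X k * X l))))"
    unfolding linM_F[OF lin(1)] by (intro sum.cong refl) (simp add: step)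
  also have "\<dots> = of_real (v i) * (L1 F + (\<Sum>k\<in>I. \<Sum>l\<in>I. of_real (a k l) * E k l) + L2 F + L3 F)"
    unfolding linM_F[OF lin(2)] linM_F[OF lin(3)] linM_F[OF lin(4)]
    by (simp add: distrib_left sum.distrib sum_distrib_left mult_ac)
  also have "\<dots> = of_real (v i) * (fdq i 1 us (F ^ Suc N * ev vs) + fdqF i (Suc N) (ev us) (ev vs) + fdq i (ev us * F ^ Suc N) vs 1)"
    unfolding fdqF_Suc by (simp add: L1_def L2_def L3_def E_def mult.assoc add_ac)
  finally show ?case .
qed

text \<open>F is even in the variables. Each term of the difference quotient contains a factor of
  the same odd kind with a smaller power of F.\<close>

lemma phi_odd:
  assumes "i \<in> I"
  shows "\<phi> (F ^ N * X i) = 0"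
  using assms
proof (induction N arbitrary: i rule: less_induct)
  case (less N)
  have "\<phi> (X i * F ^ N) = of_real (v i) * fdqF i N 1 1"
    using schwinger_dyson_F[OF less.prems, of "[]" "[]" N] by simp
  also have "fdqF i N 1 1 = 0"
    unfolding fdqF_def
  proof (intro sum.neutral ballI)
    fix s k l assume *: "s \<in> {..<N}" "k \<in> I" "l \<in> I"
    have z: "\<phi> (F ^ s * X k) = 0" "\<phi> (F ^ (N - 1 - s) * X l) = 0"
      using * by (auto intro!: less.IH)
    have z': "\<phi> (X l * F ^ (N - 1 - s)) = 0"
      using * unfolding z(2)[symmetric] by (intro phi_trace) (auto simp: X_M)
    show "of_real (a k l) *
     ((if k = i then \<phi> (1 * F ^ s) * \<phi> (X l * F ^ (N - 1 - s) * 1) else 0)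
      + (if l = i then \<phi> (1 * F ^ s * X k) * \<phi> (F ^ (N - 1 - s) * 1) else 0)) = 0"
      unfolding mult_1_left mult_1_right z z' by simp
  qed
  finally show ?case
    using phi_trace[of "X i" "F ^ N"] less.prems by (simp add: X_M)
qed

definition G :: "nat \<Rightarrow> 'b \<Rightarrow> 'b \<Rightarrow> complex" where
  "G N i j = \<phi> (X i * F ^ N * X j)"

text \<open>By \<open>phi_odd\<close> only the terms survive in which the first letter of the
  differentiated copy of F is hit.\<close>

lemma G_rec:
  assumes i: "i \<in> I" and j: "j \<in> I"
  shows "G N i j = of_real (v i) * ((if i = j then \<phi> (F ^ N) else 0)
    + (\<Sum>s<N. \<phi> (F ^ s) * (\<Sum>l\<in>I. of_real (a i l) * G (N - 1 - s) l j)))"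
proof -
  have "G N i j = of_real (v i) * (fdqF i N 1 (X j) + (if i = j then \<phi> (F ^ N) else 0))"
    using schwinger_dyson_F[OF i, of "[]" "[letter j]" N] i j
    by (auto simp: G_def mult.assoc bd_X X_M)
  also have "fdqF i N 1 (X j) = (\<Sum>s<N. \<phi> (F ^ s) * (\<Sum>l\<in>I. of_real (a i l) * G (N - 1 - s) l j))"
    unfolding fdqF_def
  proof (intro sum.cong refl)
    fix s assume "s \<in> {..<N}"
    have "(\<Sum>k\<in>I. \<Sum>l\<in>I. of_real (a k l) *
       ((if k = i then \<phi> (1 * F ^ s) * \<phi> (X l * F ^ (N - 1 - s) * X j) else 0)
        + (if l = i then \<phi> (1 * F ^ s * X k) * \<phi> (F ^ (N - 1 - s) * X j) else 0)))
      = (\<Sum>k\<in>I. if k = i then \<Sum>l\<in>I. of_real (a i l) * (\<phi> (F ^ s) * G (N - 1 - s) l j) else 0)"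
    proof (intro sum.cong refl)
      fix k assume k: "k \<in> I"
      have z: "\<phi> (1 * F ^ s * X k) = 0" using phi_odd[OF k] by simp
      show "(\<Sum>l\<in>I. of_real (a k l) *
         ((if k = i then \<phi> (1 * F ^ s) * \<phi> (X l * F ^ (N - 1 - s) * X j) else 0)
          + (if l = i then \<phi> (1 * F ^ s * X k) * \<phi> (F ^ (N - 1 - s) * X j) else 0)))
        = (if k = i then \<Sum>l\<in>I. of_real (a i l) * (\<phi> (F ^ s) * G (N - 1 - s) l j) else 0)"
        unfolding z G_def mult_zero_left if_cancel add_0_right by (cases "k = i") simp_all
    qed
    also have "\<dots> = \<phi> (F ^ s) * (\<Sum>l\<in>I. of_real (a i l) * G (N - 1 - s) l j)"
      using i finite_I by (simp add: sum_distrib_left mult_ac)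
    finally show "(\<Sum>k\<in>I. \<Sum>l\<in>I. of_real (a k l) *
       ((if k = i then \<phi> (1 * F ^ s) * \<phi> (X l * F ^ (N - 1 - s) * X j) else 0)
        + (if l = i then \<phi> (1 * F ^ s * X k) * \<phi> (F ^ (N - 1 - s) * X j) else 0)))
      = \<phi> (F ^ s) * (\<Sum>l\<in>I. of_real (a i l) * G (N - 1 - s) l j)" .
  qed
  finally show ?thesis by (simp add: add.commute)
qed

lemma moment_Suc: "\<phi> (F ^ Suc N) = (\<Sum>k\<in>I. \<Sum>l\<in>I. of_real (a k l) * G N l k)"
proof -
  have "linM (\<lambda>Y. \<phi> (Y * F ^ N))"
    by (auto simp: linM_def distrib_right phi_add scaleC_mult_left phi_scaleC)
  from linM_F[OF this] have "\<phi> (F * F ^ N) = (\<Sum>k\<in>I. \<Sum>l\<in>I. of_real (a k l) * \<phi> (X k * X l * F ^ N))" .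
  also have "\<dots> = (\<Sum>k\<in>I. \<Sum>l\<in>I. of_real (a k l) * G N l k)"
  proof (intro sum.cong refl)
    fix k l assume "k \<in> I" "l \<in> I"
    then have "\<phi> (X k * (X l * F ^ N)) = \<phi> ((X l * F ^ N) * X k)"
      by (intro phi_trace) (auto simp: X_M)
    then show "of_real (a k l) * \<phi> (X k * X l * F ^ N) = of_real (a k l) * G N l k"
      by (simp add: G_def mult.assoc)
  qed
  finally show ?thesis by simp
qed

definition B :: "'b \<Rightarrow> 'b \<Rightarrow> real" where
  "B i j = v i * a i j"

text \<open>With M the moment series and W = X M, the recursion for G is solved by M times h o W,
  where h is the generating function of the matrices B^p diag(v). Inserted into
  \<open>moment_Suc\<close> it gives M = C o W, where C has the coefficients tr B^p for p \<ge> 1.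
  Vanishing of the first trace means that the form is centered, as \<open>free_moment\<close>
  presupposes.\<close>

lemma moments_quadratic:
  assumes tr0: "(\<Sum>k\<in>I. v k * a k k) = 0"
  shows "\<phi> (F ^ N) = of_real (free_moment (Abs_fps (\<lambda>n. \<Sum>k\<in>I. mpow I B (n + 2) k k)) N)"
proof -
  define Mf where "Mf = Abs_fps (\<lambda>N. \<phi> (F ^ N))"
  define Gf where "Gf i j = Abs_fps (\<lambda>N. G N i j)" for i j
  define W where "W = fps_X * Mf"
  define h where "h i j = Abs_fps (\<lambda>p. complex_of_real (mpow I B p i j * v j))" for i j
  have W0: "W $ 0 = 0" by (simp add: W_def)
  have W_nth: "(W * Z) $ n = (\<Sum>s<n. \<phi> (F ^ s) * Z $ (n - 1 - s))" for Z n
  proof -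
    have "Mf $ k = \<phi> (F ^ k)" for k by (simp add: Mf_def)
    then have "(Mf * Z) $ m = (\<Sum>s<Suc m. \<phi> (F ^ s) * Z $ (m - s))" for m
      by (simp add: fps_mult_nth atLeast0AtMost lessThan_Suc_atMost)
    note * = this
    have WZ: "W * Z = fps_X * (Mf * Z)" by (simp add: W_def mult.assoc)
    show ?thesis unfolding WZ by (cases n) (simp_all add: *)
  qed
  have Gf: "Gf i j = fps_const (if i = j then of_real (v i) else 0) * Mf + W * (\<Sum>l\<in>I. fps_const (of_real (B i l)) * Gf l j)"
    if "i \<in> I" "j \<in> I" for i j
  proof (rule fps_ext)
    fix n
    have "(W * (\<Sum>l\<in>I. fps_const (of_real (B i l)) * Gf l j)) $ n
      = (\<Sum>s<n. \<phi> (F ^ s) * (\<Sum>l\<in>I. of_real (B i l) * G (n - 1 - s) l j))"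
      unfolding W_nth by (simp add: Gf_def fps_sum_nth)
    also have "\<dots> = of_real (v i) * (\<Sum>s<n. \<phi> (F ^ s) * (\<Sum>l\<in>I. of_real (a i l) * G (n - 1 - s) l j))"
      by (simp add: B_def sum_distrib_left mult_ac)
    finally show "Gf i j $ n = (fps_const (if i = j then of_real (v i) else 0) * Mf + W * (\<Sum>l\<in>I. fps_const (of_real (B i l)) * Gf l j)) $ n"
      using G_rec[OF that, of n] by (simp add: Gf_def Mf_def distrib_left)
  qed
  have h: "h i j = fps_const (if i = j then of_real (v i) else 0) + fps_X * (\<Sum>l\<in>I. fps_const (of_real (B i l)) * h l j)" for i j
  proof (rule fps_ext)
    fix n
    show "h i j $ n = (fps_const (if i = j then of_real (v i) else 0) + fps_X * (\<Sum>l\<in>I. fps_const (of_real (B i l)) * h l j)) $ n"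
      by (cases n) (simp_all add: h_def fps_sum_nth sum_distrib_right sum_distrib_left mult_ac)
  qed
  define H where "H i j = h i j oo W" for i j
  have H: "H i j = fps_const (if i = j then of_real (v i) else 0) + W * (\<Sum>l\<in>I. fps_const (of_real (B i l)) * H l j)" for i j
    unfolding H_def by (subst h)
      (simp add: fps_compose_add_distrib fps_compose_mult_distrib[OF W0] fps_compose_sum_distrib W0)
  \<comment> \<open>Both families solve the same linear equation, whose right side carries a factor
    \<open>W\<close> without constant term; so they agree by induction on the order of the
    coefficient.\<close>
  have GH: "(Gf i j - Mf * H i j) $ n = 0" if "i \<in> I" "j \<in> I" for i j n
    using that
  proof (induction n arbitrary: i rule: less_induct)
    case (less n)
    have "Gf i j - Mf * H i j = W * (\<Sum>l\<in>I. fps_const (of_real (B i l)) * (Gf l j - Mf * H l j))"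
      by (subst Gf[OF less.prems], subst H) (simp add: algebra_simps sum_subtractf sum_distrib_left)
    also have "\<dots> $ n = 0"
      unfolding W_nth using less.IH less.prems
      by (auto simp: fps_sum_nth intro!: sum.neutral)
    finally show ?case .
  qed
  have GfH: "Gf i j = Mf * H i j" if "i \<in> I" "j \<in> I" for i j
  proof -
    have "Gf i j - Mf * H i j = 0" using GH[OF that] by (intro fps_ext) simp
    then show ?thesis by simp
  qed
  define C where "C = 1 + fps_X * (\<Sum>k\<in>I. \<Sum>l\<in>I. fps_const (of_real (a k l)) * h l k)"
  have "Mf = 1 + fps_X * (\<Sum>k\<in>I. \<Sum>l\<in>I. fps_const (of_real (a k l)) * Gf l k)"
  proof (rule fps_ext)
    fix n
    show "Mf $ n = (1 + fps_X * (\<Sum>k\<in>I. \<Sum>l\<in>I. fps_const (of_real (a k l)) * Gf l k)) $ n"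
      using moment_Suc by (cases n) (simp_all add: Mf_def fps_sum_nth Gf_def del: power_Suc)
  qed
  also have "\<dots> = 1 + W * (\<Sum>k\<in>I. \<Sum>l\<in>I. fps_const (of_real (a k l)) * H l k)"
    by (simp add: GfH W_def sum_distrib_left mult_ac)
  also have "\<dots> = C oo W"
    by (simp add: C_def H_def fps_compose_add_distrib fps_compose_mult_distrib[OF W0] fps_compose_sum_distrib W0)
  finally have "Mf = C oo (fps_X * Mf)" by (simp add: W_def)
  then have "Mf $ N = (C ^ (N + 1)) $ N / of_nat (N + 1)"
    by (rule lagrange_inversion[rotated]) (simp add: C_def)
  moreover define f where "f = Abs_fps (\<lambda>n. \<Sum>k\<in>I. mpow I B (n + 2) k k)"
  have "C = 1 + fps_X ^ 2 * Abs_fps (\<lambda>n. complex_of_real (f $ n))"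
  proof (rule fps_ext)
    fix n
    have *: "C $ Suc p = of_real (\<Sum>k\<in>I. mpow I B (Suc p) k k)" for p
      by (simp add: C_def fps_sum_nth h_def B_def mult_ac)
    show "C $ n = (1 + fps_X ^ 2 * Abs_fps (\<lambda>n. complex_of_real (f $ n))) $ n"
    proof (cases n rule: nat_cases_2)
      case 2
      have "(\<Sum>k\<in>I. mpow I B (Suc 0) k k) = (\<Sum>k\<in>I. v k * a k k)"
        using finite_I by (intro sum.cong) (simp_all add: B_def if_distrib[of "\<lambda>x. _ * x"] sum.delta cong: if_cong)
      then show ?thesis using *[of 0] 2 tr0 by (simp add: fps_X_power_mult_nth del: mpow.simps)
    next
      case (3 p)
      then show ?thesis using *[of "Suc p"] by (simp add: fps_X_power_mult_nth f_def del: mpow.simps)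
    qed (simp add: C_def)
  qed
  ultimately have "Mf $ N = free_moment (Abs_fps (\<lambda>n. complex_of_real (f $ n))) N"
    by (simp only: free_moment_def)
  also have "Mf $ N = \<phi> (F ^ N)" by (simp add: Mf_def)
  finally show ?thesis
    unfolding free_moment_of_real f_def .
qed

end

section \<open>The second Wigner chaos\<close>

context free_family begin

lemma phi_X: "i \<in> I \<Longrightarrow> \<phi> (X i) = 0"
  using schwinger_dyson[of i "[]"] by (simp add: SD_def)

lemma phi_XX: "i \<in> I \<Longrightarrow> j \<in> I \<Longrightarrow> \<phi> (X i * X j) = (if i = j then of_real (v i) else 0)"
  using schwinger_dyson[of i "[letter j]"] by (auto simp: SD_def bd_X X_M)

lemma phi_XXXX:
  assumes "i \<in> I" "j \<in> I" "k \<in> I" "l \<in> I" "i \<noteq> j"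
  shows "\<phi> (X j * X i * (X k * X l)) = (if i = k \<and> j = l then of_real (v i * v j) else 0)"
proof -
  have "\<phi> (X j * (X i * (X k * X l))) = of_real (v j) *
     ((if k = j then \<phi> (X i) * \<phi> (X l) else 0) + (if l = j then \<phi> (X i * X k) else 0))"
    using schwinger_dyson[of j "[letter i, letter k, letter l]"] assms
    by (cases "k = j"; cases "l = j") (simp_all add: SD_def bd_X X_M mult.assoc)
  then show ?thesis
    using assms by (auto simp: phi_X phi_XX mult.assoc)
qed

text \<open>The isometry off the diagonal: for i \<noteq> j the product X j X i pairs nontrivially
  only with X i X j.\<close>

lemma sqnorm_quadratic:
  assumes fin: "finite I" and sa: "\<And>i. i \<in> I \<Longrightarrow> is_adjoint (X i) (X i)" and d0: "\<And>i. i \<in> I \<Longrightarrow> d i i = 0"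
  shows "sqnorm (\<Sum>i\<in>I. \<Sum>j\<in>I. d i j *\<^sub>R (X i * X j)) = (\<Sum>i\<in>I. \<Sum>j\<in>I. (d i j)\<^sup>2 * (v i * v j))"
proof -
  let ?D = "\<Sum>i\<in>I. \<Sum>j\<in>I. d i j *\<^sub>R (X i * X j)"
  let ?D' = "\<Sum>i\<in>I. \<Sum>j\<in>I. d j i *\<^sub>R (X i * X j)"
  have D: "?D \<in> M" by (auto intro!: M_sum simp: X_M)
  have "is_adjoint ?D (\<Sum>i\<in>I. \<Sum>j\<in>I. d i j *\<^sub>R (X j * X i))"
    by (intro is_adjoint_sum is_adjoint_scaleR is_adjoint_mult sa)
  also have "(\<Sum>i\<in>I. \<Sum>j\<in>I. d i j *\<^sub>R (X j * X i)) = ?D'"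
    by (rule sum.swap)
  finally have adj: "adj ?D = ?D'" by (rule adj_eq)
  have "linM (\<lambda>Y. \<phi> (Y * ?D))"
    using D by (auto simp: linM_def distrib_right phi_add scaleC_mult_left phi_scaleC)
  from linM_quadratic[OF this, of "\<lambda>i j. d j i"]
  have "\<phi> (?D' * ?D) = (\<Sum>j\<in>I. \<Sum>i\<in>I. of_real (d i j) * \<phi> (X j * X i * ?D))" .
  also have "\<dots> = (\<Sum>j\<in>I. \<Sum>i\<in>I. of_real ((d i j)\<^sup>2 * (v i * v j)))"
  proof (intro sum.cong refl)
    fix i j assume ij: "j \<in> I" "i \<in> I"
    show "of_real (d i j) * \<phi> (X j * X i * ?D) = of_real ((d i j)\<^sup>2 * (v i * v j))"
    proof (cases "i = j")
      case True
      then show ?thesis using d0 ij by simp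
    next
      case False
      have "linM (\<lambda>Y. \<phi> (X j * X i * Y))"
        using ij by (auto simp: linM_def distrib_left phi_add scaleC_mult_right phi_scaleC X_M)
      from linM_quadratic[OF this, of d]
      have "\<phi> (X j * X i * ?D) = (\<Sum>k\<in>I. \<Sum>l\<in>I. of_real (d k l) * \<phi> (X j * X i * (X k * X l)))" .
      also have "\<dots> = (\<Sum>k\<in>I. \<Sum>l\<in>I. if k = i then if l = j then of_real (d i j * (v i * v j)) else 0 else 0)"
        using ij False by (intro sum.cong refl) (auto simp: phi_XXXX)
      also have "\<dots> = (\<Sum>k\<in>I. if k = i then of_real (d i j * (v i * v j)) else 0)"
        using fin ij by (intro sum.cong refl) (auto simp: sum.delta)
      also have "\<dots> = of_real (d i j * (v i * v j))"
        using fin ij by (simp add: sum.delta)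
      finally show ?thesis by (simp add: power2_eq_square mult.assoc)
    qed
  qed
  also have "\<dots> = of_real (\<Sum>i\<in>I. \<Sum>j\<in>I. (d i j)\<^sup>2 * (v i * v j))"
    by (subst sum.swap) simp
  finally show ?thesis unfolding sqnorm_def adj by simp
qed

end

context tracial begin

lemma sqnorm_adj: "A \<in> M \<Longrightarrow> sqnorm (adj A) = sqnorm A"
  using phi_trace[of A "adj A"] adj_eq[OF is_adjoint_sym[OF adj_is_adjoint[of A]]]
  by (simp add: sqnorm_def)

lemma sqnorm_diff_le:
  assumes "A \<in> M" "B \<in> M"
  shows "sqnorm (A - B) \<le> 2 * sqnorm A + 2 * sqnorm B"
proof -
  have e: "A + (- 1) *\<^sub>C B = A - B"
    using scaleC_of_real[of "-1" B] by simp
  have "complex_of_real (sqnorm (A + 1 *\<^sub>C B) + sqnorm (A - B)) = of_real (2 * sqnorm A + 2 * sqnorm B)"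
    using sqnorm_add_scale[OF assms, of 1] sqnorm_add_scale[OF assms, of "-1"] unfolding e by simp
  then have "sqnorm (A + 1 *\<^sub>C B) + sqnorm (A - B) = 2 * sqnorm A + 2 * sqnorm B"
    by (simp only: of_real_eq_iff)
  then show ?thesis using sqnorm_nonneg[of "A + 1 *\<^sub>C B"] assms by simp
qed

text \<open>The factors E are replaced by F one at a time. Cauchy-Schwarz bounds each error by the
  L2 distance times the L2 norm of F^m E^n, and a second application bounds that norm by a moment of
  E and a constant depending on F. Uniform moment bounds thus stand in for operator norm
  bounds.\<close>

lemma moments_tendsto:
  assumes F: "F \<in> M" and E: "\<And>k. E k \<in> M" and sa: "\<And>k. is_adjoint (E k) (E k)"
    and conv: "(\<lambda>k. sqnorm (E k - F)) \<longlonglongrightarrow> 0"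
    and bound: "\<And>N. \<exists>C. \<forall>k. cmod (\<phi> (E k ^ N)) \<le> C"
  shows "(\<lambda>k::nat. \<phi> (E k ^ n)) \<longlonglongrightarrow> \<phi> (F ^ n)"
proof -
  have mixed: "(\<lambda>k. \<phi> (E k ^ n * F ^ m)) \<longlonglongrightarrow> \<phi> (F ^ (n + m))" for n m
  proof (induction n arbitrary: m)
    case 0
    then show ?case by simp
  next
    case (Suc n)
    obtain C where C: "\<And>k. cmod (\<phi> (E k ^ (4 * n))) \<le> C"
      using bound by blast
    define Y where "Y = adj (F ^ m) * F ^ m"
    have Y: "Y \<in> M" using F by (simp add: Y_def)
    define K where "K = sqrt (sqnorm Y * C)"
    have diff: "cmod (\<phi> (E k ^ Suc n * F ^ m) - \<phi> (E k ^ n * F ^ Suc m)) \<le> sqrt (sqnorm (E k - F) * K)" for k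
    proof -
      have P: "adj (E k ^ j) = E k ^ j" for j
        by (intro adj_eq is_adjoint_power sa)
      define Z where "Z = F ^ m * E k ^ n"
      have Z: "Z \<in> M" using F E by (simp add: Z_def)
      have EF: "E k - F \<in> M" using F E by simp
      have "E k ^ Suc n * F ^ m - E k ^ n * F ^ Suc m = E k ^ n * ((E k - F) * F ^ m)"
        by (simp add: power_Suc2[of "E k"] left_diff_distrib right_diff_distrib mult.assoc del: power_Suc)
           (simp add: power_commutes mult.assoc)
      moreover have "\<phi> (E k ^ Suc n * F ^ m - E k ^ n * F ^ Suc m) = \<phi> (E k ^ Suc n * F ^ m) - \<phi> (E k ^ n * F ^ Suc m)"
        using F E by (intro phi_minus) auto
      ultimately have "\<phi> (E k ^ Suc n * F ^ m) - \<phi> (E k ^ n * F ^ Suc m) = \<phi> (E k ^ n * ((E k - F) * F ^ m))"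
        by (simp only:)
      also have "\<dots> = \<phi> ((E k - F) * F ^ m * E k ^ n)"
        using F E by (intro phi_trace) auto
      also have "\<dots> = \<phi> (adj (adj (E k - F)) * Z)"
        using adj_eq[OF is_adjoint_sym[OF adj_is_adjoint[OF EF]]] by (simp add: Z_def mult.assoc)
      finally have "cmod (\<phi> (E k ^ Suc n * F ^ m) - \<phi> (E k ^ n * F ^ Suc m)) ^ 2 \<le> sqnorm (E k - F) * sqnorm Z"
        using phi_cauchy_schwarz[of "adj (E k - F)" Z] EF Z by (simp add: sqnorm_adj)
      also have "sqnorm Z \<le> K"
      proof -
        have "adj Z = E k ^ n * adj (F ^ m)"
          unfolding Z_def using F by (intro adj_eq is_adjoint_mult adj_is_adjoint is_adjoint_power sa) auto
        then have "\<phi> (adj Z * Z) = \<phi> (E k ^ n * (Y * E k ^ n))"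
          by (simp add: Z_def Y_def mult.assoc)
        also have "\<dots> = \<phi> (Y * E k ^ n * E k ^ n)"
          using Y E by (intro phi_trace) auto
        also have "\<dots> = \<phi> (adj Y * E k ^ (2 * n))"
        proof -
          have "is_adjoint Y Y"
            unfolding Y_def using F
            by (intro is_adjoint_mult is_adjoint_sym[OF adj_is_adjoint] adj_is_adjoint) auto
          then show ?thesis by (simp add: adj_eq mult.assoc mult_2 power_add)
        qed
        finally have "(sqnorm Z)\<^sup>2 \<le> cmod (\<phi> (adj Y * E k ^ (2 * n))) ^ 2"
          unfolding sqnorm_def by (metis abs_Re_le_cmod abs_le_square_iff abs_norm_cancel)
        also have "\<dots> \<le> sqnorm Y * sqnorm (E k ^ (2 * n))"
          using Y E by (intro phi_cauchy_schwarz) auto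
        also have "sqnorm (E k ^ (2 * n)) \<le> C"
        proof -
          have "adj (E k ^ (2 * n)) * E k ^ (2 * n) = E k ^ (4 * n)"
            unfolding P by (simp flip: power_add)
          then show ?thesis
            using C[of k] complex_Re_le_cmod[of "\<phi> (E k ^ (4 * n))"] by (simp add: sqnorm_def)
        qed
        finally have "(sqnorm Z)\<^sup>2 \<le> sqnorm Y * C"
          using sqnorm_nonneg[OF Y] by (simp add: mult_left_mono)
        then show ?thesis unfolding K_def by (rule real_le_rsqrt)
      qed
      finally have "cmod (\<phi> (E k ^ Suc n * F ^ m) - \<phi> (E k ^ n * F ^ Suc m)) ^ 2 \<le> sqnorm (E k - F) * K"
        using sqnorm_nonneg[OF EF] by (simp add: mult_left_mono)
      then show ?thesis by (rule real_le_rsqrt)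
    qed
    have "(\<lambda>k. sqrt (sqnorm (E k - F) * K)) \<longlonglongrightarrow> sqrt (0 * K)"
      by (intro tendsto_intros conv)
    then have lim0: "(\<lambda>k. sqrt (sqnorm (E k - F) * K)) \<longlonglongrightarrow> 0"
      by (simp only: mult_zero_left real_sqrt_zero)
    have "(\<lambda>k. \<phi> (E k ^ Suc n * F ^ m) - \<phi> (E k ^ n * F ^ Suc m)) \<longlonglongrightarrow> 0"
      by (rule Lim_null_comparison[OF always_eventually lim0]) (intro allI diff)
    from tendsto_add[OF this Suc.IH[of "Suc m"]] show ?case
      by (simp only: diff_add_cancel add_0_left add_Suc_right add_Suc)
  qed
  show ?thesis using mixed[of n 0] by simp
qed

end

text \<open>The matrix diag(v) a need not be symmetric, but conjugation with the roots of v makes it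
  so and keeps the traces of powers.\<close>

lemma mpow_conjugate:
  assumes v: "\<And>i. i \<in> I \<Longrightarrow> v i > 0" and ij: "i \<in> I" "j \<in> I"
    and S: "\<And>i j. S i j = sqrt (v i) * a i j * sqrt (v j)"
  shows "mpow I (\<lambda>i j. v i * a i j) p i j = sqrt (v i) * mpow I S p i j / sqrt (v j)"
  using ij(1)
proof (induction p arbitrary: i)
  case 0
  then show ?case using v[OF ij(2)] by auto
next
  case (Suc p)
  have "v i * a i l * (sqrt (v l) * mpow I S p l j / sqrt (v j)) = sqrt (v i) * (S i l * mpow I S p l j) / sqrt (v j)"
    if "l \<in> I" for l
  proof -
    have r: "v i = sqrt (v i) * sqrt (v i)" using v[OF Suc.prems] by simp
    show ?thesis
      by (subst r) (simp only: S times_divide_eq_right mult_ac)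
  qed
  then show ?case
    unfolding mpow.simps sum_distrib_left sum_divide_distrib by (intro sum.cong refl) (simp only: Suc.IH)
qed

section \<open>Elementary kernels and their antisymmetric part\<close>

lemma box_integral:
  fixes p q r s :: real
  assumes "p \<le> q" "r \<le> s"
  shows "has_bochner_integral lborel (\<lambda>z. indicator {p<..q} (fst z) * indicator {r<..s} (snd z)) ((q - p) * (s - r))"
proof -
  let ?A = "{p<..q} \<times> {r<..s}"
  have em: "emeasure lborel ?A = ennreal ((q - p) * (s - r))"
  proof -
    have "emeasure (lborel \<Otimes>\<^sub>M lborel) ?A = emeasure lborel {p<..q} * emeasure lborel {r<..s}"
      by (rule lborel.emeasure_pair_measure_Times) auto
    then show ?thesis using assms by (simp add: lborel_prod ennreal_mult)
  qed
  have "has_bochner_integral lborel (indicator ?A :: real \<times> real \<Rightarrow> real) (measure lborel ?A)"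
  proof (rule has_bochner_integral_real_indicator)
    have "?A \<in> sets (lborel \<Otimes>\<^sub>M lborel)" by (intro pair_measureI) auto
    then show "?A \<in> sets lborel" by (simp only: lborel_prod)
  qed (simp add: em)
  moreover have "measure lborel ?A = (q - p) * (s - r)"
    unfolding measure_def em using assms by simp
  moreover have "(indicator ?A :: real \<times> real \<Rightarrow> real) = (\<lambda>z. indicator {p<..q} (fst z) * indicator {r<..s} (snd z))"
    by (auto simp: fun_eq_iff indicator_def)
  ultimately show ?thesis by simp
qed

lemma subdivision_mono:
  assumes "subdivision m t" "i \<le> j" "j \<le> m"
  shows "t i \<le> t j"
  using assms(2,3)
proof (induction j rule: dec_induct)
  case (step n)
  then have "t i \<le> t n" "t n < t (Suc n)" using assms(1) by (simp_all add: subdivision_def)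
  then show ?case by simp
qed simp

lemma subdivision_nonneg:
  assumes "subdivision m t" "i \<le> m"
  shows "0 \<le> t i"
  using subdivision_mono[OF assms(1) _ assms(2), of 0] assms(1) by (simp add: subdivision_def)

lemma sum_disjoint_sq:
  fixes b c :: "nat \<Rightarrow> real"
  assumes "\<And>i. b i * b i = b i" "\<And>i k. i < m \<Longrightarrow> k < m \<Longrightarrow> i \<noteq> k \<Longrightarrow> b i * b k = 0"
  shows "(\<Sum>i<m. b i * c i)\<^sup>2 = (\<Sum>i<m. b i * (c i)\<^sup>2)"
proof -
  have "(\<Sum>i<m. b i * c i)\<^sup>2 = (\<Sum>i<m. \<Sum>k<m. (b i * b k) * (c i * c k))"
    by (simp add: power2_eq_square sum_product mult_ac)
  also have "\<dots> = (\<Sum>i<m. \<Sum>k<m. if k = i then b i * (c i)\<^sup>2 else 0)"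
    using assms by (intro sum.cong refl) (auto simp: power2_eq_square)
  also have "\<dots> = (\<Sum>i<m. b i * (c i)\<^sup>2)"
    by (simp add: sum.delta)
  finally show ?thesis .
qed

lemma elementary_kernel_sq:
  assumes "subdivision m t"
  shows "(elementary_kernel m t a z)\<^sup>2 = (\<Sum>i<m. \<Sum>j<m. (a i j)\<^sup>2 *
     (indicator {t i <.. t (Suc i)} (fst z) * indicator {t j <.. t (Suc j)} (snd z)))"
proof -
  define b where "b x i = (indicator {t i <.. t (Suc i)} x :: real)" for x i
  have b1: "b x i * b x i = b x i" for x i by (simp add: b_def indicator_def)
  have b0: "b x i * b x k = 0" if ik: "i < m" "k < m" "i \<noteq> k" for x i k
  proof (cases "i < k")
    case True
    then have "t (Suc i) \<le> t k" using ik by (intro subdivision_mono[OF assms]) auto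
    then show ?thesis by (auto simp: b_def indicator_def)
  next
    case False
    then have "t (Suc k) \<le> t i" using ik by (intro subdivision_mono[OF assms]) auto
    then show ?thesis by (auto simp: b_def indicator_def)
  qed
  have "elementary_kernel m t a z = (\<Sum>i<m. b (fst z) i * (\<Sum>j<m. b (snd z) j * a i j))"
    unfolding elementary_kernel_def b_def sum_distrib_left by (simp only: mult_ac)
  then have "(elementary_kernel m t a z)\<^sup>2 = (\<Sum>i<m. b (fst z) i * (\<Sum>j<m. b (snd z) j * (a i j)\<^sup>2))"
    by (simp add: sum_disjoint_sq[OF b1 b0])
  then show ?thesis unfolding b_def sum_distrib_left by (simp only: mult_ac)
qed

lemma elementary_kernel_sq_integral:
  assumes "subdivision m t"
  shows "has_bochner_integral lborel (\<lambda>z. (elementary_kernel m t a z)\<^sup>2)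
    (\<Sum>i<m. \<Sum>j<m. (a i j)\<^sup>2 * ((t (Suc i) - t i) * (t (Suc j) - t j)))"
  unfolding elementary_kernel_sq[OF assms]
  by (intro has_bochner_integral_sum has_bochner_integral_mult_right box_integral)
     (use assms in \<open>auto simp: subdivision_def less_imp_le\<close>)

lemma lborel_swap: "distr lborel lborel prod.swap = (lborel :: (real \<times> real) measure)"
proof -
  have "(\<lambda>(x, y). (y, x)) = (prod.swap :: real \<times> real \<Rightarrow> _)" by auto
  then show ?thesis
    using lborel_pair.distr_pair_swap[where ?'a = real and ?'b = real] by (simp add: lborel_prod)
qed

lemma elementary_kernel_swap: "elementary_kernel m t a (prod.swap z) = elementary_kernel m t (\<lambda>i j. a j i) z"
  unfolding elementary_kernel_def by (subst sum.swap) (simp add: mult_ac)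

lemma elementary_kernel_measurable [measurable]: "elementary_kernel m t a \<in> borel_measurable borel"
proof -
  have "(\<lambda>z. elementary_kernel m t a z) \<in> borel_measurable (borel \<Otimes>\<^sub>M borel)"
    unfolding elementary_kernel_def by measurable
  then show ?thesis by (simp add: borel_prod)
qed

text \<open>The symmetric f cancels from the antisymmetrized kernel, which is therefore g - f minus
  its reflection. The inequality (x - y)^2 \<le> 2 x^2 + 2 y^2 and invariance of Lebesgue measure
  under the swap give the constant 4.\<close>

lemma elementary_kernel_asymmetry:
  assumes sub: "subdivision m t" and f: "L2_kernel f" "symmetric_kernel f"
  shows "(\<Sum>i<m. \<Sum>j<m. (a i j - a j i)\<^sup>2 * ((t (Suc i) - t i) * (t (Suc j) - t j)))
    \<le> 4 * (LINT z:quadrant|lborel. (elementary_kernel m t a z - f z)\<^sup>2)"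
proof -
  define g where "g = elementary_kernel m t a"
  define e where "e = elementary_kernel m t (\<lambda>i j. a i j - a j i)"
  \<comment> \<open>The hypotheses concern \<open>f\<close> on the quadrant only; extension by zero
    makes integrals and the swap available on the whole plane.\<close>
  define f0 where "f0 z = indicator quadrant z *\<^sub>R f z" for z
  define h where "h z = (g z - f0 z)\<^sup>2" for z
  have f0_meas [measurable]: "f0 \<in> borel_measurable borel"
    using f(1) unfolding L2_kernel_def set_borel_measurable_def f0_def by simp
  have g_meas [measurable]: "g \<in> borel_measurable borel" by (simp add: g_def)
  have h_meas: "h \<in> borel_measurable borel" unfolding h_def by measurable
  have off: "g z = 0" if "z \<notin> quadrant" for z
    unfolding g_def elementary_kernel_def
  proof (intro sum.neutral ballI)
    fix i j assume "i \<in> {..<m}" "j \<in> {..<m}"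
    then have "0 \<le> t i" "0 \<le> t j" using subdivision_nonneg[OF sub] by auto
    then show "a i j * indicator {t i<..t (Suc i)} (fst z) * indicator {t j<..t (Suc j)} (snd z) = 0"
      using that by (cases z) (auto simp: indicator_def)
  qed
  have h_eq: "indicator quadrant z *\<^sub>R (g z - f z)\<^sup>2 = h z" for z
    using off[of z] by (auto simp: h_def f0_def indicator_def)
  have g2: "integrable lborel (\<lambda>z. (g z)\<^sup>2)"
    using elementary_kernel_sq_integral[OF sub, of a] by (simp add: g_def has_bochner_integral_iff)
  have f2: "integrable lborel (\<lambda>z. (f0 z)\<^sup>2)"
  proof -
    have "(\<lambda>z. (f0 z)\<^sup>2) = (\<lambda>z. indicator quadrant z *\<^sub>R (f z)\<^sup>2)"
      by (auto simp: f0_def indicator_def)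
    then show ?thesis using f(1) by (simp add: L2_kernel_def set_integrable_def)
  qed
  have h_int: "integrable lborel h"
  proof (rule Bochner_Integration.integrable_bound)
    show "integrable lborel (\<lambda>z. 2 * (g z)\<^sup>2 + 2 * (f0 z)\<^sup>2)" using g2 f2 by simp
    show "h \<in> borel_measurable lborel" using h_meas by simp
    show "AE z in lborel. norm (h z) \<le> norm (2 * (g z)\<^sup>2 + 2 * (f0 z)\<^sup>2)"
    proof (rule AE_I2)
      fix z
      have "0 \<le> (g z + f0 z)\<^sup>2" by simp
      then have "(g z - f0 z)\<^sup>2 \<le> 2 * (g z)\<^sup>2 + 2 * (f0 z)\<^sup>2"
        by (simp add: power2_eq_square algebra_simps)
      then show "norm (h z) \<le> norm (2 * (g z)\<^sup>2 + 2 * (f0 z)\<^sup>2)" by (simp add: h_def)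
    qed
  qed
  have swap_meas: "prod.swap \<in> measurable lborel (lborel :: (real \<times> real) measure)"
    by (simp add: borel_measurable_continuous_onI continuous_on_swap)
  have hs_int: "integrable lborel (\<lambda>z. h (prod.swap z))"
    using integrable_distr[OF swap_meas, of h] h_int by (simp add: lborel_swap)
  have hs: "(LINT z|lborel. h (prod.swap z)) = (LINT z|lborel. h z)"
    using integral_distr[OF swap_meas, of h] h_meas by (simp add: lborel_swap)
  have e_int: "has_bochner_integral lborel (\<lambda>z. (e z)\<^sup>2) (\<Sum>i<m. \<Sum>j<m. (a i j - a j i)\<^sup>2 * ((t (Suc i) - t i) * (t (Suc j) - t j)))"
    unfolding e_def by (rule elementary_kernel_sq_integral[OF sub])
  have e_eq: "e z = g z - g (prod.swap z)" for z
    unfolding e_def g_def elementary_kernel_swap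
    by (simp add: elementary_kernel_def left_diff_distrib sum_subtractf)
  have "AE z in lborel. f0 z = f0 (prod.swap z)"
    using f(2) unfolding symmetric_kernel_def
    by eventually_elim (auto simp: f0_def indicator_def)
  then have le: "AE z in lborel. (e z)\<^sup>2 \<le> 2 * h z + 2 * h (prod.swap z)"
  proof eventually_elim
    case (elim z)
    have "0 \<le> ((g z - f0 z) + (g (prod.swap z) - f0 (prod.swap z)))\<^sup>2" by simp
    then show ?case unfolding e_eq h_def elim
      by (simp add: power2_eq_square algebra_simps)
  qed
  have "(LINT z|lborel. (e z)\<^sup>2) \<le> (LINT z|lborel. 2 * h z + 2 * h (prod.swap z))"
    using e_int h_int hs_int le by (intro integral_mono_AE) (auto simp: has_bochner_integral_iff)
  also have "\<dots> = 4 * (LINT z|lborel. h z)"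
    using h_int hs_int hs by simp
  also have "(LINT z|lborel. h z) = (LINT z:quadrant|lborel. (g z - f z)\<^sup>2)"
    unfolding set_lebesgue_integral_def h_eq ..
  finally show ?thesis
    using e_int by (simp add: has_bochner_integral_iff g_def)
qed

section \<open>Elementary integrals as quadratic forms in Brownian increments\<close>

context tracial begin

lemma brownian_free_family:
  assumes bm: "free_brownian_motion M \<phi> S" and sub: "subdivision m t"
  shows "free_family M \<phi> {..<m} (\<lambda>i. S (t (Suc i)) - S (t i)) (\<lambda>i. t (Suc i) - t i)"
proof unfold_locales
  fix i assume i: "i \<in> {..<m}"
  then have ti: "0 \<le> t i" "0 \<le> t (Suc i)" "t i < t (Suc i)"
    using subdivision_nonneg[OF sub, of i] subdivision_nonneg[OF sub, of "Suc i"] sub by (auto simp: subdivision_def)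
  then show "S (t (Suc i)) - S (t i) \<in> M"
    using bm by (simp add: free_brownian_motion_def)
  show "\<phi> ((S (t (Suc i)) - S (t i)) ^ Suc n) = of_real (t (Suc i) - t i) *
      (\<Sum>s<n. \<phi> ((S (t (Suc i)) - S (t i)) ^ s) * \<phi> ((S (t (Suc i)) - S (t i)) ^ (n - 1 - s)))" for n
    using bm ti by (intro semicircular_rec) (auto simp: free_brownian_motion_def)
next
  show "freely_independent \<phi> {..<m} (\<lambda>i. S (t (Suc i)) - S (t i))"
    using bm sub by (simp add: free_brownian_motion_def)
qed

lemma brownian_self_adjoint:
  assumes bm: "free_brownian_motion M \<phi> S" and sub: "subdivision m t" and i: "i < m"
  shows "is_adjoint (S (t (Suc i)) - S (t i)) (S (t (Suc i)) - S (t i))"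
proof -
  have "0 \<le> t i" "t i < t (Suc i)"
    using subdivision_nonneg[OF sub, of i] sub i by (auto simp: subdivision_def)
  then have "semicircular \<phi> (t (Suc i) - t i) (S (t (Suc i)) - S (t i))"
    using bm by (simp add: free_brownian_motion_def)
  then show ?thesis by (simp add: semicircular_def self_adjoint_def)
qed

lemma elementary_integral_symmetric:
  assumes bm: "free_brownian_motion M \<phi> S" and sub: "subdivision m t"
    and sym: "\<And>i j. a i j = a j i" and diag: "\<And>i. a i i = 0"
  defines "E \<equiv> elementary_integral S m t a"
  shows "E \<in> M" "is_adjoint E E"
    and "\<exists>l. \<forall>N. \<phi> (E ^ N) = of_real (free_moment (moment_series {..<m} (\<lambda>x. (l x)\<^sup>2) l) N)"
proof -
  define v where "v i = t (Suc i) - t i" for i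
  define X where "X i = S (t (Suc i)) - S (t i)" for i
  interpret free_family M \<phi> "{..<m}" X v
    using brownian_free_family[OF bm sub] unfolding X_def[abs_def] v_def[abs_def] .
  interpret free_quadratic M \<phi> "{..<m}" X v a
    by unfold_locales (use sym in auto)
  have E: "E = F" unfolding E_def elementary_integral_def F_def X_def ..
  show "E \<in> M" by (simp add: E)
  have sa: "is_adjoint (X i) (X i)" if "i < m" for i
    unfolding X_def by (rule brownian_self_adjoint[OF bm sub that])
  have "is_adjoint F (\<Sum>i<m. \<Sum>j<m. a i j *\<^sub>R (X j * X i))"
    unfolding F_def by (intro is_adjoint_sum is_adjoint_scaleR is_adjoint_mult sa) auto
  also have "(\<Sum>i<m. \<Sum>j<m. a i j *\<^sub>R (X j * X i)) = F"
    unfolding F_def by (subst sum.swap) (simp add: sym)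
  finally show "is_adjoint E E" by (simp add: E)
  have v: "v i > 0" if "i \<in> {..<m}" for i
    using sub that by (simp add: subdivision_def v_def)
  define T where "T i j = sqrt (v i) * a i j * sqrt (v j)" for i j
  obtain l where l: "\<And>p. (\<Sum>i<m. mpow {..<m} T p i i) = (\<Sum>x<m. l x ^ p)"
    using symmetric_trace_eigenvalues[of m T] by (auto simp: T_def sym)
  have "mpow {..<m} B p i i = mpow {..<m} T p i i" if "i \<in> {..<m}" for p i
  proof -
    have "mpow {..<m} (\<lambda>i j. v i * a i j) p i i = sqrt (v i) * mpow {..<m} T p i i / sqrt (v i)"
      by (rule mpow_conjugate[OF v that that]) (simp_all add: T_def)
    then show ?thesis using v[OF that] by (simp add: B_def[abs_def])
  qed
  then have tr: "(\<Sum>i<m. mpow {..<m} B p i i) = (\<Sum>x<m. l x ^ p)" for p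
    by (simp add: l)
  have "Abs_fps (\<lambda>n. \<Sum>k<m. mpow {..<m} B (n + 2) k k) = moment_series {..<m} (\<lambda>x. (l x)\<^sup>2) l"
    unfolding tr by (rule fps_ext) (simp add: moment_series_nth power2_eq_square mult_ac)
  moreover have "\<phi> (F ^ N) = of_real (free_moment (Abs_fps (\<lambda>n. \<Sum>k<m. mpow {..<m} B (n + 2) k k)) N)" for N
    by (rule moments_quadratic) (simp add: diag)
  ultimately show "\<exists>l. \<forall>N. \<phi> (E ^ N) = of_real (free_moment (moment_series {..<m} (\<lambda>x. (l x)\<^sup>2) l) N)"
    unfolding E by auto
qed

text \<open>The approximating kernels may be asymmetric, while the eigenvalue description needs a
  symmetric matrix. Symmetrizing costs the antisymmetric part, whose L2 norm is controlled by
  \<open>sqnorm_quadratic\<close> and \<open>elementary_kernel_asymmetry\<close>.\<close>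

lemma elementary_integral_symmetrize:
  assumes bm: "free_brownian_motion M \<phi> S" and sub: "subdivision m t" and diag: "\<And>i. a i i = 0"
    and f: "L2_kernel f" "symmetric_kernel f" and F: "F \<in> M"
  defines "s \<equiv> \<lambda>i j. (a i j + a j i) / 2"
  shows "sqnorm (elementary_integral S m t s - F) \<le> 2 * sqnorm (elementary_integral S m t a - F)
    + 2 * (LINT z:quadrant|lborel. (elementary_kernel m t a z - f z)\<^sup>2)"
proof -
  define v where "v i = t (Suc i) - t i" for i
  define X where "X i = S (t (Suc i)) - S (t i)" for i
  interpret free_family M \<phi> "{..<m}" X v
    using brownian_free_family[OF bm sub] unfolding X_def[abs_def] v_def[abs_def] .
  define d where "d i j = (a i j - a j i) / 2" for i j
  define D where "D = (\<Sum>i<m. \<Sum>j<m. d i j *\<^sub>R (X i * X j))"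
  have el: "elementary_integral S m t c = (\<Sum>i<m. \<Sum>j<m. c i j *\<^sub>R (X i * X j))" for c
    by (simp add: elementary_integral_def X_def)
  have el_M: "elementary_integral S m t c \<in> M" for c
    unfolding el by (auto intro!: M_sum simp: X_M)
  have D_M: "D \<in> M" unfolding D_def by (auto intro!: M_sum simp: X_M)
  have "elementary_integral S m t a - elementary_integral S m t s = D"
    unfolding el D_def sum_subtractf[symmetric]
    by (intro sum.cong refl) (simp add: s_def d_def field_simps flip: scaleR_left_diff_distrib)
  then have e: "elementary_integral S m t s - F = (elementary_integral S m t a - F) - D"
    by (simp add: algebra_simps)
  have "sqnorm (elementary_integral S m t s - F) \<le> 2 * sqnorm (elementary_integral S m t a - F) + 2 * sqnorm D"
    unfolding e by (intro sqnorm_diff_le M_minus el_M F D_M)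
  also have "sqnorm D \<le> (LINT z:quadrant|lborel. (elementary_kernel m t a z - f z)\<^sup>2)"
  proof -
    have "sqnorm D = (\<Sum>i<m. \<Sum>j<m. (d i j)\<^sup>2 * (v i * v j))"
      unfolding D_def
      by (rule sqnorm_quadratic) (auto simp: d_def X_def intro: brownian_self_adjoint[OF bm sub])
    also have "\<dots> = (\<Sum>i<m. \<Sum>j<m. (a i j - a j i)\<^sup>2 * (v i * v j)) / 4"
      by (simp add: d_def power_divide sum_divide_distrib)
    finally show ?thesis
      using elementary_kernel_asymmetry[OF sub f, of a] by (simp add: v_def)
  qed
  finally show ?thesis by simp
qed

end

lemma free_moment_2: "free_moment (f :: real fps) 2 = f $ 0"
proof -
  have "{k::nat. 2 * k \<le> 2} = {0, 1}" by auto
  then show ?thesis by (simp add: free_moment_expand)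
qed

lemma free_moment_4: "free_moment (f :: real fps) 4 = f $ 2 + 2 * (f $ 0)\<^sup>2"
proof -
  have "{k::nat. 2 * k \<le> 4} = {0, 1, 2}" by auto
  then show ?thesis by (simp add: free_moment_expand fps_nth_power_0 choose_two)
qed

context tracial begin

text \<open>L2 convergence bounds the second moments \<open>g k $ 0\<close>, which bound all
  cumulants and hence all moments of the approximants. Then \<open>moments_tendsto\<close> applies,
  and \<open>cumulants_convergent\<close> supplies the limit series f.\<close>

lemma chaos_moments:
  assumes bm: "free_brownian_motion M \<phi> S" and chaos: "F \<in> second_wigner_chaos M \<phi> S"
  shows "\<exists>f g m (l :: nat \<Rightarrow> nat \<Rightarrow> real). (\<forall>N. \<phi> (F ^ N) = of_real (free_moment f N)) \<and>
    (\<forall>i. g i = moment_series {..<m i} (\<lambda>a. (l i a)\<^sup>2) (l i)) \<and> (\<forall>n. (\<lambda>i. g i $ n) \<longlonglongrightarrow> f $ n)"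
proof -
  obtain ker where F: "F \<in> M" and ker: "L2_kernel ker" "symmetric_kernel ker" and "is_wigner_integral2 \<phi> S ker F"
    using chaos by (auto simp: second_wigner_chaos_def)
  then obtain m t a where sub: "\<And>k. subdivision (m k) (t k)" and diag: "\<And>k i. a k i i = (0::real)"
    and k0: "(\<lambda>k. LINT z:quadrant|lborel. (elementary_kernel (m k) (t k) (a k) z - ker z)\<^sup>2) \<longlonglongrightarrow> 0"
    and e0: "(\<lambda>k. \<phi> (adj (elementary_integral S (m k) (t k) (a k) - F) *
                  (elementary_integral S (m k) (t k) (a k) - F))) \<longlonglongrightarrow> 0"
    unfolding is_wigner_integral2_def by blast
  define s where "s k i j = (a k i j + a k j i) / 2" for k i j
  define E where "E k = elementary_integral S (m k) (t k) (s k)" for k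
  have E: "E k \<in> M" "is_adjoint (E k) (E k)"
    "\<exists>l. \<forall>N. \<phi> (E k ^ N) = of_real (free_moment (moment_series {..<m k} (\<lambda>x. (l x)\<^sup>2) l) N)" for k
    unfolding E_def
    using elementary_integral_symmetric[OF bm sub, of "s k" k] by (auto simp: s_def diag add.commute)
  obtain l where l: "\<And>k N. \<phi> (E k ^ N) = of_real (free_moment (moment_series {..<m k} (\<lambda>x. (l k x)\<^sup>2) (l k)) N)"
    using E(3) by metis
  define g where "g k = moment_series {..<m k} (\<lambda>x. (l k x)\<^sup>2) (l k)" for k
  have g: "\<phi> (E k ^ N) = of_real (free_moment (g k) N)" for k N
    unfolding g_def by (rule l)
  have conv: "(\<lambda>k. sqnorm (E k - F)) \<longlonglongrightarrow> 0"
  proof (rule tendsto_sandwich[of "\<lambda>_. 0" _ sequentially "\<lambda>k. 2 * sqnorm (elementary_integral S (m k) (t k) (a k) - F)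
       + 2 * (LINT z:quadrant|lborel. (elementary_kernel (m k) (t k) (a k) z - ker z)\<^sup>2)"])
    have "(\<lambda>k. sqnorm (elementary_integral S (m k) (t k) (a k) - F)) \<longlonglongrightarrow> 0"
      using tendsto_Re[OF e0] by (simp add: sqnorm_def)
    then have "(\<lambda>k. 2 * sqnorm (elementary_integral S (m k) (t k) (a k) - F)
       + 2 * (LINT z:quadrant|lborel. (elementary_kernel (m k) (t k) (a k) z - ker z)\<^sup>2)) \<longlonglongrightarrow> 2 * 0 + 2 * 0"
      by (intro tendsto_intros k0)
    then show "(\<lambda>k. 2 * sqnorm (elementary_integral S (m k) (t k) (a k) - F)
       + 2 * (LINT z:quadrant|lborel. (elementary_kernel (m k) (t k) (a k) z - ker z)\<^sup>2)) \<longlonglongrightarrow> 0"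
      by simp
    show "\<forall>\<^sub>F k in sequentially. sqnorm (E k - F) \<le> 2 * sqnorm (elementary_integral S (m k) (t k) (a k) - F)
       + 2 * (LINT z:quadrant|lborel. (elementary_kernel (m k) (t k) (a k) z - ker z)\<^sup>2)"
      unfolding E_def s_def[abs_def]
      by (intro always_eventually allI elementary_integral_symmetrize[OF bm sub diag ker F])
    show "\<forall>\<^sub>F k in sequentially. 0 \<le> sqnorm (E k - F)"
      using E(1) F by (intro always_eventually allI sqnorm_nonneg) auto
    show "(\<lambda>k. 0::real) \<longlonglongrightarrow> 0" by simp
  qed
  have bound: "\<exists>C. \<forall>k. cmod (\<phi> (E k ^ N)) \<le> C" for N
  proof -
    obtain C0 where C0: "\<And>k. norm (sqnorm (E k - F)) \<le> C0"
      using convergent_imp_Bseq[OF convergentI[OF conv]] by (auto simp: Bseq_def)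
    define K where "K = 2 * C0 + 2 * sqnorm (- F)"
    have gK: "g k $ 0 \<le> K" for k
    proof -
      have "sqnorm (E k) = Re (\<phi> (E k ^ 2))"
        by (simp add: sqnorm_def adj_eq[OF E(2)] power2_eq_square)
      then have "g k $ 0 = sqnorm ((E k - F) - (- F))"
        by (simp add: g free_moment_2)
      also have "\<dots> \<le> 2 * sqnorm (E k - F) + 2 * sqnorm (- F)"
        using E(1) F by (intro sqnorm_diff_le) auto
      finally show ?thesis using C0[of k] by (simp add: K_def)
    qed
    have g0: "0 \<le> g k $ 0" for k
      by (auto simp: g_def moment_series_nth intro!: sum_nonneg)
    have K0: "K \<ge> 0" using g0[of 0] gK[of 0] by simp
    \<comment> \<open>A majorant of the cumulants: the squared eigenvalues sum to at most K \<le> (K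
      + 1)^2, so each eigenvalue is at most K + 1 in absolute value.\<close>
    define b where "b = Abs_fps (\<lambda>j. K * (K + 1) ^ j)"
    have "\<bar>g k $ j\<bar> \<le> b $ j" for k j
    proof -
      have lk: "\<bar>l k x\<bar> \<le> K + 1" if "x < m k" for x
      proof -
        have "(l k x)\<^sup>2 \<le> (\<Sum>x<m k. (l k x)\<^sup>2)"
          using that by (intro member_le_sum) auto
        also have "\<dots> \<le> K" using gK[of k] by (simp add: g_def moment_series_nth)
        also have "K \<le> (K + 1)\<^sup>2" using K0 by (simp add: power2_eq_square algebra_simps)
        finally show ?thesis using K0 abs_le_square_iff[of "l k x" "K + 1"] by simp
      qed
      have "\<bar>g k $ j\<bar> \<le> (\<Sum>x<m k. \<bar>(l k x)\<^sup>2 * l k x ^ j\<bar>)"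
        unfolding g_def moment_series_nth by (rule sum_abs)
      also have "\<dots> \<le> (\<Sum>x<m k. (l k x)\<^sup>2 * (K + 1) ^ j)"
        using lk by (intro sum_mono) (auto simp: abs_mult power_abs intro!: mult_left_mono power_mono)
      also have "\<dots> = g k $ 0 * (K + 1) ^ j"
        by (simp add: g_def moment_series_nth sum_distrib_right)
      also have "\<dots> \<le> K * (K + 1) ^ j"
        using gK[of k] K0 by (intro mult_right_mono) auto
      finally show ?thesis by (simp add: b_def)
    qed
    then have "cmod (\<phi> (E k ^ N)) \<le> free_moment b N" for k
      unfolding g by (simp add: free_moment_abs_le)
    then show ?thesis by blast
  qed
  have lim: "(\<lambda>k. \<phi> (E k ^ N)) \<longlonglongrightarrow> \<phi> (F ^ N)" for N
    by (rule moments_tendsto[OF F E(1,2) conv bound])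
  have "(\<lambda>k. free_moment (g k) N) \<longlonglongrightarrow> Re (\<phi> (F ^ N))" for N
    using tendsto_Re[OF lim[of N]] by (simp add: g)
  then have "convergent (\<lambda>k. g k $ n)" for n
    by (intro cumulants_convergent) (auto simp: convergent_def)
  then have "\<exists>y. (\<lambda>k. g k $ n) \<longlonglongrightarrow> y" for n
    by (simp add: convergent_def)
  then obtain y where y: "\<And>n. (\<lambda>k. g k $ n) \<longlonglongrightarrow> y n" by metis
  define f where "f = Abs_fps y"
  have f: "(\<lambda>k. g k $ n) \<longlonglongrightarrow> f $ n" for n
    using y by (simp add: f_def)
  have "\<phi> (F ^ N) = of_real (free_moment f N)" for N
  proof (rule LIMSEQ_unique[OF lim])
    show "(\<lambda>k. \<phi> (E k ^ N)) \<longlonglongrightarrow> of_real (free_moment f N)"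
      unfolding g by (intro tendsto_of_real free_moment_tendsto f)
  qed
  then show ?thesis using f g_def by blast
qed

lemma tetilla_moments:
  assumes X: "\<And>i. i \<in> {1, 2} \<Longrightarrow> X i \<in> M \<and> semicircular \<phi> 1 (X i)"
    and free: "freely_independent \<phi> {1, 2} (X :: nat \<Rightarrow> _)"
  shows "\<phi> (((1 / sqrt 2) *\<^sub>R ((X 1)\<^sup>2 - (X 2)\<^sup>2)) ^ N) = of_real (free_moment (geo2 (1/2)) N)"
proof -
  define r where "r = 1 / sqrt (2::real)"
  have r2: "r\<^sup>2 = 1 / 2" by (simp add: r_def power_divide)
  \<comment> \<open>The trace r - r is zero, so the constants in the squares minus 1 cancel and the
    pure quadratic form is already centered.\<close>
  define a where "a i j = (if i = j then if i = 1 then r else - r else 0)" for i j :: nat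
  interpret free_quadratic M \<phi> "{1, 2}" X "\<lambda>_. 1" a
  proof unfold_locales
    fix i :: nat and n assume i: "i \<in> {1, 2}"
    show "\<phi> (X i ^ Suc n) = of_real 1 * (\<Sum>s<n. \<phi> (X i ^ s) * \<phi> (X i ^ (n - 1 - s)))"
      using X[OF i] by (intro semicircular_rec) auto
  qed (use X free in \<open>auto simp: a_def\<close>)
  have F: "F = r *\<^sub>R ((X 1)\<^sup>2 - (X 2)\<^sup>2)"
    unfolding F_def by (simp add: a_def power2_eq_square scaleR_diff_right)
  have B: "mpow {1, 2} B p i j = (if i = j then a i i ^ p else 0)" if "i \<in> {1, 2}" for p i j
    using that by (induction p arbitrary: i) (auto simp: B_def a_def)
  have "Abs_fps (\<lambda>n. \<Sum>k\<in>{1, 2}. mpow {1, 2} B (n + 2) k k) = geo2 (1/2)"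
  proof (rule fps_ext)
    fix n
    have "(\<Sum>k\<in>{1, 2}. mpow {1, 2} B (n + 2) k k) = r ^ (n + 2) + (- r) ^ (n + 2)"
      using B[of 1 "n + 2" 1] B[of 2 "n + 2" 2] by (simp add: a_def del: mpow.simps power_Suc)
    also have "\<dots> = (if even n then (1/2) ^ (n div 2) else 0)"
    proof (cases "even n")
      case True
      then obtain q where q: "n = 2 * q" by blast
      have "r ^ (n + 2) = (r\<^sup>2) ^ (q + 1)" "(- r) ^ (n + 2) = (r\<^sup>2) ^ (q + 1)"
        unfolding q by (simp_all add: power_mult power2_eq_square)
      then show ?thesis unfolding r2 by (simp add: q)
    next
      case False
      then show ?thesis by simp
    qed
    finally show "Abs_fps (\<lambda>n. \<Sum>k\<in>{1, 2}. mpow {1, 2} B (n + 2) k k) $ n = geo2 (1/2) $ n"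
      by (simp add: geo2_nth del: mpow.simps)
  qed
  moreover have "\<phi> (F ^ N) = of_real (free_moment (Abs_fps (\<lambda>n. \<Sum>k\<in>{1, 2}. mpow {1, 2} B (n + 2) k k)) N)"
    by (rule moments_quadratic) (simp add: a_def)
  ultimately show ?thesis
    unfolding F r_def by (simp only:)
qed

end

text \<open>\<open>is_law\<close> sees an operator only through its moments, so both definite
  descriptions are of the same predicate.\<close>

lemma law_cong: "(\<And>n. \<phi> (A ^ n) = \<phi> (B ^ n)) \<Longrightarrow> law \<phi> A = law \<phi> B"
  by (simp add: law_def is_law_def)

theorem theorem4p1:
  fixes M :: "'h::chilbert_space bop set"
    and \<phi> :: "'h bop \<Rightarrow> complex"
    and S :: "real \<Rightarrow> 'h bop"
    and X :: "nat \<Rightarrow> 'h bop"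
    and F Finf :: "'h bop"
  assumes "free_probability_space M \<phi>"
    and "free_brownian_motion M \<phi> S"
    and "\<forall>i\<in>{1, 2}. X i \<in> M \<and> semicircular \<phi> 1 (X i)"
    and "freely_independent \<phi> {1, 2} X"
    and "Finf = (1 / sqrt 2) *\<^sub>R ((X 1)\<^sup>2 - (X 2)\<^sup>2)"
    and "F \<in> second_wigner_chaos M \<phi> S"
    and "\<phi> (F ^ 2) = \<phi> (Finf ^ 2)"
    and "Re (\<phi> (F ^ 4)) \<ge> Re (\<phi> (Finf ^ 4))"
  shows "\<phi> (Finf ^ 2) = 1 \<and> \<phi> (Finf ^ 4) = 5 / 2 \<and>
    (\<forall>n::nat. n \<ge> 1 \<longrightarrow> Re (\<phi> (F ^ (2 * n))) \<ge> Re (\<phi> (Finf ^ (2 * n)))) \<and>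
    ((\<exists>n::nat. n \<ge> 3 \<and> Re (\<phi> (F ^ (2 * n))) = Re (\<phi> (Finf ^ (2 * n))))
      \<longrightarrow> law \<phi> F = law \<phi> Finf)"
proof -
  interpret tracial M \<phi> by unfold_locales (rule assms(1))
  have Finf: "\<phi> (Finf ^ N) = of_real (free_moment (geo2 (1/2)) N)" for N
    unfolding assms(5) using assms(3,4) by (intro tetilla_moments) auto
  obtain f g m and l :: "nat \<Rightarrow> nat \<Rightarrow> real" where F: "\<And>N. \<phi> (F ^ N) = of_real (free_moment f N)"
    and g: "\<And>i. g i = moment_series {..<m i} (\<lambda>a. (l i a)\<^sup>2) (l i)" "\<And>n. (\<lambda>i. g i $ n) \<longlonglongrightarrow> f $ n"
    using chaos_moments[OF assms(2,6)] by blast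
  have Finf2: "\<phi> (Finf ^ 2) = 1" and Finf4: "\<phi> (Finf ^ 4) = 5 / 2"
    by (simp_all add: Finf free_moment_2 free_moment_4 geo2_nth)
  have f0: "f $ 0 = 1"
  proof -
    have "complex_of_real (f $ 0) = 1"
      using assms(7) unfolding Finf2 F free_moment_2 .
    then show ?thesis by (simp only: of_real_eq_1_iff)
  qed
  \<comment> \<open>The fourth moment is \<open>f $ 2 + 2\<close>, so the threshold 5/2 is the lower
    bound 1/2 for the second moment of the eigenvalue measure.\<close>
  have f2: "f $ 2 \<ge> 1 / 2"
    using assms(8) unfolding Finf4 F free_moment_4 by (simp add: f0)
  note extremal = tetilla_extremal[OF g f0 f2]
  have "law \<phi> F = law \<phi> Finf" if "n \<ge> 3" "Re (\<phi> (F ^ (2 * n))) = Re (\<phi> (Finf ^ (2 * n)))" for n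
  proof (rule law_cong)
    have "f = geo2 (1/2)"
      using that by (intro extremal(2)[of n]) (simp_all add: F Finf)
    then show "\<phi> (F ^ N) = \<phi> (Finf ^ N)" for N by (simp only: F Finf)
  qed
  moreover have "Re (\<phi> (Finf ^ (2 * n))) \<le> Re (\<phi> (F ^ (2 * n)))" for n
    using extremal(1)[of n] by (simp add: F Finf)
  ultimately show ?thesis using Finf2 Finf4 by blast
qed

end
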